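(* Let $n\ge2$, let $X$ be a one-dimensional Peano continuum, $y_0\in X$, $\{x_j\}_{j\in\mathbb{N}}$ a sequence in $X$, each $(A_j,a_j)$ sequentially $(n-1)$-connected and $\pi_n$-residual, $Y=\operatorname{\bf Adj}(X,x_j,A_j,a_j)$, with generalized universal covering $p:\widetilde Y\to Y$, $\widetilde X=p^{-1}(X)$, the group $G$ and the injective homomorphism $\widetilde\Phi:\pi_n(\widetilde Y,\widetilde y_0)\to G$ as in the context. An element $g\in G$ lies in $\operatorname{Im}(\widetilde{\Phi})$ if and only if (1) the closure $\overline{\operatorname{supp}(g)}$ in $\widetilde X$ is compact, and (2) for every $j\in\mathbb{N}$, either $\operatorname{supp}(g_j)$ is finite, or $\operatorname{supp}(g_j)$ is countably infinite and there exist an enumeration $\operatorname{supp}(g_j)=\{[\alpha_1],[\alpha_2],\dots\}$ and a based map $h:(\mathbb{H}_n,b_0)\to(A_j,a_j)$ with $g(j,[\alpha_i])=[h\circ\ell_i]$ for all $i\in\mathbb{N}$.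
   Context: All spaces Hausdorff; $I=[0,1]$; Peano continuum = connected, locally path-connected compact metric space; one-dimensional = covering dimension one. $\operatorname{\bf Adj}(X,x_j,A_j,a_j)$: $Y_k$ is the adjunction space obtained from $X\sqcup A_1\sqcup\dots\sqcup A_k$ by $a_j\sim x_j$ ($j\le k$), $\rho_{k+1,k}$ collapses $A_{k+1}$ to $x_{k+1}$, and the space is $\varprojlim_kY_k\subseteq\prod_kY_k$ with underlying set $(X\sqcup\coprod_jA_j)/(a_j\sim x_j)$. Shrinking wedge: one-point union where $U$ is open iff it meets each summand in an open set and, if it contains the wedge point, contains all but finitely many summands. $\mathbb{H}_0=\{0\}\cup\{1/m\}$ based at $0$; $\mathbb{H}_k$ ($k\ge1$) is the shrinking wedge of countably many copies of $(S^k,e_k)$ with wedge point $b_0$, $\ell_i:S^k\to\mathbb{H}_k$ the $i$-th inclusion. $X$ is sequentially $m$-connected at $x$ if the set of based homotopy classes $[(\mathbb{H}_k,b_0),(X,x)]$ is a singleton for all $0\le k\le m$; $\pi_n$-residual at $x$ if $[f]\mapsto([f\circ\ell_i])_i$, $[(\mathbb{H}_n,b_0),(X,x)]\to\pi_n(X,x)^{\mathbb{N}}$, is injective. $\widetilde Y$: path-homotopy classes $[\alpha]$ of paths in $Y$ from $y_0$ with the whisker topology (basic sets $\{[\alpha\cdot\epsilon]:\epsilon(I)\subseteq U\}$, $U$ open about $\alpha(1)$), basepoint $\widetilde y_0$ = class of constant path, $p([\alpha])=\alpha(1)$; this is a simply connected generalized universal covering. $p^{-1}(x_j)=\{[\alpha]:\alpha(1)=x_j\}$.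 For $[\alpha]\in p^{-1}(x_j)$, $\mathcal{A}_{j,[\alpha]}=\{[\alpha\cdot\epsilon]:\epsilon$ a path in $A_j$ with $\epsilon(0)=a_j\}$, with canonical retraction $r_{j,[\alpha]}:\widetilde Y\to\mathcal A_{j,[\alpha]}$ constant at $[\alpha]$ off $\mathcal A_{j,[\alpha]}$; $p$ induces an identification $\pi_n(\mathcal{A}_{j,[\alpha]},[\alpha])=\pi_n(A_j,a_j)$. Let $G=\prod_{j\in\mathbb{N}}\prod_{[\alpha]\in p^{-1}(x_j)}\pi_n(A_j,a_j)$, with elements written $g=(g(j,[\alpha]))$, and $\widetilde\Phi([f])=([r_{j,[\alpha]}\circ f])_{j,[\alpha]}$ under this identification. For $g\in G$: $\operatorname{supp}(g)=\{[\alpha]\in\widetilde X: g(j,[\alpha])\neq0\text{ for some }j\}$; $g_j\in G$ agrees with $g$ at indices $(j,[\alpha])$ and is $0$ elsewhere; $\operatorname{supp}(g_j)=\{[\alpha]\in p^{-1}(x_j):g(j,[\alpha])\ne0\}$. *)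

theory Defs
  imports "HOL-Analysis.Analysis"
begin

definition covering_dim_le :: "'a topology \<Rightarrow> nat \<Rightarrow> bool" where
  "covering_dim_le X d \<longleftrightarrow>
    (\<forall>\<U>. finite \<U> \<and> (\<forall>U\<in>\<U>. openin X U) \<and> \<Union>\<U> = topspace X \<longrightarrow>
      (\<exists>\<V>. finite \<V> \<and> (\<forall>V\<in>\<V>. openin X V) \<and> \<Union>\<V> = topspace X \<and>
           (\<forall>V\<in>\<V>. \<exists>U\<in>\<U>. V \<subseteq> U) \<and>
           (\<forall>p\<in>topspace X. card {V\<in>\<V>. p \<in> V} \<le> d + 1)))"

definition one_dimensional :: "'a topology \<Rightarrow> bool" where
  "one_dimensional X \<longleftrightarrow> covering_dim_le X 1 \<and> \<not> covering_dim_le X 0"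

definition peano_continuum :: "'a topology \<Rightarrow> bool" where
  "peano_continuum X \<longleftrightarrow> connected_space X \<and> locally_path_connected_space X \<and>
     compact_space X \<and> metrizable_space X"

definition based_map :: "'a topology \<Rightarrow> 'a \<Rightarrow> 'b topology \<Rightarrow> 'b \<Rightarrow> ('a \<Rightarrow> 'b) \<Rightarrow> bool" where
  "based_map H b A a f \<longleftrightarrow> continuous_map H A f \<and> f b = a"

definition bclass :: "'a topology \<Rightarrow> 'a \<Rightarrow> 'b topology \<Rightarrow> 'b \<Rightarrow> ('a \<Rightarrow> 'b) \<Rightarrow> ('a \<Rightarrow> 'b) set" where
  "bclass H b A a f = {g. based_map H b A a g \<and> homotopic_with (\<lambda>k. k b = a) H A f g}"

definition bclasses :: "'a topology \<Rightarrow> 'a \<Rightarrow> 'b topology \<Rightarrow> 'b \<Rightarrow> ('a \<Rightarrow> 'b) set set" where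
  "bclasses H b A a = {bclass H b A a f | f. based_map H b A a f}"

definition sph_base :: "nat \<Rightarrow> real" where
  "sph_base = (\<lambda>i. if i = 0 then 1 else 0)"

definition pi_n :: "nat \<Rightarrow> 'b topology \<Rightarrow> 'b \<Rightarrow> ((nat \<Rightarrow> real) \<Rightarrow> 'b) set set" where
  "pi_n n A a = bclasses (nsphere n) sph_base A a"

definition pi_zero :: "nat \<Rightarrow> 'b topology \<Rightarrow> 'b \<Rightarrow> ((nat \<Rightarrow> real) \<Rightarrow> 'b) set" where
  "pi_zero n A a = bclass (nsphere n) sph_base A a (\<lambda>_. a)"

definition H0 :: "real topology" where
  "H0 = subtopology euclideanreal ({0} \<union> {1 / real m | m. m \<ge> 1})"

text \<open>Shrinking wedge of countably many copies of (S^k,e_k), k >= 1.  Points are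
(i,s), s in S^k - {e_k}, in the i-th summand, together with the wedge point (0,e_k).\<close>
definition wedge_pt :: "nat \<times> (nat \<Rightarrow> real)" where
  "wedge_pt = (0, sph_base)"

definition wedge_incl :: "nat \<Rightarrow> (nat \<Rightarrow> real) \<Rightarrow> nat \<times> (nat \<Rightarrow> real)" where
  "wedge_incl i s = (if s = sph_base then wedge_pt else (i, s))"

definition wedge_carrier :: "nat \<Rightarrow> (nat \<times> (nat \<Rightarrow> real)) set" where
  "wedge_carrier k = (\<Union>i. wedge_incl i ` topspace (nsphere k))"

definition Hwedge :: "nat \<Rightarrow> (nat \<times> (nat \<Rightarrow> real)) topology" where
  "Hwedge k = topology_generated_by
     {U. U \<subseteq> wedge_carrier k \<and>
         (\<forall>i. openin (nsphere k) {s \<in> topspace (nsphere k). wedge_incl i s \<in> U}) \<and>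
         (wedge_pt \<in> U \<longrightarrow> finite {i. \<not> wedge_incl i ` topspace (nsphere k) \<subseteq> U})}"

definition seq_connected :: "nat \<Rightarrow> 'b topology \<Rightarrow> 'b \<Rightarrow> bool" where
  "seq_connected m A a \<longleftrightarrow> is_singleton (bclasses H0 0 A a) \<and>
     (\<forall>k\<in>{1..m}. is_singleton (bclasses (Hwedge k) wedge_pt A a))"

definition pi_residual :: "nat \<Rightarrow> 'b topology \<Rightarrow> 'b \<Rightarrow> bool" where
  "pi_residual n A a \<longleftrightarrow>
     (\<forall>f g. based_map (Hwedge n) wedge_pt A a f \<longrightarrow> based_map (Hwedge n) wedge_pt A a g \<longrightarrow>
        (\<forall>i. bclass (nsphere n) sph_base A a (f \<circ> wedge_incl i)
             = bclass (nsphere n) sph_base A a (g \<circ> wedge_incl i)) \<longrightarrow>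
        bclass (Hwedge n) wedge_pt A a f = bclass (Hwedge n) wedge_pt A a g)"

text \<open>Points: Inl z for z in X, Inr (j,b) for b in A_j - {a_j}; a_j is identified with x_j.
Indices j range over nat (starting at 0); Y_k contains A_j for j < k.\<close>
definition adj_incl :: "(nat \<Rightarrow> 'a) \<Rightarrow> (nat \<Rightarrow> 'b) \<Rightarrow> nat \<Rightarrow> 'b \<Rightarrow> 'a + nat \<times> 'b" where
  "adj_incl x a j b = (if b = a j then Inl (x j) else Inr (j, b))"

definition adj_carrier :: "'a topology \<Rightarrow> (nat \<Rightarrow> 'b topology) \<Rightarrow> (nat \<Rightarrow> 'a) \<Rightarrow> (nat \<Rightarrow> 'b)
     \<Rightarrow> nat set \<Rightarrow> ('a + nat \<times> 'b) set" where
  "adj_carrier X A x a K = Inl ` topspace X \<union> (\<Union>j\<in>K. adj_incl x a j ` topspace (A j))"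

text \<open>Y_k: quotient topology of X + A_0 + ... + A_(k-1) under a_j ~ x_j\<close>
definition adj_stage :: "'a topology \<Rightarrow> (nat \<Rightarrow> 'b topology) \<Rightarrow> (nat \<Rightarrow> 'a) \<Rightarrow> (nat \<Rightarrow> 'b)
     \<Rightarrow> nat \<Rightarrow> ('a + nat \<times> 'b) topology" where
  "adj_stage X A x a k = topology_generated_by
     {U. U \<subseteq> adj_carrier X A x a {..<k} \<and>
         openin X {z \<in> topspace X. Inl z \<in> U} \<and>
         (\<forall>j<k. openin (A j) {b \<in> topspace (A j). adj_incl x a j b \<in> U})}"

definition adj_collapse :: "(nat \<Rightarrow> 'a) \<Rightarrow> nat \<Rightarrow> 'a + nat \<times> 'b \<Rightarrow> 'a + nat \<times> 'b" where
  "adj_collapse x k y = (case y of Inl z \<Rightarrow> Inl z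
                          | Inr (j, b) \<Rightarrow> (if j < k then Inr (j, b) else Inl (x j)))"

text \<open>the inverse limit, realised on its underlying set with the subspace topology of the
product of the Y_k via y |-> (rho_k(y))_k\<close>
definition adj_space :: "'a topology \<Rightarrow> (nat \<Rightarrow> 'b topology) \<Rightarrow> (nat \<Rightarrow> 'a) \<Rightarrow> (nat \<Rightarrow> 'b)
     \<Rightarrow> ('a + nat \<times> 'b) topology" where
  "adj_space X A x a = pullback_topology (adj_carrier X A x a UNIV)
     (\<lambda>y k. adj_collapse x k y) (product_topology (adj_stage X A x a) UNIV)"

definition pcat :: "(real \<Rightarrow> 'y) \<Rightarrow> (real \<Rightarrow> 'y) \<Rightarrow> real \<Rightarrow> 'y" where
  "pcat \<alpha> \<epsilon> t = (if t \<le> 1/2 then \<alpha> (2 * t) else \<epsilon> (2 * t - 1))"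

definition pclass :: "'y topology \<Rightarrow> (real \<Rightarrow> 'y) \<Rightarrow> (real \<Rightarrow> 'y) set" where
  "pclass Y \<alpha> = {\<beta>. pathin Y \<beta> \<and> \<beta> 0 = \<alpha> 0 \<and> \<beta> 1 = \<alpha> 1 \<and>
      homotopic_with (\<lambda>h. h 0 = \<alpha> 0 \<and> h 1 = \<alpha> 1) (top_of_set {0..1}) Y \<alpha> \<beta>}"

definition gcov_carrier :: "'y topology \<Rightarrow> 'y \<Rightarrow> (real \<Rightarrow> 'y) set set" where
  "gcov_carrier Y y0 = {pclass Y \<alpha> | \<alpha>. pathin Y \<alpha> \<and> \<alpha> 0 = y0}"

definition gcov_proj :: "(real \<Rightarrow> 'y) set \<Rightarrow> 'y" where
  "gcov_proj c = (SOME \<alpha>. \<alpha> \<in> c) 1"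

definition whisker_nbhd :: "'y topology \<Rightarrow> (real \<Rightarrow> 'y) set \<Rightarrow> 'y set \<Rightarrow> (real \<Rightarrow> 'y) set set" where
  "whisker_nbhd Y c U = {pclass Y (pcat \<alpha> \<epsilon>) | \<alpha> \<epsilon>.
      \<alpha> \<in> c \<and> pathin (subtopology Y U) \<epsilon> \<and> \<epsilon> 0 = \<alpha> 1}"

definition gcov :: "'y topology \<Rightarrow> 'y \<Rightarrow> (real \<Rightarrow> 'y) set topology" where
  "gcov Y y0 = topology_generated_by
     {whisker_nbhd Y c U | c U. c \<in> gcov_carrier Y y0 \<and> openin Y U \<and> gcov_proj c \<in> U}"

definition gcov_base :: "'y topology \<Rightarrow> 'y \<Rightarrow> (real \<Rightarrow> 'y) set" where
  "gcov_base Y y0 = pclass Y (\<lambda>_. y0)"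

definition gcov_fiber :: "'y topology \<Rightarrow> 'y \<Rightarrow> 'y \<Rightarrow> (real \<Rightarrow> 'y) set set" where
  "gcov_fiber Y y0 y = {c \<in> gcov_carrier Y y0. gcov_proj c = y}"

context
  fixes X :: "'a topology" and A :: "nat \<Rightarrow> 'b topology"
    and x :: "nat \<Rightarrow> 'a" and a :: "nat \<Rightarrow> 'b" and y0 :: 'a
begin

definition AdjY :: "('a + nat \<times> 'b) topology" where
  "AdjY = adj_space X A x a"

definition fiberj :: "nat \<Rightarrow> (real \<Rightarrow> 'a + nat \<times> 'b) set set" where
  "fiberj j = gcov_fiber AdjY (Inl y0) (Inl (x j))"

definition liftA :: "nat \<Rightarrow> (real \<Rightarrow> 'a + nat \<times> 'b) set \<Rightarrow> (real \<Rightarrow> 'a + nat \<times> 'b) set set" where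
  "liftA j c = {pclass AdjY (pcat \<alpha> (adj_incl x a j \<circ> \<delta>)) | \<alpha> \<delta>.
      \<alpha> \<in> c \<and> pathin (A j) \<delta> \<and> \<delta> 0 = a j}"

definition retr :: "nat \<Rightarrow> (real \<Rightarrow> 'a + nat \<times> 'b) set
     \<Rightarrow> (real \<Rightarrow> 'a + nat \<times> 'b) set \<Rightarrow> (real \<Rightarrow> 'a + nat \<times> 'b) set" where
  "retr j c z = (if z \<in> liftA j c then z else c)"

text \<open>Phi~([f]) for f : (S^n,e_n) -> (Y~,y~0); the (j,[alpha]) coordinate is the class of
r_{j,[alpha]} o f, transported to pi_n(A_j,a_j) via p (and the embedding A_j -> Y).
Outside the index set the value is undefined (extensional product).\<close>
definition Phi :: "nat \<Rightarrow> ((nat \<Rightarrow> real) \<Rightarrow> (real \<Rightarrow> 'a + nat \<times> 'b) set)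
     \<Rightarrow> nat \<Rightarrow> (real \<Rightarrow> 'a + nat \<times> 'b) set \<Rightarrow> ((nat \<Rightarrow> real) \<Rightarrow> 'b) set" where
  "Phi n f = (\<lambda>j c. if c \<in> fiberj j then
      bclass (nsphere n) sph_base (A j) (a j)
        (\<lambda>s. inv_into (topspace (A j)) (adj_incl x a j) (gcov_proj (retr j c (f s))))
      else undefined)"

definition Gset :: "nat \<Rightarrow> (nat \<Rightarrow> (real \<Rightarrow> 'a + nat \<times> 'b) set \<Rightarrow> ((nat \<Rightarrow> real) \<Rightarrow> 'b) set) set" where
  "Gset n = {g. \<forall>j c. (c \<in> fiberj j \<longrightarrow> g j c \<in> pi_n n (A j) (a j)) \<and>
                       (c \<notin> fiberj j \<longrightarrow> g j c = undefined)}"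

definition ImPhi :: "nat \<Rightarrow> (nat \<Rightarrow> (real \<Rightarrow> 'a + nat \<times> 'b) set \<Rightarrow> ((nat \<Rightarrow> real) \<Rightarrow> 'b) set) set" where
  "ImPhi n = Phi n ` {f. based_map (nsphere n) sph_base (gcov AdjY (Inl y0)) (gcov_base AdjY (Inl y0)) f}"

definition Xtilde :: "(real \<Rightarrow> 'a + nat \<times> 'b) set topology" where
  "Xtilde = subtopology (gcov AdjY (Inl y0))
      {c \<in> gcov_carrier AdjY (Inl y0). gcov_proj c \<in> Inl ` topspace X}"

definition supp :: "nat \<Rightarrow> (nat \<Rightarrow> (real \<Rightarrow> 'a + nat \<times> 'b) set \<Rightarrow> ((nat \<Rightarrow> real) \<Rightarrow> 'b) set)
     \<Rightarrow> (real \<Rightarrow> 'a + nat \<times> 'b) set set" where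
  "supp n g = {c. \<exists>j. c \<in> fiberj j \<and> g j c \<noteq> pi_zero n (A j) (a j)}"

definition suppj :: "nat \<Rightarrow> (nat \<Rightarrow> (real \<Rightarrow> 'a + nat \<times> 'b) set \<Rightarrow> ((nat \<Rightarrow> real) \<Rightarrow> 'b) set)
     \<Rightarrow> nat \<Rightarrow> (real \<Rightarrow> 'a + nat \<times> 'b) set set" where
  "suppj n g j = {c \<in> fiberj j. g j c \<noteq> pi_zero n (A j) (a j)}"

end

end

theory Submission
  imports Defs
begin

text \<open>
Y carries the initial topology for the retractions \<open>q : Y \<rightarrow> X\<close> and \<open>r j : Y \<rightarrow> A j\<close>.  Sequential
1-connectedness contracts all excursions of a path into a summand \<open>A j\<close> simultaneously, so a path in Y
with ends in X is homotopic to its projection to X.  Hence the topology of the covering over X is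
governed by the relation ``joined by a lift of a path in X of diameter less than \<open>e\<close>''.

If \<open>g = \<Phi>(f)\<close>, the sets where the \<open>(j, c)\<close>-coordinate of f leaves the base point are open and disjoint for
fixed j, so compactness of the sphere gives condition (2); moreover the support of g lies in the closure
of the compact part of the image of f over X, and closures of compact sets are compact because
the small-path relation makes this space regular.

Conversely, the closure of the support being compact, there is a path over X that rests at every point
of the support during an interval of its own: the rest positions are chosen in a Cantor-like set so that
close positions belong to close points, and the gaps are filled with small paths.
Composing with a height function on the sphere gives a map that is constant on bands, in each of which a
ball carrying the prescribed element of the homotopy group of \<open>A j\<close> is inserted.
\<close>

section \<open>Gluing and spheres\<close>

text \<open>The difficulty is continuity where infinitely many pieces accumulate. It arises twice,
  for the homotopy that contracts infinitely many excursions and for the sphere map that carries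
  infinitely many balls, and \<open>continuous_map_glue_family\<close> treats both. Contracting the
  excursions one by one would leave their homotopies unrelated; a single null-homotopy on the
  Hawaiian earring makes all but finitely many of them small. For the balls smallness has two
  sources: the limit topology puts the whole of \<open>A j\<close> into a given neighbourhood for
  late j with \<open>x j\<close> close enough, and for each of the finitely many early j condition
  (2) leaves only finitely many large representatives. The small-path relation is handled like a
  distance, through the axioms of \<open>small_rel\<close>. Limits in it are chosen and not claimed
  to be unique. Accordingly the support is located in the closure of a compact set and not in that
  set: where a coordinate of f returns to its base point, f reaches a point over X that is joined to
  c by lifts of arbitrarily small paths, and the proof does not claim that this point is c.\<close>

lemma openin_topology_generated_by_closed:
  assumes "{} \<in> S" "\<And>U V. U \<in> S \<Longrightarrow> V \<in> S \<Longrightarrow> U \<inter> V \<in> S" "\<And>K. K \<subseteq> S \<Longrightarrow> \<Union>K \<in> S"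
  shows "openin (topology_generated_by S) U \<longleftrightarrow> U \<in> S"
proof
  assume "openin (topology_generated_by S) U"
  then have "generate_topology_on S U" by (rule openin_topology_generated_by)
  then show "U \<in> S"
    by induction (use assms in \<open>auto simp: subset_iff\<close>)
qed (rule topology_generated_by_Basis)

text \<open>The sets \<open>B i\<close> may accumulate, so local finiteness is replaced by
  \<open>small\<close>: near a point outside all of them, all but finitely many pieces take values
  in the given neighbourhood V. The finitely many exceptions are controlled one at a time by
  \<open>bd\<close>.\<close>

lemma continuous_map_glue_family:
  assumes cont0: "continuous_map Z T Fb"
    and contF: "\<And>i. i \<in> I \<Longrightarrow> continuous_map Z T (F i)"
    and op: "\<And>i. i \<in> I \<Longrightarrow> openin Z (B i)"
    and bd: "\<And>i z. i \<in> I \<Longrightarrow> z \<in> Z closure_of (B i) \<Longrightarrow> z \<notin> B i \<Longrightarrow> F i z = Fb z"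
    and small: "\<And>z V. z \<in> topspace Z \<Longrightarrow> z \<notin> (\<Union>i\<in>I. B i) \<Longrightarrow> openin T V \<Longrightarrow> Fb z \<in> V \<Longrightarrow>
        \<exists>W J. openin Z W \<and> z \<in> W \<and> finite J \<and> (\<forall>i\<in>I-J. \<forall>w\<in>W \<inter> B i. F i w \<in> V)"
    and eqB: "\<And>i z. i \<in> I \<Longrightarrow> z \<in> B i \<Longrightarrow> G z = F i z"
    and eq0: "\<And>z. z \<in> topspace Z \<Longrightarrow> z \<notin> (\<Union>i\<in>I. B i) \<Longrightarrow> G z = Fb z"
  shows "continuous_map Z T G"
  unfolding continuous_map_eq_topcontinuous_at
proof
  fix z assume z: "z \<in> topspace Z"
  have B_sub: "B i \<subseteq> topspace Z" if "i \<in> I" for i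
    using op[OF that] openin_subset by blast
  have Gin: "G w \<in> topspace T" if "w \<in> topspace Z" for w
  proof (cases "w \<in> (\<Union>i\<in>I. B i)")
    case True
    then obtain i where "i \<in> I" "w \<in> B i" by auto
    then show ?thesis using continuous_map_image_subset_topspace[OF contF[of i]] eqB that by force
  next
    case False
    then show ?thesis using continuous_map_image_subset_topspace[OF cont0] eq0 that by force
  qed
  show "topcontinuous_at Z T G z"
    unfolding topcontinuous_at_def
  proof (intro conjI allI impI)
    show "z \<in> topspace Z" by fact
    show "G \<in> topspace Z \<rightarrow> topspace T" using Gin by auto
    fix V assume V: "openin T V \<and> G z \<in> V"
    show "\<exists>U. openin Z U \<and> z \<in> U \<and> (\<forall>y\<in>U. G y \<in> V)"
    proof (cases "z \<in> (\<Union>i\<in>I. B i)")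
      case True
      then obtain i where i: "i \<in> I" "z \<in> B i" by auto
      let ?U = "B i \<inter> {w \<in> topspace Z. F i w \<in> V}"
      have "openin Z ?U" using op[OF i(1)] openin_continuous_map_preimage[OF contF[OF i(1)]] V by blast
      moreover have "z \<in> ?U" using i z V eqB by auto
      moreover have "\<forall>y\<in>?U. G y \<in> V" using eqB[OF i(1)] by auto
      ultimately show ?thesis by blast
    next
      case False
      then have F0V: "Fb z \<in> V" using V eq0[OF z] by auto
      obtain W J where W: "openin Z W" "z \<in> W" "finite J" "\<forall>i\<in>I-J. \<forall>w\<in>W \<inter> B i. F i w \<in> V"
        using small[OF z False _ F0V] V by blast
      \<comment> \<open>For an exceptional index: if z lies on the boundary of \<open>B i\<close>,
        then \<open>F i z = Fb z\<close> and continuity of \<open>F i\<close> suffices; otherwise a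
        neighbourhood of z misses \<open>B i\<close>.\<close>
      define N where "N i = (if z \<in> Z closure_of (B i) then {w \<in> topspace Z. F i w \<in> V}
                             else topspace Z - Z closure_of (B i))" for i
      have N: "openin Z (N i)" "z \<in> N i" if "i \<in> I" for i
      proof -
        show "openin Z (N i)"
          using openin_continuous_map_preimage[OF contF[OF that]] V by (auto simp: N_def)
        show "z \<in> N i" using bd[OF that] False that z F0V by (auto simp: N_def)
      qed
      define U where "U = W \<inter> {w \<in> topspace Z. Fb w \<in> V} \<inter> (topspace Z \<inter> (\<Inter>i\<in>J\<inter>I. N i))"
      have "openin Z (topspace Z \<inter> (\<Inter>i\<in>J\<inter>I. N i))"
        using W(3) N(1) by (cases "J \<inter> I = {}") (auto intro!: openin_Int openin_INT)
      then have "openin Z U"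
        using W(1) openin_continuous_map_preimage[OF cont0] V unfolding U_def by blast
      moreover have "z \<in> U" using W(2) F0V N(2) z by (auto simp: U_def)
      moreover have "G y \<in> V" if y: "y \<in> U" for y
      proof (cases "y \<in> (\<Union>i\<in>I. B i)")
        case True
        then obtain i where i: "i \<in> I" "y \<in> B i" by auto
        have "F i y \<in> V"
        proof (cases "i \<in> J")
          case True
          then have "y \<in> N i" using y i by (auto simp: U_def)
          moreover have "y \<in> Z closure_of (B i)" using closure_of_subset[OF B_sub[OF i(1)]] i(2) by auto
          ultimately show ?thesis by (auto simp: N_def split: if_splits)
        qed (use W(4) i y U_def in auto)
        then show ?thesis using eqB i by auto
      next
        case False
        then show ?thesis using eq0 y by (auto simp: U_def)
      qed
      ultimately show ?thesis by blast
    qed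
  qed
qed

section \<open>Coordinates, compactness and homotopies of the spheres\<close>

lemma topspace_nsphere: "topspace (nsphere n) = {x. (\<Sum>i\<le>n. x i ^ 2) = 1 \<and> (\<forall>i>n. x i = 0)}"
  by (simp add: nsphere)

lemma continuous_map_into_nsphere:
  "continuous_map Z (nsphere n) f \<longleftrightarrow>
     (\<forall>k. continuous_map Z euclideanreal (\<lambda>z. f z k)) \<and> f ` topspace Z \<subseteq> topspace (nsphere n)"
  by (auto simp: nsphere continuous_map_in_subtopology continuous_map_componentwise_UNIV)

lemma sph_base_in_nsphere: "sph_base \<in> topspace (nsphere n)"
  using in_topspace_nsphere[of n] by (simp add: sph_base_def)

lemma nsphere_coord_bound:
  assumes "z \<in> topspace (nsphere n)" shows "\<bar>z k\<bar> \<le> 1"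
proof (cases "k \<le> n")
  case True
  have "z k ^ 2 \<le> (\<Sum>i\<le>n. z i ^ 2)"
    using True by (intro member_le_sum) auto
  then show ?thesis using assms by (simp add: topspace_nsphere abs_square_le_1)
qed (use assms in \<open>auto simp: topspace_nsphere\<close>)

text \<open>The sphere is closed in a product of copies of the interval from -1 to 1, which is
  compact by Tychonoff.\<close>

lemma compact_space_nsphere: "compact_space (nsphere n)"
proof -
  let ?S = "{x::nat\<Rightarrow>real. (\<Sum>i\<le>n. x i ^ 2) = 1 \<and> (\<forall>i>n. x i = 0)}"
  have "compactin (powertop_real UNIV) (PiE UNIV (\<lambda>_. {-1..1::real}))"
    by (subst compactin_PiE) (auto simp: compactin_euclidean_iff)
  moreover have "?S \<subseteq> PiE UNIV (\<lambda>_. {-1..1::real})"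
    using nsphere_coord_bound[of _ n] by (auto simp: topspace_nsphere abs_le_iff minus_le_iff)
  moreover have "closedin (powertop_real UNIV) ?S"
  proof -
    have c: "continuous_map (powertop_real UNIV) euclideanreal (\<lambda>x. x (i::nat))" for i
      by (rule continuous_map_product_projection) auto
    have 1: "closedin (powertop_real UNIV) {x \<in> topspace (powertop_real UNIV). (\<Sum>i\<le>n. x i ^ 2) \<in> {1}}"
      by (rule closedin_continuous_map_preimage[where Y=euclideanreal])
         (auto intro!: continuous_intros c)
    have 2: "closedin (powertop_real UNIV) {x \<in> topspace (powertop_real UNIV). x (i::nat) \<in> {0}}" for i
      by (rule closedin_continuous_map_preimage[OF c]) auto
    have "?S = {x \<in> topspace (powertop_real UNIV). (\<Sum>i\<le>n. x i ^ 2) \<in> {1}} \<inter>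
       (\<Inter>i\<in>{Suc n..}. {x \<in> topspace (powertop_real UNIV). x (i::nat) \<in> {0}})"
      by (auto simp: Suc_le_eq)
    then show ?thesis by (metis (no_types, lifting) 1 2 closedin_Int closedin_INT atLeast_iff le_refl empty_iff)
  qed
  ultimately have "compactin (powertop_real UNIV) ?S"
    by (rule closed_compactin)
  then show ?thesis by (simp add: nsphere compact_space_subtopology)
qed

text \<open>The type class topology on \<open>nat => real\<close> is the product topology, so facts
  about \<open>continuous_on\<close> and about second countable types become applicable to the
  sphere.\<close>

lemma nsphere_eq_top_of_set: "nsphere n = top_of_set (topspace (nsphere n))"
  unfolding topspace_nsphere by (simp add: nsphere euclidean_product_topology)

lemma continuous_map_homotopy_into_nsphere:
  fixes h :: "real \<times> (nat \<Rightarrow> real) \<Rightarrow> nat \<Rightarrow> real"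
  assumes "\<And>k. continuous_on ({0..1} \<times> topspace (nsphere m)) (\<lambda>z. h z k)"
    and "\<And>z. z \<in> {0..1} \<times> topspace (nsphere m) \<Longrightarrow> h z \<in> topspace (nsphere n)"
  shows "continuous_map (prod_topology (top_of_set {0..1}) (nsphere m)) (nsphere n) h"
proof -
  have e: "prod_topology (top_of_set {0..1::real}) (nsphere m) =
      top_of_set ({0..1} \<times> topspace (nsphere m))"
    by (subst nsphere_eq_top_of_set) (simp add: subtopology_Times flip: euclidean_product_topology prod_topology_euclidean)
  have "continuous_map (prod_topology (top_of_set {0..1}) (nsphere m)) euclideanreal (\<lambda>z. h z k)" for k
    unfolding e continuous_map_iff_continuous by (rule assms(1))
  then show ?thesis
    unfolding continuous_map_into_nsphere using assms(2) by auto
qed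

lemma continuous_on_apply_snd: "continuous_on S (\<lambda>z::real \<times> (nat \<Rightarrow> real). snd z i)"
proof -
  have "continuous_on UNIV (\<lambda>z::nat \<Rightarrow> real. z i)" by simp
  from continuous_on_compose2[OF this continuous_on_snd[OF continuous_on_id]] show ?thesis by auto
qed

section \<open>Pinching the sphere onto a narrow band\<close>

definition sph_rot :: "real \<Rightarrow> (nat \<Rightarrow> real) \<Rightarrow> nat \<Rightarrow> real" where
  "sph_rot \<omega> z i = (if i = 0 then cos \<omega> * z 0 - sin \<omega> * z 1
     else if i = 1 then sin \<omega> * z 0 + cos \<omega> * z 1 else z i)"

lemma sum_atMost_split_two:
  fixes f :: "nat \<Rightarrow> real"
  assumes "n \<ge> 1" shows "(\<Sum>i\<le>n. f i) = f 0 + f 1 + (\<Sum>i\<in>{2..n}. f i)"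
proof -
  have "{..n} = insert 0 (insert 1 {2..n})" using assms by auto
  then show ?thesis by (simp add: add.assoc)
qed

lemma sum_atMost_split_one:
  fixes f :: "nat \<Rightarrow> real" shows "(\<Sum>i\<le>n. f i) = f 0 + (\<Sum>i\<in>{1..n}. f i)"
proof -
  have "{..n} = insert 0 {1..n}" by auto
  then show ?thesis by simp
qed

lemma sph_rot_in_nsphere:
  assumes "n \<ge> 1" "z \<in> topspace (nsphere n)" shows "sph_rot \<omega> z \<in> topspace (nsphere n)"
proof -
  have "(cos \<omega> * z 0 - sin \<omega> * z 1)\<^sup>2 + (sin \<omega> * z 0 + cos \<omega> * z 1)\<^sup>2
      = (cos \<omega> ^ 2 + sin \<omega> ^ 2) * (z 0 ^ 2 + z 1 ^ 2)"
    by (simp only: power2_eq_square) algebra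
  then have "(\<Sum>i\<le>n. (sph_rot \<omega> z i)\<^sup>2) = (\<Sum>i\<le>n. (z i)\<^sup>2)"
    by (simp add: sum_atMost_split_two[OF assms(1)] sph_rot_def add.commute)
  then show ?thesis using assms by (auto simp: topspace_nsphere sph_rot_def)
qed

text \<open>Writing u = 1 + z 0, this stretches the cap u < 2/a over the sphere minus the base point
and sends the rest to the base point when t = 1; it is the identity when t = 0.  The factors p, q
satisfy u p + (2 - u) q = 2, which keeps the image on the sphere.\<close>
definition sph_spread :: "real \<Rightarrow> real \<Rightarrow> (nat \<Rightarrow> real) \<Rightarrow> nat \<Rightarrow> real" where
  "sph_spread a t z i =
    (let u = 1 + z 0;
         p = (1 - t) + t * (2 / max u (2 / a));
         q = (1 - t) + t * (max (2 - a * u) 0 / max (2 - u) (2 - 2 / a))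
     in if i = 0 then u * p - 1 else sqrt (p * q) * z i)"

text \<open>With u = 1 + z 0 the remaining coordinates have square sum u (2 - u). The new first
  coordinate is u p - 1 and the new remainder is p q u (2 - u) = (u p)(2 - u p), so the squares add
  up to 1 by the relation between p and q.\<close>

lemma sph_spread_in_nsphere:
  assumes "a > 1" "t \<in> {0..1}" "z \<in> topspace (nsphere n)"
  shows "sph_spread a t z \<in> topspace (nsphere n)"
proof -
  define u where "u = 1 + z 0"
  define p where "p = (1 - t) + t * (2 / max u (2 / a))"
  define q where "q = (1 - t) + t * (max (2 - a * u) 0 / max (2 - u) (2 - 2 / a))"
  have a: "2 / a > 0" "2 - 2 / a > 0" "a > 0" using assms(1) by (auto simp: field_simps)
  have "max u (2 / a) > 0" using a(1) by (simp add: less_max_iff_disj)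
  then have "p \<ge> 0" unfolding p_def using assms(2) by (intro add_nonneg_nonneg mult_nonneg_nonneg) auto
  moreover have "q \<ge> 0" unfolding q_def using assms(2) a
    by (intro add_nonneg_nonneg mult_nonneg_nonneg divide_nonneg_nonneg) auto
  ultimately have pq: "p * q \<ge> 0" by simp
  define A where "A = 2 / max u (2 / a)"
  define B where "B = max (2 - a * u) 0 / max (2 - u) (2 - 2 / a)"
  \<comment> \<open>\<open>A\<close> and \<open>B\<close> are the values of the two factors p and q
    at t = 1. At t = 0 both factors are 1 and the relation is trivial; it is affine in t, so it
    holds for every t.\<close>
  have "u * A + (2 - u) * B = 2"
  proof (cases "u \<le> 2 / a")
    case True
    then have "max u (2/a) = 2/a" "max (2 - u) (2 - 2/a) = 2 - u" "max (2 - a * u) 0 = 2 - a * u"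
      "2 - u \<noteq> 0" using a by (auto simp: field_simps)
    then have "A = a" "(2 - u) * B = 2 - a * u" using a by (auto simp: A_def B_def)
    then show ?thesis by simp
  next
    case False
    then have "max u (2/a) = u" "max (2 - a * u) 0 = 0" "u > 0" using a order.strict_trans[OF a(1)] by (auto simp: field_simps)
    then show ?thesis by (simp add: A_def B_def)
  qed
  moreover have "u * p + (2 - u) * q = (1 - t) * 2 + t * (u * A + (2 - u) * B)"
    unfolding p_def q_def A_def[symmetric] B_def[symmetric] by (simp add: algebra_simps)
  ultimately have upq: "u * p + (2 - u) * q = 2" by simp
  have s: "(\<Sum>i\<le>n. (z i)\<^sup>2) = 1" "\<forall>i>n. z i = 0" using assms(3) by (auto simp: topspace_nsphere)
  have rest: "(\<Sum>i\<in>{1..n}. (z i)\<^sup>2) = 1 - (z 0)^2" using s(1) by (simp add: sum_atMost_split_one)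
  have sp: "sph_spread a t z i = (if i = 0 then u * p - 1 else sqrt (p * q) * z i)" for i
    by (simp add: sph_spread_def u_def p_def q_def Let_def)
  have "(\<Sum>i\<in>{1..n}. (sqrt (p * q) * z i)\<^sup>2) = (p * q) * (1 - (z 0)^2)"
    using pq rest by (simp add: power_mult_distrib flip: sum_distrib_left)
  then have "(\<Sum>i\<le>n. (sph_spread a t z i)\<^sup>2) = (u * p - 1)^2 + (p * q) * (1 - (z 0)^2)"
    by (simp add: sum_atMost_split_one sp)
  also have "\<dots> = (u * p - 1)^2 + (u * p) * ((2 - u) * q)"
    by (simp add: u_def power2_eq_square algebra_simps)
  also have "(2 - u) * q = 2 - u * p" using upq by linarith
  also have "(u * p - 1)^2 + (u * p) * (2 - u * p) = 1" by (simp add: power2_eq_square algebra_simps)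
  finally show ?thesis using s(2) by (auto simp: topspace_nsphere sp)
qed

lemma sph_spread_0 [simp]: "sph_spread a 0 z = z"
  by (auto simp: sph_spread_def Let_def fun_eq_iff)

text \<open>Here p = 2 / u and q = 0, so the first coordinate becomes 1 and the others
  vanish.\<close>

lemma sph_spread_outside_cap:
  assumes "a > 1" "z \<in> topspace (nsphere n)" "1 + z 0 \<ge> 2 / a"
  shows "sph_spread a 1 z = sph_base"
proof -
  have "1 + z 0 > 0" using assms(1,3) by (smt (verit) divide_pos_pos)
  moreover have "a * (1 + z 0) \<ge> 2" using assms by (simp add: field_simps)
  ultimately show ?thesis using assms
    by (auto simp: sph_spread_def Let_def sph_base_def fun_eq_iff max_def field_simps)
qed

lemma sph_spread_base:
  assumes "a > 1" "t \<in> {0..1}" shows "sph_spread a t sph_base = sph_base"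
proof -
  have "max 2 (2 / a) = 2" using assms by (auto simp: field_simps max_def)
  then show ?thesis by (auto simp: sph_spread_def Let_def sph_base_def fun_eq_iff)
qed

lemma continuous_on_sph_spread:
  assumes "a > 1" "continuous_on S f" "\<And>i. continuous_on S (\<lambda>z. g z i)"
  shows "continuous_on S (\<lambda>z. sph_spread a (f z) (g z) i)"
proof -
  have a: "2 / a > 0" "2 - 2 / a > 0" using assms(1) by (auto simp: field_simps)
  have nz: "max u (2 / a) \<noteq> 0" "max v (2 - 2 / a) \<noteq> 0" for u v using a by (auto simp: max_def)
  show ?thesis
    unfolding sph_spread_def Let_def
    by (cases "i = 0") (use nz in \<open>auto intro!: continuous_intros assms(2,3)\<close>)
qed

text \<open>\<open>\<kappa>\<close> rotates a point at height \<open>\<tau>\<close> to the antipode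
  of the base point and then spreads a small cap around the antipode over the sphere. The height
  \<open>(1 - s 0) / 2\<close> is 0 at the base point. The homotopy to the identity first undoes the
  rotation and then the spreading; precomposing a based map with \<open>\<kappa>\<close> therefore
  keeps its class and concentrates it in the band.\<close>

lemma nsphere_pinch:
  assumes n: "n \<ge> 1" and \<tau>: "0 < \<tau>" "\<tau> < 1" and \<rho>: "0 < \<rho>"
  obtains \<kappa> where "continuous_map (nsphere n) (nsphere n) \<kappa>"
    "homotopic_with (\<lambda>k. k sph_base = sph_base) (nsphere n) (nsphere n) \<kappa> id"
    "\<And>s. s \<in> topspace (nsphere n) \<Longrightarrow> \<kappa> s \<noteq> sph_base \<Longrightarrow> \<bar>(1 - s 0) / 2 - \<tau>\<bar> < \<rho>"
proof -
  let ?S = "nsphere n" and ?P = "\<lambda>k. k sph_base = (sph_base :: nat \<Rightarrow> real)"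
  \<comment> \<open>With this angle the point whose first two coordinates are 1 - 2 \<tau> and sin
    \<omega> has height \<tau> and is rotated to the antipode of \<open>sph_base\<close>.\<close>
  define \<omega> where "\<omega> = arccos (2 * \<tau> - 1)"
  have cos: "cos \<omega> = 2 * \<tau> - 1" unfolding \<omega>_def using \<tau> by (intro cos_arccos) auto
  have \<omega>: "0 \<le> \<omega>" "\<omega> \<le> pi" unfolding \<omega>_def using \<tau> by (auto intro: arccos_lbound arccos_ubound)
  \<comment> \<open>Each bound has one use: 1 gives \<open>a > 1\<close>, \<open>2 * \<tau>\<close>
    keeps the base point out of the cap during the rotation, and \<open>2 * \<rho>^2\<close>
    confines the cap to heights within \<open>\<rho>\<close> of \<open>\<tau>\<close>.\<close>
  define \<eta> where "\<eta> = min 1 (min (2 * \<tau>) (2 * \<rho>^2))"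
  have \<eta>: "0 < \<eta>" "\<eta> \<le> 1" "\<eta> \<le> 2 * \<tau>" "\<eta> \<le> 2 * \<rho>^2" using \<tau> \<rho> by (auto simp: \<eta>_def)
  define a where "a = 2 / \<eta>"
  have a: "a > 1" "2 / a = \<eta>" using \<eta> by (auto simp: a_def field_simps)
  define \<kappa> where "\<kappa> s = sph_spread a 1 (sph_rot \<omega> s)" for s
  have crot: "continuous_on S (\<lambda>z. sph_rot (f z * \<omega>) (snd z) i)"
    if "continuous_on S f" for S i and f :: "real \<times> (nat \<Rightarrow> real) \<Rightarrow> real"
    unfolding sph_rot_def
    by (cases "i = 0"; cases "i = 1") (auto intro!: continuous_intros continuous_on_apply_snd that)
  have h1: "homotopic_with ?P ?S ?S \<kappa> (sph_spread a 1)"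
    unfolding homotopic_with_def
  proof (intro exI conjI)
    let ?h = "\<lambda>z. sph_spread a 1 (sph_rot ((1 - fst z) * \<omega>) (snd z))"
    show "continuous_map (prod_topology (top_of_set {0..1}) ?S) ?S ?h"
      by (rule continuous_map_homotopy_into_nsphere)
        (auto intro!: continuous_on_sph_spread a crot continuous_intros sph_spread_in_nsphere sph_rot_in_nsphere n)
    show "\<forall>x. ?h (0, x) = \<kappa> x" by (auto simp: \<kappa>_def)
    show "\<forall>x. ?h (1, x) = sph_spread a 1 x"
      by (auto simp: sph_rot_def fun_eq_iff intro!: arg_cong2[where f="sph_spread a 1"])
    show "\<forall>t\<in>{0..1}. ?P (\<lambda>x. ?h (t, x))"
    proof (clarsimp)
      fix t :: real assume t: "0 \<le> t" "t \<le> 1"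
      \<comment> \<open>The first coordinate of the rotated base point is cos ((1 - t) \<omega>),
        which is never below cos \<omega> = 2 \<tau> - 1, so the base point stays outside the
        cap.\<close>
      have "(1 - t) * \<omega> \<le> 1 * \<omega>" using t \<omega> by (intro mult_right_mono) auto
      then have "cos ((1 - t) * \<omega>) \<ge> cos \<omega>" using t \<omega> by (intro cos_monotone_0_pi_le) auto
      then have "1 + sph_rot ((1 - t) * \<omega>) sph_base 0 \<ge> 2 / a"
        using cos \<eta> a by (simp add: sph_rot_def sph_base_def)
      then show "sph_spread a 1 (sph_rot ((1 - t) * \<omega>) sph_base) = sph_base"
        using sph_spread_outside_cap[OF a(1) sph_rot_in_nsphere[OF n sph_base_in_nsphere]] by auto
    qed
  qed
  have h2: "homotopic_with ?P ?S ?S (sph_spread a 1) id"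
    unfolding homotopic_with_def
  proof (intro exI conjI)
    let ?h = "\<lambda>z. sph_spread a (1 - fst z) (snd z)"
    show "continuous_map (prod_topology (top_of_set {0..1}) ?S) ?S ?h"
      by (rule continuous_map_homotopy_into_nsphere)
        (auto intro!: continuous_on_sph_spread a continuous_intros sph_spread_in_nsphere continuous_on_apply_snd)
  qed (use a sph_spread_base in auto)
  have h: "homotopic_with ?P ?S ?S \<kappa> id" by (rule homotopic_with_trans[OF h1 h2])
  show thesis
  proof
    show "continuous_map ?S ?S \<kappa>" using homotopic_with_imp_continuous_maps[OF h] by simp
    show "homotopic_with ?P ?S ?S \<kappa> id" by fact
    fix s assume s: "s \<in> topspace ?S" "\<kappa> s \<noteq> sph_base"
    define w where "w = sin \<omega>"
    have "1 + sph_rot \<omega> s 0 < \<eta>"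
      using sph_spread_outside_cap[OF a(1) sph_rot_in_nsphere[OF n s(1)]] s(2) a(2)
      by (force simp: \<kappa>_def)
    then have 1: "1 + (2 * \<tau> - 1) * s 0 - w * s 1 < \<eta>" by (simp add: sph_rot_def cos w_def)
    have w2: "w^2 + (2 * \<tau> - 1)^2 = 1" using sin_cos_squared_add[of \<omega>] by (simp add: w_def cos)
    have "(\<Sum>i\<in>{2..n}. (s i)\<^sup>2) \<ge> 0" by (intro sum_nonneg) auto
    then have "(s 0)^2 + (s 1)^2 \<le> 1"
      using s(1) by (simp add: topspace_nsphere sum_atMost_split_two[OF n])
    \<comment> \<open>The left side is the squared distance, in the first two coordinates, from s to
      the point that the rotation carries to the centre of the cap.\<close>
    then have "(s 0 + (2 * \<tau> - 1))^2 + (s 1 - w)^2 < 2 * \<eta>"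
      using 1 w2 by (simp add: power2_eq_square algebra_simps)
    then have "(s 0 + (2 * \<tau> - 1))^2 < 2 * \<eta>" by (smt (verit) zero_le_power2)
    then have "(s 0 + (2 * \<tau> - 1))^2 < (2 * \<rho>)^2" using \<eta>(4) by (simp add: power_mult_distrib)
    then have "\<bar>s 0 + (2 * \<tau> - 1)\<bar> < 2 * \<rho>"
      using abs_le_square_iff[of "2 * \<rho>" "s 0 + (2 * \<tau> - 1)"] \<rho> by auto
    then show "\<bar>(1 - s 0) / 2 - \<tau>\<bar> < \<rho>" by (simp add: abs_less_iff field_simps)
  qed
qed

section \<open>Local path connectedness and path connectedness of the spheres\<close>

definition sph_normalize :: "nat \<Rightarrow> (nat \<Rightarrow> real) \<Rightarrow> nat \<Rightarrow> real" where
  "sph_normalize n z i = z i / sqrt (\<Sum>i\<le>n. (z i)\<^sup>2)"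

definition punctured_space :: "nat \<Rightarrow> (nat \<Rightarrow> real) topology" where
  "punctured_space n = subtopology (Euclidean_space (Suc n)) {z. (\<Sum>i\<le>n. (z i)\<^sup>2) > 0}"

lemma topspace_punctured_space:
  "topspace (punctured_space n) = {z. (\<forall>i>n. z i = 0) \<and> (\<Sum>i\<le>n. (z i)\<^sup>2) > 0}"
  by (auto simp: punctured_space_def topspace_Euclidean_space Suc_le_eq)

lemma retraction_maps_sph_normalize:
  "retraction_maps (punctured_space n) (nsphere n) (sph_normalize n) id"
  unfolding retraction_maps_def
proof (intro conjI ballI)
  have c: "continuous_map (punctured_space n) euclideanreal (\<lambda>z. z i)" for i
    unfolding punctured_space_def Euclidean_space_def
    by (intro continuous_map_from_subtopology continuous_map_product_projection) auto
  show "continuous_map (punctured_space n) (nsphere n) (sph_normalize n)"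
    unfolding continuous_map_into_nsphere
  proof (intro conjI allI)
    fix k
    have "continuous_map (punctured_space n) euclideanreal (\<lambda>z. sqrt (\<Sum>i\<le>n. (z i)\<^sup>2))"
      using continuous_map_compose[of "punctured_space n" euclideanreal "\<lambda>z. (\<Sum>i\<le>n. (z i)\<^sup>2)" euclideanreal sqrt]
      by (auto simp: o_def intro!: continuous_intros c)
    then show "continuous_map (punctured_space n) euclideanreal (\<lambda>z. sph_normalize n z k)"
      unfolding sph_normalize_def
      by (intro continuous_map_real_divide c) (auto simp: topspace_punctured_space simp del: sum_nonneg_eq_0_iff)
    show "sph_normalize n ` topspace (punctured_space n) \<subseteq> topspace (nsphere n)"
      by (auto simp: topspace_punctured_space topspace_nsphere sph_normalize_def power_divide
          simp flip: sum_divide_distrib)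
  qed
  show "continuous_map (nsphere n) (punctured_space n) id"
    unfolding nsphere_def punctured_space_def continuous_map_in_subtopology
    by (auto simp: continuous_map_from_subtopology)
  show "sph_normalize n (id z) = z" if "z \<in> topspace (nsphere n)" for z
    using that by (auto simp: topspace_nsphere sph_normalize_def)
qed

text \<open>The sphere is a retract of an open subset of a Euclidean space. The property is what
  \<open>continuous_map_lift_gcov\<close> asks of the domain of a lifted map.\<close>

lemma locally_path_connected_space_nsphere: "locally_path_connected_space (nsphere n)"
proof (rule locally_path_connected_space_retraction_map_image)
  show "retraction_map (punctured_space n) (nsphere n) (sph_normalize n)"
    using retraction_maps_sph_normalize retraction_map_def by blast
  have c: "continuous_map (Euclidean_space (Suc n)) euclideanreal (\<lambda>z. z i)" for i
    unfolding Euclidean_space_def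
    by (intro continuous_map_from_subtopology continuous_map_product_projection) auto
  have "openin (Euclidean_space (Suc n)) {z \<in> topspace (Euclidean_space (Suc n)). (\<Sum>i\<le>n. (z i)\<^sup>2) \<in> {0<..}}"
    by (rule openin_continuous_map_preimage[where Y=euclideanreal]) (auto intro!: continuous_intros c)
  then have "locally_path_connected_space (subtopology (Euclidean_space (Suc n))
     {z \<in> topspace (Euclidean_space (Suc n)). (\<Sum>i\<le>n. (z i)\<^sup>2) \<in> {0<..}})"
    by (intro locally_path_connected_space_open_subset locally_path_connected_Euclidean_space)
  also have "subtopology (Euclidean_space (Suc n)) {z \<in> topspace (Euclidean_space (Suc n)). (\<Sum>i\<le>n. (z i)\<^sup>2) \<in> {0<..}}
     = punctured_space n"
    unfolding punctured_space_def
    using subtopology_restrict[of "Euclidean_space (Suc n)" "{z. (\<Sum>i\<le>n. (z i)\<^sup>2) > 0}"]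
    by (simp add: Collect_conj_eq)
  finally show "locally_path_connected_space (punctured_space n)" .
qed

text \<open>The segment from z to w misses the origin unless the points are antipodal, and then it
  can be normalised.\<close>

lemma nsphere_path_nonantipodal:
  assumes z: "z \<in> topspace (nsphere n)" and w: "w \<in> topspace (nsphere n)" and ne: "w \<noteq> (\<lambda>i. - z i)"
  shows "path_component_of (nsphere n) z w"
proof -
  define g where "g t i = (1 - t) * z i + t * w i" for t i
  have pos: "(\<Sum>i\<le>n. (g t i)\<^sup>2) > 0" if t: "t \<in> {0..1}" for t
  proof (rule ccontr)
    assume "\<not> ?thesis"
    then have "(\<Sum>i\<le>n. (g t i)\<^sup>2) = 0" by (meson antisym not_le sum_nonneg zero_le_power2)
    then have g0: "g t i = 0" if "i \<le> n" for i
      using that by (subst (asm) sum_nonneg_eq_0_iff) auto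
    \<comment> \<open>Both points have norm 1, so the segment can meet the origin only at its
      midpoint, and that forces w = -z.\<close>
    have "(1 - t)^2 * (\<Sum>i\<le>n. (z i)\<^sup>2) = (\<Sum>i\<le>n. ((1 - t) * z i)\<^sup>2)"
      by (simp add: power_mult_distrib sum_distrib_left)
    also have "\<dots> = (\<Sum>i\<le>n. (t * w i)\<^sup>2)"
    proof (rule sum.cong)
      fix i assume "i \<in> {..n}"
      then have "(1 - t) * z i = - (t * w i)" using g0[of i] by (simp add: g_def eq_neg_iff_add_eq_0)
      then show "((1 - t) * z i)\<^sup>2 = (t * w i)\<^sup>2" by simp
    qed simp
    also have "\<dots> = t^2 * (\<Sum>i\<le>n. (w i)\<^sup>2)"
      by (simp add: power_mult_distrib sum_distrib_left)
    finally have "(1 - t)^2 = t^2" using z w by (simp add: topspace_nsphere)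
    then have "1 - t = t" using t by (simp add: power2_eq_iff_nonneg)
    then have th: "t = 1/2" by simp
    have "w i = - z i" for i
      using g0[of i] z w by (cases "i \<le> n") (auto simp: g_def th topspace_nsphere)
    then show False using ne by auto
  qed
  have cg: "continuous_map (top_of_set {0..1}) euclideanreal (\<lambda>t. g t i)" for i
    by (auto simp: g_def intro!: continuous_intros)
  have "continuous_map (top_of_set {0..1}) (punctured_space n) g"
    unfolding punctured_space_def Euclidean_space_def continuous_map_in_subtopology continuous_map_componentwise_UNIV
    using cg pos z w by (auto simp: g_def topspace_nsphere)
  then have "pathin (nsphere n) (sph_normalize n \<circ> g)"
    unfolding pathin_def using retraction_maps_sph_normalize
    by (auto simp: retraction_maps_def intro: continuous_map_compose)
  moreover have "g 0 = z" "g 1 = w" by (auto simp: g_def)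
  ultimately show ?thesis
    using retraction_maps_sph_normalize z w
    unfolding path_component_of_def retraction_maps_def by (intro exI[of _ "sph_normalize n \<circ> g"]) auto
qed

lemma path_connected_space_nsphere:
  assumes "n \<ge> 1" shows "path_connected_space (nsphere n)"
proof -
  have "path_component_of (nsphere n) z sph_base" if z: "z \<in> topspace (nsphere n)" for z
  proof (cases "sph_base = (\<lambda>i. - z i)")
    case False
    then show ?thesis using nsphere_path_nonantipodal z sph_base_in_nsphere by blast
  next
    case True
    \<comment> \<open>For the antipode of the base point a detour is made through the unit vector of
      coordinate 1, which lies on the sphere because n is at least 1.\<close>
    define w :: "nat \<Rightarrow> real" where "w i = (if i = 1 then 1 else 0)" for i
    have w: "w \<in> topspace (nsphere n)"
    proof -
      have "(\<Sum>i\<le>n. (w i)\<^sup>2) = (\<Sum>i\<le>n. if i = 1 then 1 else 0)" by (rule sum.cong) (auto simp: w_def)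
      then show ?thesis using assms by (auto simp: topspace_nsphere w_def)
    qed
    have 0: "w 0 = 0" "sph_base 0 = (1::real)" by (auto simp: w_def sph_base_def)
    then have "z 0 = -1" using fun_cong[OF True, of 0] by simp
    then have "w \<noteq> (\<lambda>i. - z i)" "sph_base \<noteq> (\<lambda>i. - w i)"
      using 0 fun_cong[of w "\<lambda>i. - z i" 0] fun_cong[of sph_base "\<lambda>i. - w i" 0] by auto
    then show ?thesis
      using nsphere_path_nonantipodal z w sph_base_in_nsphere path_component_of_trans by metis
  qed
  then show ?thesis
    unfolding path_connected_space_iff_path_component
    by (meson path_component_of_sym path_component_of_trans)
qed

section \<open>The shrinking wedge\<close>

lemma openin_Hwedge:
  "openin (Hwedge k) U \<longleftrightarrow> U \<subseteq> wedge_carrier k \<and>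
         (\<forall>i. openin (nsphere k) {s \<in> topspace (nsphere k). wedge_incl i s \<in> U}) \<and>
         (wedge_pt \<in> U \<longrightarrow> finite {i. \<not> wedge_incl i ` topspace (nsphere k) \<subseteq> U})"
  unfolding Hwedge_def
proof (subst openin_topology_generated_by_closed, goal_cases)
  case (2 U V)
  have "{s \<in> topspace (nsphere k). wedge_incl i s \<in> U \<inter> V} =
     {s \<in> topspace (nsphere k). wedge_incl i s \<in> U} \<inter> {s \<in> topspace (nsphere k). wedge_incl i s \<in> V}" for i
    by auto
  moreover have "{i. \<not> wedge_incl i ` topspace (nsphere k) \<subseteq> U \<inter> V} =
     {i. \<not> wedge_incl i ` topspace (nsphere k) \<subseteq> U} \<union> {i. \<not> wedge_incl i ` topspace (nsphere k) \<subseteq> V}" by auto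
  ultimately show ?case using 2 by auto
next
  case (3 K)
  have "{s \<in> topspace (nsphere k). wedge_incl i s \<in> \<Union>K} =
     (\<Union>U\<in>K. {s \<in> topspace (nsphere k). wedge_incl i s \<in> U})" for i by auto
  moreover have "finite {i. \<not> wedge_incl i ` topspace (nsphere k) \<subseteq> \<Union>K}" if "wedge_pt \<in> U" "U \<in> K" for U
  proof (rule finite_subset)
    show "finite {i. \<not> wedge_incl i ` topspace (nsphere k) \<subseteq> U}" using 3 that by blast
  qed (use that in blast)
  ultimately show ?case using 3 by (auto intro!: openin_Union)
qed auto

lemma topspace_Hwedge: "topspace (Hwedge k) = wedge_carrier k"
proof
  show "topspace (Hwedge k) \<subseteq> wedge_carrier k" using openin_Hwedge openin_topspace by blast
  have "{s \<in> topspace (nsphere k). wedge_incl i s \<in> wedge_carrier k} = topspace (nsphere k)" for i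
    by (auto simp: wedge_carrier_def)
  moreover have "{i. \<not> wedge_incl i ` topspace (nsphere k) \<subseteq> wedge_carrier k} = {}"
    by (auto simp: wedge_carrier_def)
  ultimately have "openin (Hwedge k) (wedge_carrier k)" by (simp add: openin_Hwedge)
  then show "wedge_carrier k \<subseteq> topspace (Hwedge k)" by (rule openin_subset)
qed

lemma continuous_map_wedge_incl: "continuous_map (nsphere k) (Hwedge k) (wedge_incl i)"
  unfolding continuous_map_def by (auto simp: openin_Hwedge topspace_Hwedge wedge_carrier_def)

lemma wedge_incl_base: "wedge_incl i sph_base = wedge_pt"
  by (simp add: wedge_incl_def)

lemma wedge_pt_in_Hwedge: "wedge_pt \<in> topspace (Hwedge k)"
  using continuous_map_wedge_incl[of k 0] sph_base_in_nsphere[of k] wedge_incl_base[of 0]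
  by (metis continuous_map_image_subset_topspace image_subset_iff)

definition wedge_map :: "(nat \<Rightarrow> (nat \<Rightarrow> real) \<Rightarrow> 'b) \<Rightarrow> nat \<times> (nat \<Rightarrow> real) \<Rightarrow> 'b" where
  "wedge_map m = (\<lambda>(i, s). m i s)"

lemma wedge_map_incl:
  assumes "\<And>i. m i sph_base = a" shows "wedge_map m (wedge_incl i s) = m i s"
  using assms by (auto simp: wedge_map_def wedge_incl_def wedge_pt_def)

text \<open>Openness at the wedge point asks for all but finitely many whole summands, and
  \<open>shrink\<close> is this condition for preimages; \<open>based_map_Hwedge_shrinks\<close> is
  the converse.\<close>

lemma based_map_wedge_map:
  assumes m: "\<And>i. based_map (nsphere k) sph_base A a (m i)"
    and shrink: "\<And>V. openin A V \<Longrightarrow> a \<in> V \<Longrightarrow> finite {i. \<not> m i ` topspace (nsphere k) \<subseteq> V}"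
  shows "based_map (Hwedge k) wedge_pt A a (wedge_map m)"
proof -
  have cm: "continuous_map (nsphere k) A (m i)" and mb: "m i sph_base = a" for i
    using m by (auto simp: based_map_def)
  note wm = wedge_map_incl[of m a, OF mb]
  have pt: "wedge_map m wedge_pt = a" using mb by (simp add: wedge_map_def wedge_pt_def)
  have "continuous_map (Hwedge k) A (wedge_map m)"
    unfolding continuous_map_def
  proof (intro conjI allI impI)
    show "wedge_map m \<in> topspace (Hwedge k) \<rightarrow> topspace A"
      using cm by (auto simp: topspace_Hwedge wedge_carrier_def wm continuous_map_def Pi_iff)
    fix V assume V: "openin A V"
    let ?U = "{x \<in> topspace (Hwedge k). wedge_map m x \<in> V}"
    have inc: "wedge_incl i s \<in> topspace (Hwedge k)" if "s \<in> topspace (nsphere k)" for i s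
      using that by (auto simp: topspace_Hwedge wedge_carrier_def)
    have "{s \<in> topspace (nsphere k). wedge_incl i s \<in> ?U} = {s \<in> topspace (nsphere k). m i s \<in> V}" for i
      using inc by (auto simp: wm)
    moreover have "{i. \<not> wedge_incl i ` topspace (nsphere k) \<subseteq> ?U} = {i. \<not> m i ` topspace (nsphere k) \<subseteq> V}"
      using inc by (auto simp: wm)
    moreover have "openin (nsphere k) {s \<in> topspace (nsphere k). m i s \<in> V}" for i
      using cm V by (rule openin_continuous_map_preimage)
    ultimately show "openin (Hwedge k) ?U"
      unfolding openin_Hwedge using shrink[OF V] pt by (auto simp: topspace_Hwedge)
  qed
  then show ?thesis using pt by (simp add: based_map_def)
qed

lemma based_map_Hwedge_shrinks:
  assumes "based_map (Hwedge k) wedge_pt A a h" "openin A V" "a \<in> V"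
  shows "finite {i. \<not> (h \<circ> wedge_incl i) ` topspace (nsphere k) \<subseteq> V}"
proof -
  have h: "continuous_map (Hwedge k) A h" "h wedge_pt = a" using assms(1) by (auto simp: based_map_def)
  let ?U = "{x \<in> topspace (Hwedge k). h x \<in> V}"
  have "openin (Hwedge k) ?U" using h(1) assms(2) by (rule openin_continuous_map_preimage)
  then have "finite {i. \<not> wedge_incl i ` topspace (nsphere k) \<subseteq> ?U}"
    unfolding openin_Hwedge using h(2) assms(3) wedge_pt_in_Hwedge by auto
  then show ?thesis by (rule finite_subset[rotated]) auto
qed

section \<open>Contracting loops rel their base set\<close>

text \<open>\<open>gap_left\<close> and \<open>gap_right\<close> give the end points of the
  complementary interval of E around s; for s in E both equal s.\<close>

definition gap_left :: "real set \<Rightarrow> real \<Rightarrow> real" where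
  "gap_left E s = Sup (E \<inter> {..s})"

definition gap_right :: "real set \<Rightarrow> real \<Rightarrow> real" where
  "gap_right E s = Inf (E \<inter> {s..})"

context
  fixes E :: "real set"
  assumes E: "closed E" "E \<subseteq> {0..1}" "0 \<in> E" "1 \<in> E"
begin

lemma gap_left:
  assumes "s \<in> {0..1}"
  shows "gap_left E s \<in> E" "gap_left E s \<le> s" "\<And>e. e \<in> E \<Longrightarrow> e \<le> s \<Longrightarrow> e \<le> gap_left E s"
proof -
  have bd: "bdd_above (E \<inter> {..s})" by (rule bdd_above_mono[of "{..s}"]) auto
  have "Sup (E \<inter> {..s}) \<in> E \<inter> {..s}"
    using E assms bd by (intro closed_contains_Sup) auto
  then show "gap_left E s \<in> E" "gap_left E s \<le> s" by (auto simp: gap_left_def)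
  show "e \<le> gap_left E s" if "e \<in> E" "e \<le> s" for e
    unfolding gap_left_def using that bd by (intro cSup_upper) auto
qed

lemma gap_right:
  assumes "s \<in> {0..1}"
  shows "gap_right E s \<in> E" "s \<le> gap_right E s" "\<And>e. e \<in> E \<Longrightarrow> s \<le> e \<Longrightarrow> gap_right E s \<le> e"
proof -
  have bd: "bdd_below (E \<inter> {s..})" by (rule bdd_below_mono[of "{s..}"]) auto
  have "Inf (E \<inter> {s..}) \<in> E \<inter> {s..}"
    using E assms bd by (intro closed_contains_Inf) auto
  then show "gap_right E s \<in> E" "s \<le> gap_right E s" by (auto simp: gap_right_def)
  show "gap_right E s \<le> e" if "e \<in> E" "s \<le> e" for e
    unfolding gap_right_def using that bd by (intro cInf_lower) auto
qed

lemma gap_strict: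
  assumes "s \<in> {0..1}" "s \<notin> E" shows "gap_left E s < s" "s < gap_right E s"
proof -
  have "gap_left E s \<noteq> s" "gap_right E s \<noteq> s"
    using gap_left(1)[OF assms(1)] gap_right(1)[OF assms(1)] assms(2) by auto
  then show "gap_left E s < s" "s < gap_right E s"
    using gap_left(2)[OF assms(1)] gap_right(2)[OF assms(1)] by auto
qed

lemma gap_eq:
  assumes "s \<in> {0..1}" "gap_left E s < s'" "s' < gap_right E s"
  shows "gap_left E s' = gap_left E s" "gap_right E s' = gap_right E s" "s' \<in> {0..1}" "s' \<notin> E"
proof -
  note l = gap_left[OF assms(1)] and r = gap_right[OF assms(1)]
  have "gap_left E s \<in> {0..1}" "gap_right E s \<in> {0..1}" using l(1) r(1) E(2) by auto
  then show s': "s' \<in> {0..1}" using assms(2,3) by auto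
  have out: "e \<le> gap_left E s \<or> gap_right E s \<le> e" if "e \<in> E" for e
    using l(3)[OF that] r(3)[OF that] by linarith
  then show "s' \<notin> E" using assms by force
  note l' = gap_left[OF s'] and r' = gap_right[OF s']
  show "gap_left E s' = gap_left E s"
    using out[OF l'(1)] l'(2) l'(3)[OF l(1)] assms by linarith
  show "gap_right E s' = gap_right E s"
    using out[OF r'(1)] r'(2) r'(3)[OF r(1)] assms by linarith
qed

text \<open>Every gap contains a rational, and by \<open>gap_eq\<close> any point of a gap
  determines it.\<close>

lemma countable_gaps: "countable ((\<lambda>s. (gap_left E s, gap_right E s)) ` ({0..1} - E))" (is "countable ?J")
proof -
  have "\<exists>q\<in>\<rat>. fst p < q \<and> q < snd p" if p: "p \<in> ?J" for p
  proof -
    obtain s where s: "s \<in> {0..1}" "s \<notin> E" "p = (gap_left E s, gap_right E s)" using p by auto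
    then have "fst p < snd p" using gap_strict[OF s(1,2)] by simp
    then show ?thesis using Rats_dense_in_real[of "fst p" "snd p"] by auto
  qed
  then obtain f where f: "\<And>p. p \<in> ?J \<Longrightarrow> f p \<in> \<rat> \<and> fst p < f p \<and> f p < snd p" by metis
  have "p = (gap_left E (f p), gap_right E (f p))" if p: "p \<in> ?J" for p
  proof -
    obtain s where "s \<in> {0..1}" "s \<notin> E" "p = (gap_left E s, gap_right E s)" using p by auto
    then show ?thesis using gap_eq(1,2)[of s "f p"] f[OF p] by auto
  qed
  then have "inj_on f ?J" by (rule inj_on_inverseI[of _ "\<lambda>q. (gap_left E q, gap_right E q)", OF sym])
  moreover have "countable (f ` ?J)" 
  proof (rule countable_subset)
    show "f ` ?J \<subseteq> \<rat>" using f by blast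
  qed (rule countable_rat)
  ultimately show ?thesis using countable_image_inj_on by blast
qed

end

text \<open>A parametrisation of the circle without trigonometric functions: the first coordinate
  runs linearly from 1 to -1 and back, the second is nonnegative on the first half and nonpositive
  on the second. On each half the parameter is an affine function of the first coordinate, which is
  how \<open>circle_loop\<close> inverts it.\<close>

definition circle_path :: "real \<Rightarrow> nat \<Rightarrow> real" where
  "circle_path t i = (if i = 0 then \<bar>4 * t - 2\<bar> - 1
     else if i = 1 then (if t \<le> 1/2 then 1 else -1) * sqrt (1 - (\<bar>4 * t - 2\<bar> - 1)\<^sup>2) else 0)"

definition circle_loop :: "(real \<Rightarrow> 'b) \<Rightarrow> (nat \<Rightarrow> real) \<Rightarrow> 'b" where
  "circle_loop \<delta> z = (if 0 \<le> z 1 then \<delta> ((1 - z 0) / 4) else \<delta> ((3 + z 0) / 4))"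

lemma circle_path_ends: "circle_path 0 = sph_base" "circle_path 1 = sph_base"
  by (auto simp: circle_path_def sph_base_def fun_eq_iff)

lemma continuous_map_circle_path: "continuous_map (top_of_set {0..1}) (nsphere 1) circle_path"
  unfolding continuous_map_into_nsphere
proof (intro conjI allI)
  fix k :: nat
  have "continuous_on {0..1} (\<lambda>t. if t \<le> 1/2 then sqrt (1 - (\<bar>4 * t - 2\<bar> - 1)\<^sup>2) else - sqrt (1 - (\<bar>4 * t - 2\<bar> - 1)\<^sup>2))"
  proof (rule continuous_on_cases_le)
    fix t :: real assume "t \<in> {0..1}" "t = 1/2"
    then show "sqrt (1 - (\<bar>4 * t - 2\<bar> - 1)\<^sup>2) = - sqrt (1 - (\<bar>4 * t - 2\<bar> - 1)\<^sup>2)" by (simp only:) simp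
  qed (auto intro!: continuous_intros)
  moreover have "(\<lambda>t. circle_path t 1) = (\<lambda>t. if t \<le> 1/2 then sqrt (1 - (\<bar>4 * t - 2\<bar> - 1)\<^sup>2) else - sqrt (1 - (\<bar>4 * t - 2\<bar> - 1)\<^sup>2))"
    by (auto simp: circle_path_def)
  ultimately have 1: "continuous_on {0..1} (\<lambda>t. circle_path t 1)" by metis
  have 0: "continuous_on {0..1} (\<lambda>t. circle_path t 0)"
    by (auto simp: circle_path_def intro!: continuous_intros)
  consider "k = 0" | "k = 1" | "k \<noteq> 0" "k \<noteq> 1" by auto
  then have "continuous_on {0..1} (\<lambda>t. circle_path t k)"
    by cases (use 0 1 in \<open>auto simp: circle_path_def\<close>)
  then show "continuous_map (top_of_set {0..1}) euclideanreal (\<lambda>t. circle_path t k)" by simp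
next
  have "(\<bar>4 * t - 2\<bar> - 1)\<^sup>2 \<le> 1" if "t \<in> {0..1}" for t :: real
    using that by (auto simp: abs_square_le_1 abs_if)
  then have "(circle_path t 0)\<^sup>2 + (circle_path t 1)\<^sup>2 = 1" if "t \<in> {0..1}" for t
    using that by (simp add: circle_path_def power_mult_distrib)
  then show "circle_path ` topspace (top_of_set {0..1}) \<subseteq> topspace (nsphere 1)"
    by (auto simp: topspace_nsphere) (auto simp: circle_path_def)
qed

lemma nsphere1_coord:
  assumes "z \<in> topspace (nsphere 1)" shows "(z 0)^2 + (z 1)^2 = 1"
  using assms by (simp add: topspace_nsphere)

context
  fixes A :: "'b topology" and a :: 'b and \<delta> :: "real \<Rightarrow> 'b"
  assumes \<delta>: "pathin A \<delta>" "\<delta> 0 = a" "\<delta> 1 = a"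
begin

lemma circle_loop_image: "circle_loop \<delta> ` topspace (nsphere 1) \<subseteq> \<delta> ` {0..1}"
proof clarify
  fix z assume "z \<in> topspace (nsphere 1)"
  then have "\<bar>z 0\<bar> \<le> 1" by (rule nsphere_coord_bound)
  then have "(1 - z 0) / 4 \<in> {0..1}" "(3 + z 0) / 4 \<in> {0..1}" by auto
  then show "circle_loop \<delta> z \<in> \<delta> ` {0..1}" unfolding circle_loop_def by (metis image_eqI)
qed

lemma circle_loop_path: assumes "t \<in> {0..1}" shows "circle_loop \<delta> (circle_path t) = \<delta> t"
proof (cases "t \<le> 1/2")
  case True
  have "(\<bar>4 * t - 2\<bar> - 1)\<^sup>2 \<le> 1" using assms by (auto simp: abs_square_le_1 abs_if)
  then have "circle_path t 1 \<ge> 0" using True by (simp add: circle_path_def)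
  then show ?thesis using True by (simp add: circle_loop_def circle_path_def)
next
  case False
  show ?thesis
  proof (cases "t = 1")
    \<comment> \<open>At t = 1 the second coordinate is 0, so \<open>circle_loop\<close> takes its
      first branch and returns \<open>\<delta> 0\<close>, which equals
      \<open>\<delta> 1\<close>.\<close>
    case True
    then show ?thesis using \<delta> by (simp add: circle_path_ends circle_loop_def sph_base_def)
  next
    case ne: False
    have "(\<bar>4 * t - 2\<bar> - 1)\<^sup>2 < 1" using assms ne False by (auto simp: abs_square_less_1 abs_if)
    then have "circle_path t 1 < 0" using False by (simp add: circle_path_def)
    then show ?thesis using False by (simp add: circle_loop_def circle_path_def)
  qed
qed

lemma based_map_circle_loop: "based_map (nsphere 1) sph_base A a (circle_loop \<delta>)"
proof -
  have c: "continuous_map (subtopology (nsphere 1) T) A (\<lambda>z. \<delta> (f z))"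
    if "continuous_map (nsphere 1) euclideanreal f" "\<And>z. z \<in> topspace (nsphere 1) \<Longrightarrow> f z \<in> {0..1}" for f T
  proof -
    have "continuous_map (nsphere 1) (top_of_set {0..1}) f"
      using that by (auto simp: continuous_map_in_subtopology)
    then have "continuous_map (nsphere 1) A (\<delta> \<circ> f)"
      using \<delta>(1) unfolding pathin_def by (rule continuous_map_compose)
    then show ?thesis by (auto simp: o_def intro: continuous_map_from_subtopology)
  qed
  have b: "(1 - z 0) / 4 \<in> {0..1} \<and> (3 + z 0) / 4 \<in> {0..1}" if "z \<in> topspace (nsphere 1)" for z
    using nsphere_coord_bound[OF that, of 0] by (auto simp: abs_le_iff)
  note pr = continuous_map_nsphere_projection
  have c1: "continuous_map (nsphere 1) euclideanreal (\<lambda>z. (1 - z 0) / 4)"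
    by (intro continuous_map_real_divide continuous_map_diff continuous_map_const[THEN iffD2] pr) auto
  have c2: "continuous_map (nsphere 1) euclideanreal (\<lambda>z. (3 + z 0) / 4)"
    by (intro continuous_map_real_divide continuous_map_add continuous_map_const[THEN iffD2] pr) auto
  have "continuous_map (nsphere 1) A (\<lambda>z. if 0 \<le> z 1 then \<delta> ((1 - z 0) / 4) else \<delta> ((3 + z 0) / 4))"
  proof (rule continuous_map_cases_le)
    show "continuous_map (subtopology (nsphere 1) {x \<in> topspace (nsphere 1). 0 \<le> x 1}) A (\<lambda>z. \<delta> ((1 - z 0) / 4))"
      using c[OF c1] b by blast
    show "continuous_map (subtopology (nsphere 1) {x \<in> topspace (nsphere 1). x 1 \<le> 0}) A (\<lambda>z. \<delta> ((3 + z 0) / 4))"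
      using c[OF c2] b by blast
    fix z assume "z \<in> topspace (nsphere 1)" "0 = z 1"
    then have "(z 0)^2 = 1" using nsphere1_coord[of z] by simp
    then have "z 0 = 1 \<or> z 0 = -1" by (simp add: power2_eq_1_iff)
    then show "\<delta> ((1 - z 0) / 4) = \<delta> ((3 + z 0) / 4)" using \<delta> by auto
  qed (auto intro: pr)
  then show ?thesis using \<delta> by (auto simp: based_map_def circle_loop_def[abs_def] sph_base_def)
qed

end

lemma bclasses_singleton_imp_homotopic:
  assumes "is_singleton (bclasses H b A a)" "based_map H b A a f" "based_map H b A a g"
  shows "homotopic_with (\<lambda>k. k b = a) H A f g"
proof -
  have "bclass H b A a f \<in> bclasses H b A a" "bclass H b A a g \<in> bclasses H b A a"
    using assms(2,3) by (auto simp: bclasses_def)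
  then have "bclass H b A a f = bclass H b A a g" using assms(1) by (auto simp: is_singleton_def)
  moreover have "g \<in> bclass H b A a g" using assms(3) by (auto simp: bclass_def based_map_def)
  ultimately have "g \<in> bclass H b A a f" by simp
  then show ?thesis by (simp add: bclass_def)
qed

text \<open>The excursions of \<open>\<delta>\<close> away from a are loops on the gaps of E, the
  set of times at a. They are countably many and shrink to a, so they form one map on the Hawaiian
  earring, whose based null-homotopy is pulled back to the square. That K stays at a over all of E
  is what allows the homotopies for different summands to be combined in
  \<open>path_hom_project\<close>.\<close>

lemma loop_nullhomotopic_rel_base_set:
  fixes A :: "'b topology"
  assumes haus: "Hausdorff_space A" and sing: "is_singleton (bclasses (Hwedge 1) wedge_pt A a)"
    and aA: "a \<in> topspace A" and \<delta>: "pathin A \<delta>" "\<delta> 0 = a" "\<delta> 1 = a"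
  obtains K where "continuous_map (prod_topology (top_of_set {0..1::real}) (top_of_set {0..1::real})) A K"
    "\<And>s. s \<in> {0..1} \<Longrightarrow> K (0, s) = \<delta> s" "\<And>s. s \<in> {0..1} \<Longrightarrow> K (1, s) = a"
    "\<And>t s. t \<in> {0..1} \<Longrightarrow> s \<in> {0..1} \<Longrightarrow> \<delta> s = a \<Longrightarrow> K (t, s) = a"
proof -
  let ?I = "top_of_set {0..1::real}"
  define E where "E = {s \<in> {0..1}. \<delta> s = a}"
  have \<delta>c: "continuous_map ?I A \<delta>" using \<delta>(1) by (simp add: pathin_def)
  have "closedin ?I {s \<in> topspace ?I. \<delta> s \<in> {a}}"
    using closedin_continuous_map_preimage[OF \<delta>c] closedin_Hausdorff_singleton[OF haus aA] by blast
  then have "closedin ?I E" by (simp add: E_def)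
  then have E: "closed E" "E \<subseteq> {0..1}" "0 \<in> E" "1 \<in> E"
    using \<delta> by (auto simp: E_def closedin_closed_eq)
  define J where "J = (\<lambda>s. (gap_left E s, gap_right E s)) ` ({0..1} - E)"
  have cJ: "countable J" unfolding J_def by (rule countable_gaps[OF E])
  define gp where "gp s = (gap_left E s, gap_right E s)" for s
  have gpJ: "gp s \<in> J" "fst (gp s) < s" "s < snd (gp s)" if "s \<in> {0..1}" "s \<notin> E" for s
    using that gap_strict[OF E that] by (auto simp: J_def gp_def)
  have Jex: "\<exists>s\<in>{0..1}. s \<notin> E \<and> p = (gap_left E s, gap_right E s)" if "p \<in> J" for p
    using that by (auto simp: J_def)
  have J: "fst p \<in> E" "snd p \<in> E" "fst p < snd p" if p: "p \<in> J" for p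
  proof -
    obtain s where s: "s \<in> {0..1}" "s \<notin> E" "p = (gap_left E s, gap_right E s)" using Jex[OF p] by blast
    then show "fst p \<in> E" "snd p \<in> E" "fst p < snd p"
      using gap_left(1)[OF E s(1)] gap_right(1)[OF E s(1)] gap_strict[OF E s(1,2)] by auto
  qed
  have Jgp: "gp s = p" "s \<in> {0..1}" "s \<notin> E" if p: "p \<in> J" "fst p < s" "s < snd p" for p s
  proof -
    obtain s' where s': "s' \<in> {0..1}" "p = (gap_left E s', gap_right E s')" using Jex[OF p(1)] by blast
    then show "gp s = p" "s \<in> {0..1}" "s \<notin> E"
      using gap_eq[OF E s'(1), of s] p by (auto simp: gp_def)
  qed
  define ix where "ix = to_nat_on J"
  have inj: "inj_on ix J" unfolding ix_def by (rule inj_on_to_nat_on[OF cJ])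
  define par where "par p t = \<delta> (fst p + t * (snd p - fst p))" for p t
  \<comment> \<open>There may be only finitely many gaps; the remaining indices get the constant
    map.\<close>
  define m where "m i = (if i \<in> ix ` J then circle_loop (par (inv_into J ix i)) else (\<lambda>_. a))" for i
  have m_ix: "m (ix p) = circle_loop (par p)" if "p \<in> J" for p
    using that inj by (simp add: m_def)
  have inI: "fst p + t * (snd p - fst p) \<in> {0..1}" if "p \<in> J" "t \<in> {0..1}" for p t
  proof -
    have 1: "0 \<le> fst p" "snd p \<le> 1" "fst p < snd p" using J[OF that(1)] E(2) by auto
    define d where "d = t * (snd p - fst p)"
    have "0 \<le> d" using that(2) 1(3) by (simp add: d_def)
    moreover have "d \<le> snd p - fst p"
      using mult_right_mono[of t 1 "snd p - fst p"] that(2) 1(3) by (simp only: d_def) auto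
    ultimately have "0 \<le> fst p + d" "fst p + d \<le> 1" using 1 by auto
    then show ?thesis by (simp add: d_def)
  qed
  have par: "pathin A (par p)" "par p 0 = a" "par p 1 = a" if "p \<in> J" for p
  proof -
    have "continuous_map ?I ?I (\<lambda>t. fst p + t * (snd p - fst p))"
      using inI[OF that] by (auto simp: continuous_map_in_subtopology intro!: continuous_intros)
    from continuous_map_compose[OF this \<delta>c] show "pathin A (par p)"
      by (simp add: pathin_def par_def[abs_def] o_def)
    show "par p 0 = a" "par p 1 = a" using J[OF that] by (auto simp: par_def E_def)
  qed
  have m_based: "based_map (nsphere 1) sph_base A a (m i)" for i
    using based_map_circle_loop[OF par] aA inv_into_into[of i ix J] by (auto simp: m_def based_map_def)
  have shrink: "finite {i. \<not> m i ` topspace (nsphere 1) \<subseteq> V}" if V: "openin A V" "a \<in> V" for V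
  proof -
    \<comment> \<open>The times at which \<open>\<delta>\<close> is outside V form a compact set
      covered by the disjoint open gaps, so only finitely many gaps meet it.\<close>
    define Z where "Z = {s \<in> {0..1}. \<delta> s \<notin> V}"
    have "closedin ?I {s \<in> topspace ?I. \<delta> s \<in> topspace A - V}"
      using closedin_continuous_map_preimage[OF \<delta>c] V(1) by blast
    moreover have "{s \<in> topspace ?I. \<delta> s \<in> topspace A - V} = Z"
      using continuous_map_image_subset_topspace[OF \<delta>c] by (auto simp: Z_def)
    ultimately have "compact Z" by (simp add: closedin_compact_eq)
    moreover have "Z \<subseteq> (\<Union>p\<in>J. {fst p<..<snd p})"
      using gpJ V(2) by (fastforce simp: Z_def E_def)
    ultimately obtain C where C: "C \<subseteq> J" "finite C" "Z \<subseteq> (\<Union>p\<in>C. {fst p<..<snd p})"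
      by (elim compactE_image) auto
    have "{i. \<not> m i ` topspace (nsphere 1) \<subseteq> V} \<subseteq> ix ` C"
    proof
      fix i assume i: "i \<in> {i. \<not> m i ` topspace (nsphere 1) \<subseteq> V}"
      then obtain p where p: "p \<in> J" "i = ix p" using V(2) by (cases "i \<in> ix ` J") (auto simp: m_def)
      then obtain t where t: "t \<in> {0..1}" "par p t \<notin> V"
        using i circle_loop_image[OF par[OF p(1)]] by (fastforce simp: m_ix)
      have "t \<noteq> 0" "t \<noteq> 1" using t(2) V(2) par[OF p(1)] by auto
      then have t': "0 < t" "t < 1" using t(1) by auto
      define s where "s = fst p + t * (snd p - fst p)"
      have "t * (snd p - fst p) < 1 * (snd p - fst p)" using t' J(3)[OF p(1)] by (intro mult_strict_right_mono) auto
      moreover have "0 < t * (snd p - fst p)" using t' J(3)[OF p(1)] by simp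
      ultimately have s: "fst p < s" "s < snd p" by (auto simp: s_def)
      have "s \<in> Z" using t(2) Jgp(2)[OF p(1) s] by (simp add: Z_def par_def s_def)
      then obtain p' where "p' \<in> C" "fst p' < s" "s < snd p'" using C(3) by auto
      then show "i \<in> ix ` C" using Jgp(1)[OF p(1) s] Jgp(1)[of p' s] C(1) p(2) by auto
    qed
    then show ?thesis using C(2) finite_surj by blast
  qed
  have "based_map (Hwedge 1) wedge_pt A a (wedge_map m)"
    using m_based shrink by (rule based_map_wedge_map)
  moreover have "based_map (Hwedge 1) wedge_pt A a (\<lambda>_. a)" using aA by (simp add: based_map_def)
  ultimately have "homotopic_with (\<lambda>k. k wedge_pt = a) (Hwedge 1) A (wedge_map m) (\<lambda>_. a)"
    using bclasses_singleton_imp_homotopic[OF sing] by blast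
  then obtain h where h: "continuous_map (prod_topology ?I (Hwedge 1)) A h"
    "\<And>x. h (0, x) = wedge_map m x" "\<And>x. h (1, x) = a" "\<And>t. t \<in> {0..1} \<Longrightarrow> h (t, wedge_pt) = a"
    unfolding homotopic_with_def by auto
  \<comment> \<open>Clamping makes \<open>F p\<close> a map on the whole square with value a outside
    the strip \<open>B p\<close>, which is the form that the gluing lemma needs.\<close>
  define pos where "pos p s = max 0 (min 1 ((s - fst p) / (snd p - fst p)))" for p :: "real \<times> real" and s
  define F where "F p z = h (fst z, wedge_incl (ix p) (circle_path (pos p (snd z))))" for p z
  define B where "B p = {0..1::real} \<times> {fst p<..<snd p}" for p :: "real \<times> real"
  define K where "K z = (if snd z \<in> E then a else F (gp (snd z)) z)" for z
  let ?II = "prod_topology ?I ?I"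
  have posI: "pos p s \<in> {0..1}" for p s by (auto simp: pos_def)
  have pos_inside: "fst p + pos p s * (snd p - fst p) = s" if "p \<in> J" "fst p < s" "s < snd p" for p s
  proof -
    have "0 \<le> (s - fst p) / (snd p - fst p)" "(s - fst p) / (snd p - fst p) \<le> 1" using that by auto
    then have "pos p s = (s - fst p) / (snd p - fst p)" by (simp add: pos_def)
    then show ?thesis using that by simp
  qed
  have F_outside: "F p z = a" if "p \<in> J" "z \<in> topspace ?II" "z \<notin> B p" for p z
  proof -
    have z: "fst z \<in> {0..1}" "snd z \<le> fst p \<or> snd p \<le> snd z" using that by (auto simp: B_def)
    have "pos p (snd z) = 0 \<or> pos p (snd z) = 1"
      using z(2) J(3)[OF that(1)] by (auto simp: pos_def divide_nonpos_pos min_def max_def zero_le_divide_iff)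
    then have "circle_path (pos p (snd z)) = sph_base" using circle_path_ends by auto
    then show ?thesis using h(4)[OF z(1)] by (simp add: F_def wedge_incl_base)
  qed
  have F_cont: "continuous_map ?II A (F p)" if "p \<in> J" for p
  proof -
    have "continuous_map ?II ?I (\<lambda>z. pos p (snd z))"
    proof -
      have "continuous_map ?I ?I (pos p)"
        using posI[of p] J(3)[OF that]
        by (auto simp: continuous_map_in_subtopology pos_def[abs_def] intro!: continuous_intros)
      then show ?thesis by (rule continuous_map_compose[OF continuous_map_snd, unfolded o_def])
    qed
    from continuous_map_compose[OF continuous_map_compose[OF this continuous_map_circle_path] continuous_map_wedge_incl]
    have "continuous_map ?II (Hwedge 1) (\<lambda>z. wedge_incl (ix p) (circle_path (pos p (snd z))))"
      by (simp add: o_def)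
    then have "continuous_map ?II (prod_topology ?I (Hwedge 1)) (\<lambda>z. (fst z, wedge_incl (ix p) (circle_path (pos p (snd z)))))"
      by (intro continuous_map_pairedI continuous_map_fst)
    from continuous_map_compose[OF this h(1)] show ?thesis by (simp add: o_def F_def[abs_def])
  qed
  have K_cont: "continuous_map ?II A K"
  proof (rule continuous_map_glue_family[where F=F and Fb="\<lambda>_. a" and I=J and B=B])
    show "continuous_map ?II A (\<lambda>_. a)" using aA by simp
    show "continuous_map ?II A (F p)" if "p \<in> J" for p using F_cont[OF that] .
    show "openin ?II (B p)" if "p \<in> J" for p
    proof -
      have "{fst p<..<snd p} \<subseteq> {0..1}" using Jgp(2)[OF that] by auto
      then have "openin ?I {fst p<..<snd p}" by (auto simp: openin_open intro!: exI[of _ "{fst p<..<snd p}"])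
      moreover have "openin ?I {0..1}" using openin_topspace[of ?I] by simp
      ultimately show ?thesis unfolding B_def openin_prod_Times_iff by blast
    qed
    show "F p z = a" if "p \<in> J" "z \<in> ?II closure_of B p" "z \<notin> B p" for p z
    proof -
      have "z \<in> topspace ?II" using that(2) closure_of_subset_topspace[of ?II "B p"] by blast
      then show ?thesis using F_outside[OF that(1)] that(3) by blast
    qed
    show "K z = F p z" if "p \<in> J" "z \<in> B p" for p z
      using Jgp[OF that(1), of "snd z"] that(2) by (auto simp: B_def K_def)
    show "K z = a" if "z \<in> topspace ?II" "z \<notin> (\<Union>p\<in>J. B p)" for z
    proof (cases "snd z \<in> E")
      case False
      then have "gp (snd z) \<in> J" "z \<in> B (gp (snd z))" using gpJ[of "snd z"] that(1) by (auto simp: B_def mem_Times_iff)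
      then show ?thesis using that(2) by blast
    qed (simp add: K_def)
    fix z V assume "z \<in> topspace ?II" and V: "openin A V" "a \<in> V"
    \<comment> \<open>The tube lemma gives one neighbourhood W of the wedge point that works for all
      times at once; all but finitely many summands lie inside W.\<close>
    let ?O = "{x \<in> topspace (prod_topology ?I (Hwedge 1)). h x \<in> V}"
    have "openin (prod_topology ?I (Hwedge 1)) ?O" using h(1) V(1) by (rule openin_continuous_map_preimage)
    moreover have "compactin ?I {0..1}" by (simp add: compactin_subtopology)
    moreover have "{0..1} \<times> {wedge_pt} \<subseteq> ?O" using h(4) V(2) wedge_pt_in_Hwedge by auto
    ultimately obtain U W where W: "openin (Hwedge 1) W" "{0..1} \<subseteq> U" "wedge_pt \<in> W" "U \<times> W \<subseteq> ?O"
      using tube_lemma_left[of ?I "Hwedge 1" ?O "{0..1}" wedge_pt] wedge_pt_in_Hwedge by blast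
    let ?J = "{p \<in> J. ix p \<in> {i. \<not> wedge_incl i ` topspace (nsphere 1) \<subseteq> W}}"
    have "finite {i. \<not> wedge_incl i ` topspace (nsphere 1) \<subseteq> W}" using W(1,3) by (simp add: openin_Hwedge)
    then have fin: "finite ?J"
      by (rule finite_imageD[OF finite_subset, rotated]) (use inj in \<open>auto intro: inj_on_subset\<close>)
    have "F p w \<in> V" if "p \<in> J - ?J" "w \<in> topspace ?II" for p w
    proof -
      have "circle_path (pos p (snd w)) \<in> topspace (nsphere 1)"
        using continuous_map_image_subset_topspace[OF continuous_map_circle_path] posI by (auto simp: image_subset_iff)
      then have "wedge_incl (ix p) (circle_path (pos p (snd w))) \<in> W" using that(1) by blast
      moreover have "fst w \<in> U" using that(2) W(2) by auto
      ultimately show ?thesis using W(4) by (auto simp: F_def)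
    qed
    then show "\<exists>W Ja. openin ?II W \<and> z \<in> W \<and> finite Ja \<and> (\<forall>p\<in>J - Ja. \<forall>w\<in>W \<inter> B p. F p w \<in> V)"
      using fin \<open>z \<in> topspace ?II\<close> by (intro exI[of _ "topspace ?II"] exI[of _ ?J]) auto
  qed
  show thesis
  proof
    show "continuous_map ?II A K" by fact
    fix s :: real assume s: "s \<in> {0..1}"
    show "K (0, s) = \<delta> s"
    proof (cases "s \<in> E")
      case False
      note g = gpJ[OF s False]
      have "K (0, s) = m (ix (gp s)) (circle_path (pos (gp s) s))"
        using False h(2) wedge_map_incl[of m a] m_based by (simp add: K_def F_def based_map_def)
      also have "\<dots> = par (gp s) (pos (gp s) s)"
        using m_ix[OF g(1)] circle_loop_path[OF par[OF g(1)] posI] by simp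
      finally show ?thesis using pos_inside[OF g] by (simp add: par_def)
    qed (simp add: K_def E_def)
    show "K (1, s) = a" using h(3) by (simp add: K_def F_def)
    show "K (t, s) = a" if "t \<in> {0..1}" "\<delta> s = a" for t
      using that s by (simp add: K_def E_def)
  qed
qed

section \<open>Path classes and the whisker topology\<close>

definition path_hom :: "'y topology \<Rightarrow> (real \<Rightarrow> 'y) \<Rightarrow> (real \<Rightarrow> 'y) \<Rightarrow> bool" where
  "path_hom Y \<alpha> \<beta> \<longleftrightarrow> homotopic_with (\<lambda>h. h 0 = \<alpha> 0 \<and> h 1 = \<alpha> 1) (top_of_set {0..1}) Y \<alpha> \<beta>"

lemma path_hom_imp:
  assumes "path_hom Y \<alpha> \<beta>"
  shows "pathin Y \<alpha>" "pathin Y \<beta>" "\<beta> 0 = \<alpha> 0" "\<beta> 1 = \<alpha> 1"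
proof -
  have h: "homotopic_with (\<lambda>h. h 0 = \<alpha> 0 \<and> h 1 = \<alpha> 1) (top_of_set {0..1}) Y \<alpha> \<beta>"
    using assms by (simp add: path_hom_def)
  show "pathin Y \<alpha>" "pathin Y \<beta>" using homotopic_with_imp_continuous_maps[OF h] by (auto simp: pathin_def)
  show "\<beta> 0 = \<alpha> 0" "\<beta> 1 = \<alpha> 1" using homotopic_with_imp_property[OF h] by auto
qed

lemma path_hom_refl: "pathin Y \<alpha> \<Longrightarrow> path_hom Y \<alpha> \<alpha>"
  by (simp add: path_hom_def pathin_def)

lemma path_hom_sym: "path_hom Y \<alpha> \<beta> \<Longrightarrow> path_hom Y \<beta> \<alpha>"
proof -
  assume 1: "path_hom Y \<alpha> \<beta>"
  then have "homotopic_with (\<lambda>h. h 0 = \<beta> 0 \<and> h 1 = \<beta> 1) (top_of_set {0..1}) Y \<alpha> \<beta>"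
    using path_hom_imp(3,4)[OF 1] by (simp add: path_hom_def)
  then show ?thesis unfolding path_hom_def by (rule homotopic_with_symD)
qed

lemma path_hom_trans: "path_hom Y \<alpha> \<beta> \<Longrightarrow> path_hom Y \<beta> \<gamma> \<Longrightarrow> path_hom Y \<alpha> \<gamma>"
proof -
  assume 1: "path_hom Y \<alpha> \<beta>" and 2: "path_hom Y \<beta> \<gamma>"
  from 2 have "homotopic_with (\<lambda>h. h 0 = \<alpha> 0 \<and> h 1 = \<alpha> 1) (top_of_set {0..1}) Y \<beta> \<gamma>"
    using path_hom_imp(3,4)[OF 1] by (simp add: path_hom_def)
  with 1 show ?thesis unfolding path_hom_def by (rule homotopic_with_trans)
qed

abbreviation II :: "(real \<times> real) topology" where
  "II \<equiv> prod_topology (top_of_set {0..1}) (top_of_set {0..1})"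

lemma path_homI:
  assumes K: "continuous_map II Y K"
    and "\<And>s. s \<in> {0..1} \<Longrightarrow> K (0, s) = \<alpha> s" "\<And>s. s \<in> {0..1} \<Longrightarrow> K (1, s) = \<beta> s"
    and "\<And>t. t \<in> {0..1} \<Longrightarrow> K (t, 0) = \<alpha> 0" "\<And>t. t \<in> {0..1} \<Longrightarrow> K (t, 1) = \<alpha> 1"
  shows "path_hom Y \<alpha> \<beta>"
  unfolding path_hom_def homotopic_with_def
proof (intro exI conjI)
  \<comment> \<open>\<open>homotopic_with\<close> requires the end equations at every real s, while
    K is controlled on the unit interval only; outside it the required values are patched
    in.\<close>
  let ?h = "\<lambda>(t, s). if s \<in> {0..1} then K (t, s) else if t = 0 then \<alpha> s else \<beta> s"
  show "continuous_map II Y ?h"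
    by (rule continuous_map_eq[OF K]) auto
qed (use assms in auto)

lemma path_homE:
  assumes "path_hom Y \<alpha> \<beta>"
  obtains K where "continuous_map II Y K"
    "\<And>s. K (0, s) = \<alpha> s" "\<And>s. K (1, s) = \<beta> s"
    "\<And>t. t \<in> {0..1} \<Longrightarrow> K (t, 0) = \<alpha> 0" "\<And>t. t \<in> {0..1} \<Longrightarrow> K (t, 1) = \<alpha> 1"
proof -
  obtain K where "continuous_map II Y K" "\<forall>s. K (0, s) = \<alpha> s" "\<forall>s. K (1, s) = \<beta> s"
    "\<forall>t\<in>{0..1}. K (t, 0) = \<alpha> 0 \<and> K (t, 1) = \<alpha> 1"
    using assms unfolding path_hom_def homotopic_with_def by blast
  then show thesis using that by blast
qed

text \<open>The unit interval is convex, so the two changes of parameter are joined by a straight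
  line. The associativity, unit and inverse laws all reduce to this.\<close>

lemma path_hom_reparam:
  assumes \<alpha>: "pathin Y \<alpha>" and \<phi>: "pathin (top_of_set {0..1}) \<phi>" and \<psi>: "pathin (top_of_set {0..1}) \<psi>"
    and ends: "\<phi> 0 = \<psi> 0" "\<phi> 1 = \<psi> 1"
  shows "path_hom Y (\<alpha> \<circ> \<phi>) (\<alpha> \<circ> \<psi>)"
proof (rule path_homI)
  let ?I = "top_of_set {0..1::real}"
  have c: "continuous_map II euclideanreal (\<lambda>z. \<theta> (snd z))" and r: "\<And>s. s \<in> {0..1} \<Longrightarrow> \<theta> s \<in> {0..1}"
    if "pathin ?I \<theta>" for \<theta>
  proof -
    have \<theta>: "continuous_map ?I euclideanreal \<theta>" "\<theta> \<in> {0..1} \<rightarrow> {0..1}"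
      using that by (auto simp: pathin_def continuous_map_in_subtopology image_subset_iff)
    show "continuous_map II euclideanreal (\<lambda>z. \<theta> (snd z))"
      by (rule continuous_map_compose[OF continuous_map_snd \<theta>(1), unfolded o_def])
    show "\<And>s. s \<in> {0..1} \<Longrightarrow> \<theta> s \<in> {0..1}" using \<theta>(2) by auto
  qed
  have f: "continuous_map II euclideanreal fst"
    by (rule continuous_map_into_fulltopology[OF continuous_map_fst])
  have "continuous_map II ?I (\<lambda>z. (1 - fst z) * \<phi> (snd z) + fst z * \<psi> (snd z))"
    unfolding continuous_map_in_subtopology
  proof
    show "continuous_map II euclideanreal (\<lambda>z. (1 - fst z) * \<phi> (snd z) + fst z * \<psi> (snd z))"
      by (intro continuous_intros f c \<phi> \<psi> continuous_map_const[THEN iffD2]) auto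
    show "(\<lambda>z. (1 - fst z) * \<phi> (snd z) + fst z * \<psi> (snd z)) \<in> topspace II \<rightarrow> {0..1}"
    proof (clarsimp, intro conjI)
      fix t s :: real assume ts: "0 \<le> t" "t \<le> 1" "0 \<le> s" "s \<le> 1"
      have b: "0 \<le> \<phi> s" "\<phi> s \<le> 1" "0 \<le> \<psi> s" "\<psi> s \<le> 1" using r[OF \<phi>, of s] r[OF \<psi>, of s] ts by auto
      show "0 \<le> (1 - t) * \<phi> s + t * \<psi> s" using ts b by simp
      show "(1 - t) * \<phi> s + t * \<psi> s \<le> 1" using ts b convex_bound_le[of "\<phi> s" 1 "\<psi> s" "1 - t" t] by simp
    qed
  qed
  then show "continuous_map II Y (\<lambda>z. \<alpha> ((1 - fst z) * \<phi> (snd z) + fst z * \<psi> (snd z)))"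
    using continuous_map_compose[of II ?I _ Y \<alpha>] \<alpha> by (auto simp: pathin_def o_def)
qed (use ends in \<open>auto simp: algebra_simps\<close>)

lemma pcat_comp: "pcat (f \<circ> \<alpha>) (f \<circ> \<beta>) = f \<circ> pcat \<alpha> \<beta>"
  by (auto simp: pcat_def)

lemma pcat_ends [simp]: "pcat \<alpha> \<epsilon> 0 = \<alpha> 0" "pcat \<alpha> \<epsilon> 1 = \<epsilon> 1"
  by (auto simp: pcat_def)

lemma continuous_map_half:
  assumes "continuous_map (top_of_set {0..1::real}) Y \<alpha>" "continuous_map Z euclideanreal f"
    "\<And>z. z \<in> topspace Z \<Longrightarrow> z \<in> S \<Longrightarrow> f z \<in> {0..1}"
  shows "continuous_map (subtopology Z S) Y (\<lambda>z. \<alpha> (f z))"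
proof -
  have "continuous_map (subtopology Z S) (top_of_set {0..1}) f"
    unfolding continuous_map_in_subtopology using assms(2,3)
    by (auto intro: continuous_map_from_subtopology)
  then show ?thesis by (rule continuous_map_compose[OF _ assms(1), unfolded o_def])
qed

lemma pathin_pcat:
  assumes "pathin Y \<alpha>" "pathin Y \<epsilon>" "\<alpha> 1 = \<epsilon> 0" shows "pathin Y (pcat \<alpha> \<epsilon>)"
  unfolding pathin_def pcat_def[abs_def]
proof (rule continuous_map_cases_le)
  show "continuous_map (subtopology (top_of_set {0..1}) {x \<in> topspace (top_of_set {0..1}). x \<le> 1 / 2}) Y (\<lambda>t. \<alpha> (2 * t))"
    using assms(1) unfolding pathin_def by (rule continuous_map_half) (auto intro!: continuous_intros)
  show "continuous_map (subtopology (top_of_set {0..1}) {x \<in> topspace (top_of_set {0..1}). 1 / 2 \<le> x}) Y (\<lambda>t. \<epsilon> (2 * t - 1))"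
    using assms(2) unfolding pathin_def by (rule continuous_map_half) (auto intro!: continuous_intros)
  fix t :: real assume "t = 1 / 2"
  then show "\<alpha> (2 * t) = \<epsilon> (2 * t - 1)" using assms(3) by (simp only:) simp
qed (auto intro!: continuous_intros)

lemma continuous_map_halfII:
  assumes "continuous_map II Y K" "continuous_map euclideanreal euclideanreal f"
    "\<And>z. z \<in> {0..1} \<Longrightarrow> P z \<Longrightarrow> f z \<in> {0..1}"
  shows "continuous_map (subtopology II {z \<in> topspace II. P (snd z)}) Y (\<lambda>z. K (fst z, f (snd z)))"
proof -
  let ?Z = "subtopology II {z \<in> topspace II. P (snd z)}"
  have "continuous_map ?Z (top_of_set {0..1}) (\<lambda>z. f (snd z))"
    unfolding continuous_map_in_subtopology
  proof
    have "continuous_map ?Z euclideanreal snd"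
      by (intro continuous_map_from_subtopology continuous_map_into_fulltopology[OF continuous_map_snd])
    then show "continuous_map ?Z euclideanreal (\<lambda>z. f (snd z))"
      by (rule continuous_map_compose[OF _ assms(2), unfolded o_def])
    show "(\<lambda>z. f (snd z)) \<in> topspace ?Z \<rightarrow> {0..1}" using assms(3) by auto
  qed
  then have "continuous_map ?Z II (\<lambda>z. (fst z, f (snd z)))"
    by (rule continuous_map_pairedI[OF continuous_map_from_subtopology[OF continuous_map_fst]])
  then show ?thesis by (rule continuous_map_compose[OF _ assms(1), unfolded o_def])
qed

lemma path_hom_pcat:
  assumes "path_hom Y \<alpha> \<alpha>'" "path_hom Y \<epsilon> \<epsilon>'" "\<alpha> 1 = \<epsilon> 0"
  shows "path_hom Y (pcat \<alpha> \<epsilon>) (pcat \<alpha>' \<epsilon>')"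
proof -
  obtain K where K: "continuous_map II Y K" "\<And>s. K (0, s) = \<alpha> s" "\<And>s. K (1, s) = \<alpha>' s"
    "\<And>t. t \<in> {0..1} \<Longrightarrow> K (t, 0) = \<alpha> 0" "\<And>t. t \<in> {0..1} \<Longrightarrow> K (t, 1) = \<alpha> 1"
    by (rule path_homE[OF assms(1)]) blast
  obtain L where L: "continuous_map II Y L" "\<And>s. L (0, s) = \<epsilon> s" "\<And>s. L (1, s) = \<epsilon>' s"
    "\<And>t. t \<in> {0..1} \<Longrightarrow> L (t, 0) = \<epsilon> 0" "\<And>t. t \<in> {0..1} \<Longrightarrow> L (t, 1) = \<epsilon> 1"
    by (rule path_homE[OF assms(2)]) blast
  show ?thesis
  proof (rule path_homI)
    let ?M = "\<lambda>z. if snd z \<le> 1/2 then K (fst z, 2 * snd z) else L (fst z, 2 * snd z - 1)"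
    show "continuous_map II Y ?M"
    proof (rule continuous_map_cases_le)
      show "continuous_map II euclideanreal snd" by (rule continuous_map_into_fulltopology[OF continuous_map_snd])
      show "continuous_map (subtopology II {x \<in> topspace II. snd x \<le> 1 / 2}) Y (\<lambda>x. K (fst x, 2 * snd x))"
        by (rule continuous_map_halfII[OF K(1)]) (auto intro!: continuous_intros)
      show "continuous_map (subtopology II {x \<in> topspace II. 1 / 2 \<le> snd x}) Y (\<lambda>x. L (fst x, 2 * snd x - 1))"
        by (rule continuous_map_halfII[OF L(1)]) (auto intro!: continuous_intros)
      fix z assume z: "z \<in> topspace II" "snd z = 1 / 2"
      have "2 * snd z = 1" "2 * snd z - 1 = 0" using z(2) by auto
      moreover have "K (fst z, 1) = L (fst z, 0)" using z(1) K(5) L(4) assms(3) by auto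
      ultimately show "K (fst z, 2 * snd z) = L (fst z, 2 * snd z - 1)" by metis
    qed auto
  qed (use K L in \<open>auto simp: pcat_def\<close>)
qed

lemma pathin_unit:
  assumes "continuous_on {0..1} \<phi>" "\<And>t. t \<in> {0..1} \<Longrightarrow> \<phi> t \<in> {0..1}"
  shows "pathin (top_of_set {0..1::real}) \<phi>"
  using assms by (auto simp: pathin_def continuous_map_in_subtopology)

lemma pathin_unit_id: "pathin (top_of_set {0..1::real}) id"
  by (simp add: pathin_def)

lemma pathin_unit_comp: "pathin Y \<alpha> \<Longrightarrow> pathin (top_of_set {0..1}) \<phi> \<Longrightarrow> pathin Y (\<alpha> \<circ> \<phi>)"
  unfolding pathin_def by (rule continuous_map_compose)

lemma pathin_reverse:
  assumes "pathin Y \<epsilon>" shows "pathin Y (\<lambda>t. \<epsilon> (1 - t))"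
proof -
  have "pathin (top_of_set {0..1}) (\<lambda>t::real. 1 - t)" by (rule pathin_unit) (auto intro!: continuous_intros)
  from pathin_unit_comp[OF assms this] show ?thesis by (simp add: o_def)
qed

lemma pathin_in_topspace: "pathin Y \<epsilon> \<Longrightarrow> t \<in> {0..1} \<Longrightarrow> \<epsilon> t \<in> topspace Y"
  using continuous_map_image_subset_topspace[of "top_of_set {0..1}" Y \<epsilon>] by (auto simp: pathin_def image_subset_iff)

lemma path_hom_pcat_reparam:
  assumes "pathin Y \<alpha>" "pathin (top_of_set {0..1}) \<phi>" "pathin (top_of_set {0..1}) \<psi>"
    "pathin (top_of_set {0..1}) \<theta>" "\<phi> 1 = \<psi> 0" "\<theta> 0 = \<phi> 0" "\<theta> 1 = \<psi> 1"
  shows "path_hom Y (pcat (\<alpha> \<circ> \<phi>) (\<alpha> \<circ> \<psi>)) (\<alpha> \<circ> \<theta>)"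
  unfolding pcat_comp using assms by (intro path_hom_reparam pathin_pcat) auto

lemma path_hom_assoc:
  assumes "pathin Y \<alpha>" "pathin Y \<beta>" "pathin Y \<gamma>" "\<alpha> 1 = \<beta> 0" "\<beta> 1 = \<gamma> 0"
  shows "path_hom Y (pcat (pcat \<alpha> \<beta>) \<gamma>) (pcat \<alpha> (pcat \<beta> \<gamma>))"
proof -
  \<comment> \<open>The piecewise linear change of parameter, with breakpoints 1/4 and 1/2, that
    turns \<open>pcat \<alpha> (pcat \<beta> \<gamma>)\<close> into
    \<open>pcat (pcat \<alpha> \<beta>) \<gamma>\<close>; the \<open>min\<close> merges the first
    two pieces.\<close>
  define \<phi> :: "real \<Rightarrow> real" where "\<phi> t = (if t \<le> 1/2 then min (2 * t) (t + 1/4) else (t + 1) / 2)" for t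
  have "continuous_on {0..1} \<phi>" unfolding \<phi>_def
    by (rule continuous_on_cases_le) (auto intro!: continuous_intros)
  then have "pathin (top_of_set {0..1}) \<phi>"
    by (rule pathin_unit) (auto simp: \<phi>_def min_def)
  then have "path_hom Y (pcat \<alpha> (pcat \<beta> \<gamma>) \<circ> \<phi>) (pcat \<alpha> (pcat \<beta> \<gamma>) \<circ> id)"
    using assms by (intro path_hom_reparam pathin_pcat) (auto simp: pathin_unit_id \<phi>_def)
  moreover have "pcat \<alpha> (pcat \<beta> \<gamma>) \<circ> \<phi> = pcat (pcat \<alpha> \<beta>) \<gamma>"
    by (auto simp: fun_eq_iff pcat_def \<phi>_def min_def algebra_simps add_divide_distrib)
  ultimately show ?thesis by simp
qed

lemma path_hom_unit:
  assumes "pathin Y \<alpha>" shows "path_hom Y (pcat \<alpha> (\<lambda>_. \<alpha> 1)) \<alpha>"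
  using path_hom_pcat_reparam[of Y \<alpha> id "\<lambda>_. 1" id] assms by (simp add: pathin_unit pathin_unit_id o_def)

lemma path_hom_inverse:
  assumes "pathin Y \<alpha>" shows "path_hom Y (pcat \<alpha> (\<lambda>t. \<alpha> (1 - t))) (\<lambda>_. \<alpha> 0)"
proof -
  have "pathin (top_of_set {0..1}) (\<lambda>t::real. 1 - t)" by (rule pathin_unit) (auto intro!: continuous_intros)
  then show ?thesis
    using path_hom_pcat_reparam[of Y \<alpha> id "\<lambda>t. 1 - t" "\<lambda>_. 0"] assms by (simp add: pathin_unit pathin_unit_id o_def)
qed

section \<open>Path classes and the action of paths on them\<close>

lemma pclass_eq: "pclass Y \<alpha> = {\<beta>. path_hom Y \<alpha> \<beta>}"
proof -
  have "pathin Y \<beta> \<and> \<beta> 0 = \<alpha> 0 \<and> \<beta> 1 = \<alpha> 1 \<and> path_hom Y \<alpha> \<beta> \<longleftrightarrow> path_hom Y \<alpha> \<beta>" for \<beta>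
    using path_hom_imp[of Y \<alpha> \<beta>] by blast
  then show ?thesis unfolding pclass_def path_hom_def[symmetric] by simp
qed

lemma pclass_eq_iff:
  assumes "pathin Y \<beta>" shows "pclass Y \<alpha> = pclass Y \<beta> \<longleftrightarrow> path_hom Y \<alpha> \<beta>"
proof
  assume "pclass Y \<alpha> = pclass Y \<beta>"
  then show "path_hom Y \<alpha> \<beta>" using path_hom_refl[OF assms] by (auto simp: pclass_eq)
next
  assume "path_hom Y \<alpha> \<beta>"
  then show "pclass Y \<alpha> = pclass Y \<beta>"
    unfolding pclass_eq using path_hom_sym path_hom_trans by blast
qed

text \<open>This is the end of the lift of \<open>\<epsilon>\<close> that starts at c. One
  representative of c is picked, and \<open>pact_pclass\<close> shows that the choice is
  immaterial.\<close>

definition pact :: "'y topology \<Rightarrow> (real \<Rightarrow> 'y) set \<Rightarrow> (real \<Rightarrow> 'y) \<Rightarrow> (real \<Rightarrow> 'y) set" where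
  "pact Y c \<epsilon> = pclass Y (pcat (SOME \<alpha>. \<alpha> \<in> c) \<epsilon>)"

lemma some_in_pclass:
  assumes "pathin Y \<alpha>" shows "path_hom Y \<alpha> (SOME \<beta>. \<beta> \<in> pclass Y \<alpha>)"
  using someI[of "\<lambda>\<beta>. \<beta> \<in> pclass Y \<alpha>" \<alpha>] path_hom_refl[OF assms] by (simp add: pclass_eq)

lemma gcov_proj_pclass: "pathin Y \<alpha> \<Longrightarrow> gcov_proj (pclass Y \<alpha>) = \<alpha> 1"
  unfolding gcov_proj_def using path_hom_imp(4)[OF some_in_pclass] by auto

lemma pact_pclass:
  assumes "pathin Y \<alpha>" "pathin Y \<epsilon>" "\<epsilon> 0 = \<alpha> 1"
  shows "pact Y (pclass Y \<alpha>) \<epsilon> = pclass Y (pcat \<alpha> \<epsilon>)"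
proof -
  have "path_hom Y (pcat (SOME \<beta>. \<beta> \<in> pclass Y \<alpha>) \<epsilon>) (pcat \<alpha> \<epsilon>)"
    using path_hom_imp(4)[OF some_in_pclass[OF assms(1)]] assms
    by (intro path_hom_pcat path_hom_sym[OF some_in_pclass] path_hom_refl) auto
  then show ?thesis unfolding pact_def using pclass_eq_iff[OF path_hom_imp(2)] by blast
qed

lemma gcov_carrierE:
  assumes "c \<in> gcov_carrier Y y0"
  obtains \<alpha> where "pathin Y \<alpha>" "\<alpha> 0 = y0" "c = pclass Y \<alpha>" "gcov_proj c = \<alpha> 1"
proof -
  obtain \<alpha> where "c = pclass Y \<alpha>" "pathin Y \<alpha>" "\<alpha> 0 = y0" using assms by (auto simp: gcov_carrier_def)
  then show thesis using that gcov_proj_pclass[of Y \<alpha>] by auto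
qed

context
  fixes Y :: "'y topology" and y0 :: 'y and c :: "(real \<Rightarrow> 'y) set" and \<epsilon> :: "real \<Rightarrow> 'y"
  assumes c: "c \<in> gcov_carrier Y y0" and \<epsilon>: "pathin Y \<epsilon>" "\<epsilon> 0 = gcov_proj c"
begin

lemma pact_in_carrier: "pact Y c \<epsilon> \<in> gcov_carrier Y y0" and proj_pact: "gcov_proj (pact Y c \<epsilon>) = \<epsilon> 1"
proof -
  obtain \<alpha> where \<alpha>: "pathin Y \<alpha>" "\<alpha> 0 = y0" "c = pclass Y \<alpha>" "gcov_proj c = \<alpha> 1" using c by (rule gcov_carrierE)
  have e: "pact Y c \<epsilon> = pclass Y (pcat \<alpha> \<epsilon>)" using \<alpha> \<epsilon> by (simp add: pact_pclass)
  have p: "pathin Y (pcat \<alpha> \<epsilon>)" using \<alpha> \<epsilon> by (simp add: pathin_pcat)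
  then show "pact Y c \<epsilon> \<in> gcov_carrier Y y0" using \<alpha>(2) unfolding e gcov_carrier_def by (auto intro!: exI[of _ "pcat \<alpha> \<epsilon>"])
  show "gcov_proj (pact Y c \<epsilon>) = \<epsilon> 1" unfolding e using gcov_proj_pclass[OF p] by simp
qed

lemma pact_pact:
  assumes "pathin Y \<epsilon>'" "\<epsilon>' 0 = \<epsilon> 1" shows "pact Y (pact Y c \<epsilon>) \<epsilon>' = pact Y c (pcat \<epsilon> \<epsilon>')"
proof -
  obtain \<alpha> where \<alpha>: "pathin Y \<alpha>" "\<alpha> 0 = y0" "c = pclass Y \<alpha>" "gcov_proj c = \<alpha> 1" using c by (rule gcov_carrierE)
  have "pact Y (pact Y c \<epsilon>) \<epsilon>' = pclass Y (pcat (pcat \<alpha> \<epsilon>) \<epsilon>')"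
    using \<alpha> \<epsilon> assms by (simp add: pact_pclass pathin_pcat)
  also have "\<dots> = pclass Y (pcat \<alpha> (pcat \<epsilon> \<epsilon>'))"
    using path_hom_assoc[of Y \<alpha> \<epsilon> \<epsilon>'] \<alpha> \<epsilon> assms by (subst pclass_eq_iff) (auto simp: pathin_pcat)
  also have "\<dots> = pact Y c (pcat \<epsilon> \<epsilon>')"
    using \<alpha> \<epsilon> assms by (simp add: pact_pclass pathin_pcat)
  finally show ?thesis .
qed

lemma pact_cong: assumes "path_hom Y \<epsilon> \<epsilon>'" shows "pact Y c \<epsilon> = pact Y c \<epsilon>'"
proof -
  obtain \<alpha> where \<alpha>: "pathin Y \<alpha>" "\<alpha> 0 = y0" "c = pclass Y \<alpha>" "gcov_proj c = \<alpha> 1" using c by (rule gcov_carrierE)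
  note e = path_hom_imp[OF assms]
  have h: "path_hom Y (pcat \<alpha> \<epsilon>) (pcat \<alpha> \<epsilon>')"
    by (rule path_hom_pcat[OF path_hom_refl[OF \<alpha>(1)] assms]) (simp add: \<epsilon>(2) \<alpha>(4))
  have "pact Y c \<epsilon> = pclass Y (pcat \<alpha> \<epsilon>)"
    unfolding \<alpha>(3) by (rule pact_pclass) (simp_all add: \<alpha>(1) \<epsilon> flip: \<alpha>(3,4))
  also have "\<dots> = pclass Y (pcat \<alpha> \<epsilon>')" using pclass_eq_iff[OF path_hom_imp(2)[OF h]] h by simp
  also have "\<dots> = pact Y c \<epsilon>'"
    unfolding \<alpha>(3) by (rule pact_pclass[symmetric]) (simp_all add: \<alpha>(1) e \<epsilon> flip: \<alpha>(3,4))
  finally show ?thesis .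
qed

lemma pact_null:
  assumes "path_hom Y \<epsilon> (\<lambda>_. gcov_proj c)" shows "pact Y c \<epsilon> = c"
proof -
  obtain \<alpha> where \<alpha>: "pathin Y \<alpha>" "\<alpha> 0 = y0" "c = pclass Y \<alpha>" "gcov_proj c = \<alpha> 1" using c by (rule gcov_carrierE)
  have "pact Y c \<epsilon> = pact Y c (\<lambda>_. \<alpha> 1)" using pact_cong[OF assms] \<alpha>(4) by simp
  also have "\<dots> = pclass Y (pcat \<alpha> (\<lambda>_. \<alpha> 1))"
    unfolding \<alpha>(3) using path_hom_imp(2)[OF assms] \<alpha>(4) by (intro pact_pclass[OF \<alpha>(1)]) simp_all
  also have "\<dots> = c" using path_hom_unit[OF \<alpha>(1)] pclass_eq_iff[OF \<alpha>(1)] \<alpha>(3) by blast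
  finally show ?thesis .
qed

end

lemma pact_rev:
  assumes "c \<in> gcov_carrier Y y0" "pathin Y \<epsilon>" "\<epsilon> 0 = gcov_proj c"
  shows "pact Y (pact Y c \<epsilon>) (\<lambda>t. \<epsilon> (1 - t)) = c"
proof -
  note r = pathin_reverse[OF assms(2)]
  have "pact Y (pact Y c \<epsilon>) (\<lambda>t. \<epsilon> (1 - t)) = pact Y c (pcat \<epsilon> (\<lambda>t. \<epsilon> (1 - t)))"
    using pact_pact[OF assms r] by simp
  also have "\<dots> = c"
    by (rule pact_null) (use assms r path_hom_inverse[OF assms(2)] in \<open>auto simp: pathin_pcat\<close>)
  finally show ?thesis .
qed

lemma gcov_proj_in_topspace:
  assumes "c \<in> gcov_carrier Y y0" shows "gcov_proj c \<in> topspace Y"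
proof -
  obtain \<alpha> where "pathin Y \<alpha>" "gcov_proj c = \<alpha> 1" using assms by (rule gcov_carrierE)
  then show ?thesis using pathin_in_topspace[of Y \<alpha> 1] by simp
qed

lemma pact_const:
  assumes "c \<in> gcov_carrier Y y0" shows "pact Y c (\<lambda>_. gcov_proj c) = c"
proof -
  have "pathin Y (\<lambda>_. gcov_proj c)" using gcov_proj_in_topspace[OF assms] by (simp add: pathin_def)
  then show ?thesis by (intro pact_null[OF assms] path_hom_refl) auto
qed

lemma pathin_subtopologyD: "pathin (subtopology Y U) \<epsilon> \<Longrightarrow> pathin Y \<epsilon>"
  by (auto simp: pathin_def continuous_map_in_subtopology)

section \<open>Open sets of the whisker topology and continuity of lifts\<close>

lemma whisker_nbhd_eq:
  assumes "c \<in> gcov_carrier Y y0"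
  shows "whisker_nbhd Y c U = {pact Y c \<epsilon> | \<epsilon>. pathin (subtopology Y U) \<epsilon> \<and> \<epsilon> 0 = gcov_proj c}"
proof -
  obtain \<alpha> where \<alpha>: "pathin Y \<alpha>" "\<alpha> 0 = y0" "c = pclass Y \<alpha>" "gcov_proj c = \<alpha> 1" using assms by (rule gcov_carrierE)
  have "pclass Y (pcat \<beta> \<epsilon>) = pact Y c \<epsilon> \<and> \<beta> 1 = \<alpha> 1"
    if "\<beta> \<in> c" "pathin (subtopology Y U) \<epsilon>" "\<epsilon> 0 = \<beta> 1 \<or> \<epsilon> 0 = \<alpha> 1" for \<beta> \<epsilon>
  proof -
    have h: "path_hom Y \<alpha> \<beta>" using that(1) \<alpha>(3) by (simp add: pclass_eq)
    then have "c = pclass Y \<beta>" using \<alpha>(3) pclass_eq_iff[OF path_hom_imp(2)[OF h]] by simp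
    then show ?thesis using path_hom_imp[OF h] that pathin_subtopologyD[of Y U \<epsilon>] by (auto simp: pact_pclass)
  qed
  moreover have "\<alpha> \<in> c" using \<alpha> by (simp add: pclass_eq path_hom_refl)
  ultimately show ?thesis unfolding whisker_nbhd_def using \<alpha>(4) by (intro set_eqI iffI; clarsimp) metis+
qed

lemma whisker_refl:
  assumes "c \<in> gcov_carrier Y y0" "gcov_proj c \<in> U" shows "c \<in> whisker_nbhd Y c U"
proof -
  have "pathin (subtopology Y U) (\<lambda>_. gcov_proj c)"
    using assms gcov_proj_in_topspace[OF assms(1)] by (simp add: pathin_def)
  then show ?thesis unfolding whisker_nbhd_eq[OF assms(1)] using pact_const[OF assms(1)]
    by (smt (verit, best) mem_Collect_eq)
qed

lemma whisker_memE:
  assumes "c \<in> gcov_carrier Y y0" "d \<in> whisker_nbhd Y c U"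
  obtains \<epsilon> where "pathin (subtopology Y U) \<epsilon>" "pathin Y \<epsilon>" "\<epsilon> 0 = gcov_proj c" "d = pact Y c \<epsilon>"
    "d \<in> gcov_carrier Y y0" "gcov_proj d = \<epsilon> 1" "gcov_proj d \<in> U"
proof -
  obtain \<epsilon> where e: "pathin (subtopology Y U) \<epsilon>" "\<epsilon> 0 = gcov_proj c" "d = pact Y c \<epsilon>"
    using assms by (auto simp: whisker_nbhd_eq)
  have "\<epsilon> 1 \<in> U" using e(1) by (auto simp: pathin_def continuous_map_in_subtopology Pi_iff)
  then show thesis
    using that e pathin_subtopologyD[OF e(1)] pact_in_carrier[OF assms(1)] proj_pact[OF assms(1)] by auto
qed

lemma whisker_subset:
  assumes "c \<in> gcov_carrier Y y0"
  shows "whisker_nbhd Y c U \<subseteq> {d \<in> gcov_carrier Y y0. gcov_proj d \<in> U}"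
proof
  fix d assume "d \<in> whisker_nbhd Y c U"
  then show "d \<in> {d \<in> gcov_carrier Y y0. gcov_proj d \<in> U}" by (rule whisker_memE[OF assms]) blast
qed

text \<open>Paths in U can be concatenated inside U. Hence a whisker set can be recentred at each of
  its points, so these sets are a basis and not just a subbasis; this gives
  \<open>openin_gcov\<close>.\<close>

lemma whisker_trans:
  assumes c: "c \<in> gcov_carrier Y y0" and d: "d \<in> whisker_nbhd Y c U"
  shows "whisker_nbhd Y d U \<subseteq> whisker_nbhd Y c U"
proof
  fix e assume e: "e \<in> whisker_nbhd Y d U"
  obtain \<epsilon> where \<epsilon>: "pathin (subtopology Y U) \<epsilon>" "pathin Y \<epsilon>" "\<epsilon> 0 = gcov_proj c" "d = pact Y c \<epsilon>"
    "d \<in> gcov_carrier Y y0" "gcov_proj d = \<epsilon> 1" by (rule whisker_memE[OF c d])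
  obtain \<epsilon>' where \<epsilon>': "pathin (subtopology Y U) \<epsilon>'" "pathin Y \<epsilon>'" "\<epsilon>' 0 = gcov_proj d" "e = pact Y d \<epsilon>'"
    by (rule whisker_memE[OF \<epsilon>(5) e])
  have "e = pact Y c (pcat \<epsilon> \<epsilon>')" using pact_pact[OF c \<epsilon>(2,3) \<epsilon>'(2)] \<epsilon> \<epsilon>' by simp
  moreover have "pathin (subtopology Y U) (pcat \<epsilon> \<epsilon>')" using \<epsilon> \<epsilon>' by (intro pathin_pcat) auto
  ultimately show "e \<in> whisker_nbhd Y c U" unfolding whisker_nbhd_eq[OF c] using \<epsilon>(3) pcat_ends(1) by fastforce
qed

lemma whisker_mono: "U \<subseteq> V \<Longrightarrow> whisker_nbhd Y c U \<subseteq> whisker_nbhd Y c V"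
proof -
  assume "U \<subseteq> V"
  then have "pathin (subtopology Y V) \<epsilon>" if "pathin (subtopology Y U) \<epsilon>" for \<epsilon>
    using that by (auto simp: pathin_def continuous_map_in_subtopology)
  then show ?thesis unfolding whisker_nbhd_def by blast
qed

lemma openin_gcov:
  "openin (gcov Y y0) W \<longleftrightarrow> W \<subseteq> gcov_carrier Y y0 \<and>
     (\<forall>c\<in>W. \<exists>U. openin Y U \<and> gcov_proj c \<in> U \<and> whisker_nbhd Y c U \<subseteq> W)"
proof
  assume "openin (gcov Y y0) W"
  then have "generate_topology_on {whisker_nbhd Y c U | c U. c \<in> gcov_carrier Y y0 \<and> openin Y U \<and> gcov_proj c \<in> U} W"
    unfolding gcov_def by (rule openin_topology_generated_by)
  then show "W \<subseteq> gcov_carrier Y y0 \<and> (\<forall>c\<in>W. \<exists>U. openin Y U \<and> gcov_proj c \<in> U \<and> whisker_nbhd Y c U \<subseteq> W)"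
  proof induction
    case (Int W1 W2)
    show ?case
    proof (intro conjI ballI)
      fix c assume c: "c \<in> W1 \<inter> W2"
      obtain U where U: "openin Y U" "gcov_proj c \<in> U" "whisker_nbhd Y c U \<subseteq> W1" using Int c by blast
      obtain U' where U': "openin Y U'" "gcov_proj c \<in> U'" "whisker_nbhd Y c U' \<subseteq> W2" using Int c by blast
      have "whisker_nbhd Y c (U \<inter> U') \<subseteq> W1 \<inter> W2"
        using whisker_mono[of "U \<inter> U'" U Y c] whisker_mono[of "U \<inter> U'" U' Y c] U U' by blast
      then show "\<exists>U. openin Y U \<and> gcov_proj c \<in> U \<and> whisker_nbhd Y c U \<subseteq> W1 \<inter> W2"
        using U U' by (intro exI[of _ "U \<inter> U'"]) auto
    qed (use Int in blast)
  next
    case (UN K)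
    then show ?case by (meson Sup_upper UnionE Union_least order_trans)
  next
    case (Basis W)
    then obtain c U where W: "W = whisker_nbhd Y c U" "c \<in> gcov_carrier Y y0" "openin Y U" "gcov_proj c \<in> U" by blast
    show ?case
    proof (intro conjI ballI)
      show "W \<subseteq> gcov_carrier Y y0" unfolding W(1) using whisker_subset[OF W(2)] by blast
      fix d assume d: "d \<in> W"
      then have "gcov_proj d \<in> U" unfolding W(1) using whisker_subset[OF W(2)] by blast
      then show "\<exists>U. openin Y U \<and> gcov_proj d \<in> U \<and> whisker_nbhd Y d U \<subseteq> W"
        using whisker_trans[OF W(2)] d W by blast
    qed
  qed auto
next
  assume W: "W \<subseteq> gcov_carrier Y y0 \<and> (\<forall>c\<in>W. \<exists>U. openin Y U \<and> gcov_proj c \<in> U \<and> whisker_nbhd Y c U \<subseteq> W)"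
  show "openin (gcov Y y0) W"
  proof (subst openin_subopen, intro ballI)
    fix c assume c: "c \<in> W"
    then obtain U where U: "openin Y U" "gcov_proj c \<in> U" "whisker_nbhd Y c U \<subseteq> W" using W by blast
    then have "openin (gcov Y y0) (whisker_nbhd Y c U)"
      unfolding gcov_def using W c by (intro topology_generated_by_Basis) blast
    then show "\<exists>T. openin (gcov Y y0) T \<and> c \<in> T \<and> T \<subseteq> W" using U whisker_refl[of c Y y0 U] W c by blast
  qed
qed

lemma openin_whisker_nbhd:
  assumes "c \<in> gcov_carrier Y y0" "openin Y U" "gcov_proj c \<in> U"
  shows "openin (gcov Y y0) (whisker_nbhd Y c U)"
  unfolding gcov_def using assms by (intro topology_generated_by_Basis) blast

lemma topspace_gcov: "topspace (gcov Y y0) = gcov_carrier Y y0"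
proof
  show "topspace (gcov Y y0) \<subseteq> gcov_carrier Y y0" 
    using openin_gcov[of Y y0 "topspace (gcov Y y0)"] openin_topspace[of "gcov Y y0"] by blast
  have "openin (gcov Y y0) (gcov_carrier Y y0)"
    unfolding openin_gcov
  proof (intro conjI ballI subset_refl)
    fix c assume c: "c \<in> gcov_carrier Y y0"
    then show "\<exists>U. openin Y U \<and> gcov_proj c \<in> U \<and> whisker_nbhd Y c U \<subseteq> gcov_carrier Y y0"
      using whisker_subset[OF c] gcov_proj_in_topspace[OF c] by (intro exI[of _ "topspace Y"]) auto
  qed
  then show "gcov_carrier Y y0 \<subseteq> topspace (gcov Y y0)" by (rule openin_subset)
qed

lemma continuous_map_gcov_proj: "continuous_map (gcov Y y0) Y gcov_proj"
  unfolding continuous_map_def topspace_gcov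
proof (intro conjI allI impI)
  show "gcov_proj \<in> gcov_carrier Y y0 \<rightarrow> topspace Y" using gcov_proj_in_topspace[of _ Y y0] by auto
  fix U assume "openin Y U"
  then show "openin (gcov Y y0) {x \<in> gcov_carrier Y y0. gcov_proj x \<in> U}"
    unfolding openin_gcov using whisker_subset[of _ Y y0 U] by (intro conjI ballI exI[of _ U]) auto
qed

lemma continuous_map_into_gcov:
  assumes "\<And>z. z \<in> topspace Z \<Longrightarrow> F z \<in> gcov_carrier Y y0"
    and "\<And>z U. z \<in> topspace Z \<Longrightarrow> openin Y U \<Longrightarrow> gcov_proj (F z) \<in> U \<Longrightarrow>
      \<exists>N. openin Z N \<and> z \<in> N \<and> (\<forall>w\<in>N. F w \<in> whisker_nbhd Y (F z) U)"
  shows "continuous_map Z (gcov Y y0) F"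
  unfolding continuous_map_eq_topcontinuous_at topcontinuous_at_def topspace_gcov
proof (intro ballI conjI allI impI)
  fix z W assume z: "z \<in> topspace Z" and W: "openin (gcov Y y0) W \<and> F z \<in> W"
  then obtain U where "openin Y U" "gcov_proj (F z) \<in> U" "whisker_nbhd Y (F z) U \<subseteq> W"
    unfolding openin_gcov by blast
  then show "\<exists>U. openin Z U \<and> z \<in> U \<and> (\<forall>y\<in>U. F y \<in> W)" using assms(2)[OF z, of U] by blast
qed (use assms(1) in auto)

text \<open>By local path connectedness a point w near z is joined to z inside the preimage of U.
  Transporting \<open>F z\<close> along the image of that path stays in the whisker neighbourhood
  and ends at \<open>F w\<close> by \<open>tr\<close>.\<close>

lemma continuous_map_lift_gcov:
  assumes lpc: "locally_path_connected_space Z" and f: "continuous_map Z Y f"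
    and F: "\<And>z. z \<in> topspace Z \<Longrightarrow> F z \<in> gcov_carrier Y y0" "\<And>z. z \<in> topspace Z \<Longrightarrow> gcov_proj (F z) = f z"
    and tr: "\<And>\<sigma>. pathin Z \<sigma> \<Longrightarrow> F (\<sigma> 1) = pact Y (F (\<sigma> 0)) (f \<circ> \<sigma>)"
  shows "continuous_map Z (gcov Y y0) F"
proof (rule continuous_map_into_gcov[OF F(1)])
  fix z U assume z: "z \<in> topspace Z" and U: "openin Y U" "gcov_proj (F z) \<in> U"
  have "openin Z {w \<in> topspace Z. f w \<in> U}" using f U(1) by (rule openin_continuous_map_preimage)
  moreover have "z \<in> {w \<in> topspace Z. f w \<in> U}" using z U(2) F(2) by auto
  ultimately obtain N V where N: "openin Z N" "path_connectedin Z V" "z \<in> N" "N \<subseteq> V" "V \<subseteq> {w \<in> topspace Z. f w \<in> U}"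
    using lpc unfolding locally_path_connected_space_def neighbourhood_base_of_def neighbourhood_base_at_def
    using z by (metis (no_types, lifting))
  have "F w \<in> whisker_nbhd Y (F z) U" if w: "w \<in> N" for w
  proof -
    have "path_connected_space (subtopology Z V)" using N(2) by (simp add: path_connectedin_def)
    moreover have "z \<in> topspace (subtopology Z V)" "w \<in> topspace (subtopology Z V)"
      using N w by auto
    ultimately obtain \<sigma> where \<sigma>: "pathin (subtopology Z V) \<sigma>" "\<sigma> 0 = z" "\<sigma> 1 = w"
      unfolding path_connected_space_def by blast
    have p: "pathin Z \<sigma>" "\<sigma> \<in> {0..1} \<rightarrow> V" using \<sigma>(1) by (auto simp: pathin_def continuous_map_in_subtopology)
    have "pathin Y (f \<circ> \<sigma>)" using p(1) f unfolding pathin_def by (rule continuous_map_compose)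
    then have "pathin (subtopology Y U) (f \<circ> \<sigma>)"
      using p(2) N(5) by (auto simp: pathin_def continuous_map_in_subtopology)
    moreover have "F w = pact Y (F z) (f \<circ> \<sigma>)" using tr[OF p(1)] \<sigma> by simp
    ultimately show ?thesis unfolding whisker_nbhd_eq[OF F(1)[OF z]] using \<sigma>(2) F(2)[OF z] by auto
  qed
  then show "\<exists>N. openin Z N \<and> z \<in> N \<and> (\<forall>w\<in>N. F w \<in> whisker_nbhd Y (F z) U)" using N by blast
qed

section \<open>The adjunction space\<close>

definition adj_q :: "(nat \<Rightarrow> 'a) \<Rightarrow> 'a + nat \<times> 'b \<Rightarrow> 'a" where
  "adj_q x y = (case y of Inl z \<Rightarrow> z | Inr (j, b) \<Rightarrow> x j)"

definition adj_r :: "(nat \<Rightarrow> 'b) \<Rightarrow> nat \<Rightarrow> 'a + nat \<times> 'b \<Rightarrow> 'b" where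
  "adj_r a j y = (case y of Inl z \<Rightarrow> a j | Inr (k, b) \<Rightarrow> if k = j then b else a j)"

lemma adj_q_simps [simp]: "adj_q x (Inl z) = z" "adj_q x (Inr (j, b)) = x j" "adj_q x (adj_incl x a j b) = x j"
  by (auto simp: adj_q_def adj_incl_def)

lemma adj_r_simps [simp]: "adj_r a j (Inl z) = a j" "adj_r a j (Inr (k, b)) = (if k = j then b else a j)"
  "adj_r a j (adj_incl x a k b) = (if k = j then b else a j)"
  by (auto simp: adj_r_def adj_incl_def)

lemma adj_incl_base [simp]: "adj_incl x a j (a j) = Inl (x j)"
  by (simp add: adj_incl_def)

lemma adj_collapse_incl: "adj_collapse x k (adj_incl x a j b) = (if j < k then adj_incl x a j b else Inl (x j))"
  by (simp add: adj_collapse_def adj_incl_def)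

lemma adj_collapse_Inl [simp]: "adj_collapse x k (Inl z) = Inl z"
  by (simp add: adj_collapse_def)

locale adj_data =
  fixes X :: "'a topology" and A :: "nat \<Rightarrow> 'b topology" and x :: "nat \<Rightarrow> 'a" and a :: "nat \<Rightarrow> 'b"
  assumes haus_X: "Hausdorff_space X" and x_in: "\<And>j. x j \<in> topspace X"
    and haus_A: "\<And>j. Hausdorff_space (A j)" and a_in: "\<And>j. a j \<in> topspace (A j)"
begin

abbreviation Y :: "('a + nat \<times> 'b) topology" where "Y \<equiv> AdjY X A x a"
abbreviation incl :: "nat \<Rightarrow> 'b \<Rightarrow> 'a + nat \<times> 'b" where "incl \<equiv> adj_incl x a"
abbreviation q :: "'a + nat \<times> 'b \<Rightarrow> 'a" where "q \<equiv> adj_q x"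
abbreviation r :: "nat \<Rightarrow> 'a + nat \<times> 'b \<Rightarrow> 'b" where "r \<equiv> adj_r a"

lemma Inl_in_carrier [simp]: "Inl z \<in> adj_carrier X A x a K \<longleftrightarrow> z \<in> topspace X"
  using x_in by (auto simp: adj_carrier_def adj_incl_def)

lemma Inr_in_carrier [simp]: "Inr (j, b) \<in> adj_carrier X A x a K \<longleftrightarrow> j \<in> K \<and> b \<in> topspace (A j) \<and> b \<noteq> a j"
  by (auto simp: adj_carrier_def adj_incl_def split: if_splits)

lemma incl_in_carrier: "b \<in> topspace (A j) \<Longrightarrow> j \<in> K \<Longrightarrow> incl j b \<in> adj_carrier X A x a K"
  by (auto simp: adj_carrier_def)

lemma openin_adj_stage:
  "openin (adj_stage X A x a k) U \<longleftrightarrow> U \<subseteq> adj_carrier X A x a {..<k} \<and>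
         openin X {z \<in> topspace X. Inl z \<in> U} \<and>
         (\<forall>j<k. openin (A j) {b \<in> topspace (A j). incl j b \<in> U})"
  unfolding adj_stage_def
proof (subst openin_topology_generated_by_closed, goal_cases)
  case (2 U V)
  have "{z \<in> topspace X. Inl z \<in> U \<inter> V} = {z \<in> topspace X. Inl z \<in> U} \<inter> {z \<in> topspace X. Inl z \<in> V}" by auto
  moreover have "{b \<in> topspace (A j). incl j b \<in> U \<inter> V} =
    {b \<in> topspace (A j). incl j b \<in> U} \<inter> {b \<in> topspace (A j). incl j b \<in> V}" for j by auto
  ultimately show ?case using 2 by auto
next
  case (3 K)
  have "{z \<in> topspace X. Inl z \<in> \<Union>K} = (\<Union>U\<in>K. {z \<in> topspace X. Inl z \<in> U})" by auto
  moreover have "{b \<in> topspace (A j). incl j b \<in> \<Union>K} = (\<Union>U\<in>K. {b \<in> topspace (A j). incl j b \<in> U})" for j by auto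
  ultimately show ?case using 3 by (auto intro!: openin_Union)
qed auto

lemma topspace_adj_stage: "topspace (adj_stage X A x a k) = adj_carrier X A x a {..<k}"
proof
  let ?C = "adj_carrier X A x a {..<k}"
  show "topspace (adj_stage X A x a k) \<subseteq> ?C" using openin_adj_stage openin_topspace by blast
  have "{z \<in> topspace X. Inl z \<in> ?C} = topspace X" by auto
  moreover have "{b \<in> topspace (A j). incl j b \<in> ?C} = topspace (A j)" if "j < k" for j
    using that incl_in_carrier by auto
  ultimately have "openin (adj_stage X A x a k) ?C" by (simp add: openin_adj_stage)
  then show "?C \<subseteq> topspace (adj_stage X A x a k)" by (rule openin_subset)
qed

lemma adj_collapse_in_carrier:
  "y \<in> adj_carrier X A x a UNIV \<Longrightarrow> adj_collapse x k y \<in> adj_carrier X A x a {..<k}"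
  using x_in by (cases y) (auto simp: adj_collapse_def)

lemma topspace_Y: "topspace Y = adj_carrier X A x a UNIV"
  unfolding AdjY_def adj_space_def topspace_pullback_topology
  using adj_collapse_in_carrier by (auto simp: topspace_adj_stage PiE_UNIV_domain)

lemma openin_Y_stage:
  assumes "openin (adj_stage X A x a k) O'"
  shows "openin Y {y \<in> topspace Y. adj_collapse x k y \<in> O'}"
proof -
  let ?P = "product_topology (adj_stage X A x a) UNIV"
  have "openin ?P {f \<in> topspace ?P. f k \<in> O'}"
    using continuous_map_product_projection[of k UNIV "adj_stage X A x a"] assms
    by (intro openin_continuous_map_preimage) auto
  moreover have "{y \<in> topspace Y. adj_collapse x k y \<in> O'} =
     (\<lambda>y k. adj_collapse x k y) -` {f \<in> topspace ?P. f k \<in> O'} \<inter> adj_carrier X A x a UNIV"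
    using adj_collapse_in_carrier by (auto simp: topspace_Y topspace_adj_stage PiE_UNIV_domain)
  ultimately show ?thesis
    unfolding AdjY_def adj_space_def openin_pullback_topology by blast
qed

lemma openin_Y_nbhd:
  assumes "openin Y U" "y \<in> U"
  obtains K O' where "finite K" "\<And>k. openin (adj_stage X A x a k) (O' k)" "\<And>k. adj_collapse x k y \<in> O' k"
    "{y' \<in> topspace Y. \<forall>k\<in>K. adj_collapse x k y' \<in> O' k} \<subseteq> U"
proof -
  let ?P = "product_topology (adj_stage X A x a) UNIV"
  obtain W where W: "openin ?P W" "U = (\<lambda>y k. adj_collapse x k y) -` W \<inter> adj_carrier X A x a UNIV"
    using assms(1) unfolding AdjY_def adj_space_def openin_pullback_topology by blast
  have "(\<lambda>k. adj_collapse x k y) \<in> W" using assms(2) W(2) by simp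
  then obtain O' where O': "finite {i. O' i \<noteq> topspace (adj_stage X A x a i)}"
    "\<And>i. openin (adj_stage X A x a i) (O' i)" "(\<lambda>k. adj_collapse x k y) \<in> PiE UNIV O'" "PiE UNIV O' \<subseteq> W"
    using W(1) unfolding openin_product_topology_alt by (metis (no_types, lifting) UNIV_I Collect_cong)
  show thesis
  proof
    show "{y' \<in> topspace Y. \<forall>k\<in>{i. O' i \<noteq> topspace (adj_stage X A x a i)}. adj_collapse x k y' \<in> O' k} \<subseteq> U"
    proof clarify
      fix y' assume y': "y' \<in> topspace Y" "\<forall>k\<in>{i. O' i \<noteq> topspace (adj_stage X A x a i)}. adj_collapse x k y' \<in> O' k"
      have "adj_collapse x k y' \<in> O' k" for k
        using y' adj_collapse_in_carrier[of y' k]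
        by (cases "O' k = topspace (adj_stage X A x a k)") (auto simp: topspace_Y topspace_adj_stage)
      then show "y' \<in> U" using O'(4) y'(1) by (auto simp: W(2) topspace_Y PiE_UNIV_domain)
    qed
  qed (use O' in \<open>auto simp: PiE_UNIV_domain\<close>)
qed

text \<open>Stage 0 of the tower is X itself, and the collapse onto it is q.\<close>

lemma continuous_map_q: "continuous_map Y X q"
  unfolding continuous_map_def
proof (intro conjI allI impI)
  show "q \<in> topspace Y \<rightarrow> topspace X"
    using x_in by (auto simp: topspace_Y adj_q_def split: sum.split)
  fix V assume V: "openin X V"
  have "{z \<in> topspace X. Inl z \<in> Inl ` V} = V" using openin_subset[OF V] by auto
  moreover have "Inl ` V \<subseteq> adj_carrier X A x a {..<0}" using openin_subset[OF V] by auto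
  ultimately have "openin (adj_stage X A x a 0) (Inl ` V)"
    unfolding openin_adj_stage using V by (metis not_less_zero)
  then have "openin Y {y \<in> topspace Y. adj_collapse x 0 y \<in> Inl ` V}" by (rule openin_Y_stage)
  moreover have "adj_collapse x 0 y = Inl (q y)" for y
    by (auto simp: adj_collapse_def adj_q_def split: sum.split)
  ultimately show "openin Y {y \<in> topspace Y. q y \<in> V}" by (simp add: image_iff)
qed

text \<open>Stage \<open>Suc j\<close> is the first one that contains \<open>A j\<close>, and r j
  factors through the collapse onto it.\<close>

lemma continuous_map_r: "continuous_map Y (A j) (r j)"
  unfolding continuous_map_def
proof (intro conjI allI impI)
  show "r j \<in> topspace Y \<rightarrow> topspace (A j)"
    using a_in by (auto simp: topspace_Y adj_r_def split: sum.split)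
  fix V assume V: "openin (A j) V"
  define O' where "O' = {y \<in> adj_carrier X A x a {..<Suc j}. r j y \<in> V}"
  have "{z \<in> topspace X. Inl z \<in> O'} = (if a j \<in> V then topspace X else {})" by (auto simp: O'_def)
  moreover have "{b \<in> topspace (A i). incl i b \<in> O'} =
      (if i = j then V else if a j \<in> V then topspace (A i) else {})" if "i < Suc j" for i
    using that openin_subset[OF V] incl_in_carrier by (auto simp: O'_def)
  ultimately have "openin (adj_stage X A x a (Suc j)) O'"
    using V by (auto simp: openin_adj_stage O'_def)
  then have "openin Y {y \<in> topspace Y. adj_collapse x (Suc j) y \<in> O'}" by (rule openin_Y_stage)
  moreover have "r j (adj_collapse x (Suc j) y) = r j y" for y
    by (auto simp: adj_collapse_def adj_r_def split: sum.split)
  then have "{y \<in> topspace Y. adj_collapse x (Suc j) y \<in> O'} = {y \<in> topspace Y. r j y \<in> V}"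
    using adj_collapse_in_carrier by (auto simp: O'_def topspace_Y)
  ultimately show "openin Y {y \<in> topspace Y. r j y \<in> V}" by simp
qed

text \<open>A basic open set of the limit restricts finitely many stages. In all of these a summand
  with large index is collapsed to its attaching point, so it lies in U as a whole once that point
  is in V.\<close>

lemma openin_Y_nbhd_Inl:
  assumes "openin Y U" "Inl z \<in> U"
  obtains V N where "openin X V" "z \<in> V" "\<And>z'. z' \<in> V \<Longrightarrow> Inl z' \<in> U"
    "\<And>j b. j \<ge> N \<Longrightarrow> x j \<in> V \<Longrightarrow> b \<in> topspace (A j) \<Longrightarrow> incl j b \<in> U"
proof -
  obtain K O' where K: "finite K" "\<And>k. openin (adj_stage X A x a k) (O' k)" "\<And>k. adj_collapse x k (Inl z) \<in> O' k"
    "{y' \<in> topspace Y. \<forall>k\<in>K. adj_collapse x k y' \<in> O' k} \<subseteq> U" by (rule openin_Y_nbhd[OF assms]) blast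
  define V where "V = topspace X \<inter> (\<Inter>k\<in>K. {z \<in> topspace X. Inl z \<in> O' k})"
  obtain N where N: "\<And>k. k \<in> K \<Longrightarrow> k \<le> N" using K(1) finite_nat_set_iff_bounded_le by auto
  show thesis
  proof
    have "openin X {z \<in> topspace X. Inl z \<in> O' k}" for k using K(2)[of k] by (simp add: openin_adj_stage)
    then show "openin X V" unfolding V_def using K(1) by (cases "K = {}") (auto intro!: openin_Int openin_INT)
    have "Inl z \<in> topspace Y" using openin_subset[OF assms(1)] assms(2) by blast
    then show "z \<in> V" using K(3) by (auto simp: V_def topspace_Y)
    show "Inl z' \<in> U" if "z' \<in> V" for z'
      using that K(4) by (auto simp: V_def topspace_Y)
    show "incl j b \<in> U" if "j \<ge> N" "x j \<in> V" "b \<in> topspace (A j)" for j b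
    proof -
      have "adj_collapse x k (incl j b) \<in> O' k" if k: "k \<in> K" for k
        using N[OF k] \<open>j \<ge> N\<close> \<open>x j \<in> V\<close> k by (auto simp: V_def adj_collapse_incl)
      then show ?thesis using K(4) that(3) incl_in_carrier[of b j UNIV] by (auto simp: topspace_Y)
    qed
  qed
qed

lemma continuous_map_Inl: "continuous_map X Y Inl"
  unfolding continuous_map_def
proof (intro conjI allI impI)
  fix U assume U: "openin Y U"
  show "openin X {z \<in> topspace X. Inl z \<in> U}"
  proof (subst openin_subopen, clarify)
    fix z assume "z \<in> topspace X" "Inl z \<in> U"
    from openin_Y_nbhd_Inl[OF U this(2)] obtain V where V: "openin X V" "z \<in> V" "\<And>z'. z' \<in> V \<Longrightarrow> Inl z' \<in> U"
      by metis
    then show "\<exists>T. openin X T \<and> z \<in> T \<and> T \<subseteq> {z \<in> topspace X. Inl z \<in> U}"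
      using openin_subset[OF V(1)] by (intro exI[of _ V]) auto
  qed
qed (auto simp: topspace_Y)

lemma continuous_map_incl: "continuous_map (A j) Y (incl j)"
  unfolding continuous_map_def
proof (intro conjI allI impI)
  show "incl j \<in> topspace (A j) \<rightarrow> topspace Y" using incl_in_carrier by (auto simp: topspace_Y)
  fix U assume U: "openin Y U"
  show "openin (A j) {b \<in> topspace (A j). incl j b \<in> U}"
  proof (subst openin_subopen, clarify)
    fix b assume b: "b \<in> topspace (A j)" "incl j b \<in> U"
    obtain K O' where K: "finite K" "\<And>k. openin (adj_stage X A x a k) (O' k)" "\<And>k. adj_collapse x k (incl j b) \<in> O' k"
      "{y' \<in> topspace Y. \<forall>k\<in>K. adj_collapse x k y' \<in> O' k} \<subseteq> U" by (rule openin_Y_nbhd[OF U b(2)]) blast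
    define V where "V = topspace (A j) \<inter> (\<Inter>k\<in>K. {b \<in> topspace (A j). adj_collapse x k (incl j b) \<in> O' k})"
    have "openin (A j) {b \<in> topspace (A j). adj_collapse x k (incl j b) \<in> O' k}" for k
      using K(2)[of k] by (cases "j < k"; cases "Inl (x j) \<in> O' k") (auto simp: openin_adj_stage adj_collapse_incl)
    then have "openin (A j) V" unfolding V_def using K(1) by (cases "K = {}") (auto intro!: openin_Int openin_INT)
    moreover have "b \<in> V" using b K(3) by (auto simp: V_def)
    moreover have "V \<subseteq> {b \<in> topspace (A j). incl j b \<in> U}"
      using K(4) incl_in_carrier[of _ j UNIV] by (auto simp: V_def topspace_Y)
    ultimately show "\<exists>T. openin (A j) T \<and> b \<in> T \<and> T \<subseteq> {b \<in> topspace (A j). incl j b \<in> U}" by blast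
  qed
qed

text \<open>This is the universal property of the initial topology for q and all r j. Near a point
  over X the late summands are governed by q alone; a point of \<open>A j\<close> off the base point
  is recognised by r j.\<close>

lemma continuous_map_into_Y:
  assumes g: "\<And>z. z \<in> topspace Z \<Longrightarrow> g z \<in> topspace Y"
    and gq: "continuous_map Z X (\<lambda>z. q (g z))" and gr: "\<And>j. continuous_map Z (A j) (\<lambda>z. r j (g z))"
  shows "continuous_map Z Y g"
  unfolding continuous_map_eq_topcontinuous_at topcontinuous_at_def
proof (intro ballI conjI allI impI)
  fix z U assume z: "z \<in> topspace Z" and U: "openin Y U \<and> g z \<in> U"
  have pre: "openin (A j) {b \<in> topspace (A j). incl j b \<in> U}" for j
    using U by (intro openin_continuous_map_preimage[OF continuous_map_incl]) auto
  show "\<exists>N. openin Z N \<and> z \<in> N \<and> (\<forall>w\<in>N. g w \<in> U)"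
  proof (cases "g z")
    case (Inl y)
    obtain V N where V: "openin X V" "y \<in> V" "\<And>z'. z' \<in> V \<Longrightarrow> Inl z' \<in> U"
      "\<And>j b. j \<ge> N \<Longrightarrow> x j \<in> V \<Longrightarrow> b \<in> topspace (A j) \<Longrightarrow> incl j b \<in> U"
      by (rule openin_Y_nbhd_Inl[of U y]) (use U Inl in auto)
    \<comment> \<open>With the finitely many attaching points other than y of early summands
      removed, the only early summands left are attached at y itself; for these, finitely many
      conditions on r j suffice.\<close>
    define V' where "V' = V - {x j | j. j < N \<and> x j \<noteq> y}"
    have "finite {x j | j. j < N \<and> x j \<noteq> y}" by simp
    then have "closedin X {x j | j. j < N \<and> x j \<noteq> y}"
      using x_in haus_X by (intro closedin_Hausdorff_finite) auto
    then have V': "openin X V'" "y \<in> V'" using V by (auto simp: V'_def)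
    define J where "J = {j. j < N \<and> x j = y}"
    define M where "M j = {w \<in> topspace Z. r j (g w) \<in> {b \<in> topspace (A j). incl j b \<in> U}}" for j
    define B where "B = {w \<in> topspace Z. q (g w) \<in> V'} \<inter> (topspace Z \<inter> (\<Inter>j\<in>J. M j))"
    have "openin Z (M j)" for j unfolding M_def using gr pre by (rule openin_continuous_map_preimage)
    moreover have "finite J" by (simp add: J_def)
    ultimately have "openin Z (topspace Z \<inter> (\<Inter>j\<in>J. M j))"
      by (cases "J = {}") (auto intro!: openin_Int openin_INT)
    then have "openin Z B" unfolding B_def using openin_continuous_map_preimage[OF gq V'(1)] by blast
    moreover have "z \<in> B" using z V' Inl U a_in V(2,3) by (auto simp: B_def M_def J_def)
    moreover have "g w \<in> U" if w: "w \<in> B" for w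
    proof (cases "g w")
      case (Inl z') then show ?thesis using w V(3) by (auto simp: B_def V'_def)
    next
      case (Inr p)
      obtain j b where p: "p = (j, b)" by (cases p)
      have "g w \<in> topspace Y" using w g by (auto simp: B_def)
      then have b: "b \<in> topspace (A j)" "b \<noteq> a j" using Inr p by (auto simp: topspace_Y)
      then have e: "g w = incl j b" using Inr p by (simp add: adj_incl_def)
      have xj: "x j \<in> V'" using w Inr p by (auto simp: B_def)
      show ?thesis
      proof (cases "j < N")
        case True
        then have "j \<in> J" using xj by (auto simp: V'_def J_def)
        then have "w \<in> M j" using w by (auto simp: B_def)
        then show ?thesis using e by (auto simp: M_def)
      qed (use V(4)[of j b] xj b e in \<open>auto simp: V'_def\<close>)
    qed
    ultimately show ?thesis by blast
  next
    case (Inr p)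
    obtain j b where p: "p = (j, b)" by (cases p)
    have b: "b \<in> topspace (A j)" "b \<noteq> a j" using Inr p g[OF z] by (auto simp: topspace_Y)
    \<comment> \<open>Away from \<open>a j\<close> the value of r j identifies the point of Y, so
      the base point is removed.\<close>
    define V where "V = {b \<in> topspace (A j). incl j b \<in> U} - {a j}"
    have "openin (A j) V" unfolding V_def
      using pre closedin_Hausdorff_singleton[OF haus_A a_in] by blast
    then have "openin Z {w \<in> topspace Z. r j (g w) \<in> V}" using gr openin_continuous_map_preimage by blast
    moreover have "r j (g z) \<in> V" using Inr p b U by (auto simp: V_def adj_incl_def)
    moreover have "g w \<in> U" if "w \<in> topspace Z" "r j (g w) \<in> V" for w
      using that by (cases "g w") (auto simp: V_def adj_incl_def split: if_splits)
    ultimately show ?thesis using z by blast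
  qed
qed (use g in auto)

end

locale adj_sc = adj_data +
  assumes sing: "\<And>j. is_singleton (bclasses (Hwedge 1) wedge_pt (A j) (a j))"
begin

text \<open>All excursions of the path into the A-summands are contracted at once.\<close>
lemma path_hom_project:
  assumes \<epsilon>: "pathin Y \<epsilon>" and ends: "\<epsilon> 0 = Inl z0" "\<epsilon> 1 = Inl z1"
  shows "path_hom Y \<epsilon> (\<lambda>t. Inl (q (\<epsilon> t)))"
proof -
  have \<epsilon>c: "continuous_map (top_of_set {0..1}) Y \<epsilon>" using \<epsilon> by (simp add: pathin_def)
  have "\<exists>K. continuous_map II (A j) K \<and> (\<forall>s\<in>{0..1}. K (0, s) = r j (\<epsilon> s)) \<and> (\<forall>s\<in>{0..1}. K (1, s) = a j) \<and>
     (\<forall>t\<in>{0..1}. \<forall>s\<in>{0..1}. r j (\<epsilon> s) = a j \<longrightarrow> K (t, s) = a j)" for j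
  proof -
    have "pathin (A j) (\<lambda>t. r j (\<epsilon> t))"
      using continuous_map_compose[OF \<epsilon>c continuous_map_r[of j]] by (simp add: pathin_def o_def)
    from loop_nullhomotopic_rel_base_set[OF haus_A sing a_in this] show ?thesis
      using ends by (smt (verit, best) adj_r_simps(1))
  qed
  then obtain K where K: "\<And>j. continuous_map II (A j) (K j)" "\<And>j s. s \<in> {0..1} \<Longrightarrow> K j (0, s) = r j (\<epsilon> s)"
    "\<And>j s. s \<in> {0..1} \<Longrightarrow> K j (1, s) = a j"
    "\<And>j t s. t \<in> {0..1} \<Longrightarrow> s \<in> {0..1} \<Longrightarrow> r j (\<epsilon> s) = a j \<Longrightarrow> K j (t, s) = a j" by metis
  define H where "H p = (case \<epsilon> (snd p) of Inl z \<Rightarrow> Inl z | Inr (j, b) \<Rightarrow> incl j (K j p))" for p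
  have \<epsilon>in: "\<epsilon> s \<in> topspace Y" if "s \<in> {0..1}" for s
    using continuous_map_image_subset_topspace[OF \<epsilon>c] that by auto
  have qH: "q (H p) = q (\<epsilon> (snd p))" for p
    by (auto simp: H_def split: sum.split)
  \<comment> \<open>\<open>K j\<close> stays at \<open>a j\<close> at every time when r j of the
    path is \<open>a j\<close>. So each r j sees exactly its own contraction, whichever summand the
    path is in.\<close>
  have rH: "r j (H p) = K j p" if "p \<in> topspace II" for j p
  proof (cases "\<epsilon> (snd p)")
    case (Inl z)
    then show ?thesis using K(4)[of "fst p" "snd p" j] that by (auto simp: H_def)
  next
    case (Inr w)
    then show ?thesis using K(4)[of "fst p" "snd p" j] that by (cases w) (auto simp: H_def)
  qed
  show ?thesis
  proof (rule path_homI)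
    show "continuous_map II Y H"
    proof (rule continuous_map_into_Y)
      fix p assume p: "p \<in> topspace II"
      then have "snd p \<in> {0..1}" by auto
      then have "\<epsilon> (snd p) \<in> topspace Y" by (rule \<epsilon>in)
      moreover have "K j p \<in> topspace (A j)" for j
        using continuous_map_image_subset_topspace[OF K(1)] p by blast
      ultimately show "H p \<in> topspace Y"
        using incl_in_carrier by (auto simp: H_def topspace_Y split: sum.split)
    next
      have "continuous_map II X (\<lambda>p. q (\<epsilon> (snd p)))"
        by (rule continuous_map_compose[OF continuous_map_compose[OF continuous_map_snd \<epsilon>c] continuous_map_q, unfolded o_def])
      then show "continuous_map II X (\<lambda>z. q (H z))" by (simp add: qH)
      show "continuous_map II (A j) (\<lambda>z. r j (H z))" for j
        by (rule continuous_map_eq[OF K(1)[of j]]) (simp add: rH)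
    qed
    fix s :: real assume s: "s \<in> {0..1}"
    show "H (0, s) = \<epsilon> s"
      using K(2)[OF s] \<epsilon>in[OF s] by (auto simp: H_def topspace_Y adj_incl_def split: sum.split)
    show "H (1, s) = Inl (q (\<epsilon> s))"
      using K(3)[OF s] by (auto simp: H_def split: sum.split)
  qed (use ends in \<open>auto simp: H_def\<close>)
qed

end

section \<open>Paths through totally bounded sequences\<close>

text \<open>Base 3 with the digits 0 and 1 only: the tail after a digit weighs at most half as much
  as that digit, so strings that differ early have distant values. In base 2 a tail can weigh as
  much as the digit before it.\<close>

definition ternary :: "(nat \<Rightarrow> bool) \<Rightarrow> real" where
  "ternary f = (\<Sum>m. of_bool (f m) / 3 ^ m)"

lemma summable_ternary: "summable (\<lambda>m. of_bool (f m) / 3 ^ m :: real)"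
proof (rule summable_comparison_test')
  show "summable (\<lambda>m. (1/3::real) ^ m)" by (rule summable_geometric) simp
qed (auto simp: power_divide)

lemma ternary_bounds: "0 \<le> ternary f" "ternary f \<le> 3/2"
proof -
  show "0 \<le> ternary f" unfolding ternary_def by (intro suminf_nonneg summable_ternary) auto
  have "ternary f \<le> (\<Sum>m. (1/3::real) ^ m)"
    unfolding ternary_def by (intro suminf_le summable_ternary summable_geometric) (auto simp: power_divide)
  also have "\<dots> = 3/2" by (subst suminf_geometric) auto
  finally show "ternary f \<le> 3/2" .
qed

lemma ternary_shift: "ternary f = (\<Sum>m<M. of_bool (f m) / 3 ^ m) + of_bool (f M) / 3 ^ M + ternary (\<lambda>m. f (m + Suc M)) / 3 ^ Suc M"
proof -
  have "ternary f = (\<Sum>m. of_bool (f (m + Suc M)) / 3 ^ (m + Suc M)) + (\<Sum>m<Suc M. of_bool (f m) / 3 ^ m)"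
    unfolding ternary_def by (rule suminf_split_initial_segment[OF summable_ternary])
  also have "(\<Sum>m. of_bool (f (m + Suc M)) / 3 ^ (m + Suc M) :: real) = (\<Sum>m. (of_bool (f (m + Suc M)) / 3 ^ m) / 3 ^ Suc M)"
    by (intro suminf_cong) (simp only: power_add divide_divide_eq_left)
  also have "\<dots> = ternary (\<lambda>m. f (m + Suc M)) / 3 ^ Suc M"
    unfolding ternary_def by (rule suminf_divide[OF summable_ternary])
  finally show ?thesis by simp
qed

text \<open>Let k be the first difference. After multiplication by 3 to the power k + 1 the leading
  digits differ by 3 and the tails by at most 3/2.\<close>

lemma ternary_separated:
  assumes "f m \<noteq> g m" "m \<le> M" shows "\<bar>ternary f - ternary g\<bar> \<ge> 1 / (2 * 3 ^ M)"
proof -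
  define k where "k = (LEAST m. f m \<noteq> g m)"
  have k: "f k \<noteq> g k" "k \<le> M" 
    unfolding k_def using assms LeastI[of "\<lambda>m. f m \<noteq> g m" m] Least_le[of "\<lambda>m. f m \<noteq> g m" m] by auto
  have low: "f i = g i" if "i < k" for i using not_less_Least[of i "\<lambda>m. f m \<noteq> g m"] that by (auto simp: k_def)
  let ?F = "ternary (\<lambda>m. f (m + Suc k))" and ?G = "ternary (\<lambda>m. g (m + Suc k))"
  have e: "ternary f - ternary g = (of_bool (f k) - of_bool (g k)) / 3 ^ k + (?F - ?G) / 3 ^ Suc k"
    unfolding ternary_shift[of f k] ternary_shift[of g k] using low by (simp add: diff_divide_distrib)
  have "3 ^ Suc k * (ternary f - ternary g) = 3 * (of_bool (f k) - of_bool (g k)) + (?F - ?G)"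
    unfolding e by (simp add: field_simps)
  moreover have "\<bar>3 * (of_bool (f k) - of_bool (g k)) + (?F - ?G)\<bar> \<ge> 3/2"
    using k(1) ternary_bounds[of "\<lambda>m. f (m + Suc k)"] ternary_bounds[of "\<lambda>m. g (m + Suc k)"]
    by (cases "f k"; cases "g k") auto
  ultimately have "3 ^ Suc k * \<bar>ternary f - ternary g\<bar> \<ge> 3/2"
    by (metis abs_mult abs_of_nonneg zero_le_numeral zero_le_power)
  then have "\<bar>ternary f - ternary g\<bar> \<ge> 1 / (2 * 3 ^ k)" by (simp add: field_simps)
  moreover have "1 / (2 * 3 ^ M) \<le> 1 / (2 * 3 ^ k :: real)" using k(2) by (intro divide_left_mono) auto
  ultimately show ?thesis by linarith
qed

text \<open>\<open>R r c d\<close> is meant to say that c and d are joined by a path of diameter less than r.\<close>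

locale small_rel =
  fixes R :: "real \<Rightarrow> 'p \<Rightarrow> 'p \<Rightarrow> bool" and S :: "'p set"
  assumes R_carrier: "R r c d \<Longrightarrow> c \<in> S" and R_pos: "R r c d \<Longrightarrow> 0 < r"
    and R_mono: "R r c d \<Longrightarrow> r \<le> r' \<Longrightarrow> R r' c d"
    and R_refl: "c \<in> S \<Longrightarrow> 0 < r \<Longrightarrow> R r c c"
    and R_sym: "R r c d \<Longrightarrow> R r d c"
    and R_trans: "R r c d \<Longrightarrow> R r' d e \<Longrightarrow> R (r + r') c e"
    and R_conn: "c \<in> S \<Longrightarrow> d \<in> S \<Longrightarrow> \<exists>r. R r c d"
    and R_path: "R r c d \<Longrightarrow> \<exists>\<Gamma>. \<Gamma> 0 = c \<and> \<Gamma> 1 = d \<and> (\<forall>s\<in>{0..1}. \<forall>t\<in>{0..1}. R r (\<Gamma> s) (\<Gamma> t)) \<and>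
       (\<forall>s\<in>{0..1}. \<forall>e>0. \<exists>\<delta>>0. \<forall>t\<in>{0..1::real}. \<bar>t - s\<bar> < \<delta> \<longrightarrow> R e (\<Gamma> s) (\<Gamma> t))"
begin

definition R_continuous :: "real set \<Rightarrow> (real \<Rightarrow> 'p) \<Rightarrow> bool" where
  "R_continuous E \<phi> \<longleftrightarrow> (\<forall>t\<in>E. \<forall>e>0. \<exists>\<delta>>0. \<forall>t'\<in>E. \<bar>t' - t\<bar> < \<delta> \<longrightarrow> R e (\<phi> t) (\<phi> t'))"

definition R_unif_continuous :: "real set \<Rightarrow> (real \<Rightarrow> 'p) \<Rightarrow> bool" where
  "R_unif_continuous E \<phi> \<longleftrightarrow> (\<forall>e>0. \<exists>\<delta>>0. \<forall>t\<in>E. \<forall>t'\<in>E. \<bar>t' - t\<bar> < \<delta> \<longrightarrow> R e (\<phi> t) (\<phi> t'))"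

definition R_seq_compact :: "'p set \<Rightarrow> bool" where
  "R_seq_compact C \<longleftrightarrow> (\<forall>u. (\<forall>m::nat. u m \<in> C) \<longrightarrow> (\<exists>d\<in>C. \<forall>r>0. \<forall>N. \<exists>m\<ge>N. R r d (u m)))"

text \<open>One path serves all radii at once, because it is taken for a radius within
  \<open>\<eta>\<close> of the infimum. In \<open>gap_fill\<close> the path across a gap has to be
  fixed before any e is given.\<close>

lemma near_optimal_path:
  assumes "c \<in> S" "d \<in> S" "0 < \<eta>"
  shows "\<exists>\<Gamma>. \<Gamma> 0 = c \<and> \<Gamma> 1 = d \<and> (\<forall>r. R r c d \<longrightarrow> (\<forall>s\<in>{0..1}. \<forall>t\<in>{0..1}. R (r + \<eta>) (\<Gamma> s) (\<Gamma> t))) \<and>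
     R_continuous {0..1} \<Gamma>"
proof -
  define Q where "Q = {r. R r c d}"
  have Q: "Q \<noteq> {}" "bdd_below Q" using R_conn[OF assms(1,2)] R_pos by (auto simp: Q_def intro!: bdd_belowI[of _ 0] less_imp_le)
  then obtain r where r: "r \<in> Q" "r < Inf Q + \<eta>" using assms(3) cInf_less_iff[of Q "Inf Q + \<eta>"] by auto
  obtain \<Gamma> where \<Gamma>: "\<Gamma> 0 = c" "\<Gamma> 1 = d" "\<forall>s\<in>{0..1}. \<forall>t\<in>{0..1}. R r (\<Gamma> s) (\<Gamma> t)"
       "\<forall>s\<in>{0..1}. \<forall>e>0. \<exists>\<delta>>0. \<forall>t\<in>{0..1::real}. \<bar>t - s\<bar> < \<delta> \<longrightarrow> R e (\<Gamma> s) (\<Gamma> t)"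
    using R_path[of r c d] r by (auto simp: Q_def)
  have "r \<le> r' + \<eta>" if "R r' c d" for r'
    using cInf_lower[of r' Q] Q(2) that r(2) by (auto simp: Q_def)
  then show ?thesis using \<Gamma> R_mono unfolding R_continuous_def by (intro exI[of _ \<Gamma>]) blast
qed

text \<open>Each gap receives a near-optimal path with slack equal to its length. Where E
  accumulates, the nearby gaps are short and have close end values, so the inserted paths are small;
  at the end of a gap the continuity of its own path is used.\<close>

lemma gap_fill:
  assumes E: "closed E" "E \<subseteq> {0..1}" "0 \<in> E" "1 \<in> E"
    and \<phi>S: "\<And>t. t \<in> E \<Longrightarrow> \<phi> t \<in> S" and \<phi>: "R_continuous E \<phi>"
  shows "\<exists>\<gamma>. (\<forall>t\<in>E. \<gamma> t = \<phi> t) \<and> R_continuous {0..1} \<gamma>"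
proof -
  define L where "L = gap_left E"
  define Rt where "Rt = gap_right E"
  note gl = gap_left[OF E, folded L_def] and gr = gap_right[OF E, folded Rt_def]
    and gs = gap_strict[OF E, folded L_def Rt_def] and ge = gap_eq[OF E, folded L_def Rt_def]
  have "\<forall>u v. \<exists>\<Gamma>. u \<in> E \<longrightarrow> v \<in> E \<longrightarrow> u < v \<longrightarrow> (\<Gamma> 0 = \<phi> u \<and> \<Gamma> 1 = \<phi> v \<and>
     (\<forall>r. R r (\<phi> u) (\<phi> v) \<longrightarrow> (\<forall>s\<in>{0..1}. \<forall>t\<in>{0..1}. R (r + (v - u)) (\<Gamma> s) (\<Gamma> t))) \<and> R_continuous {0..1} \<Gamma>)"
    using near_optimal_path[OF \<phi>S \<phi>S] by (metis diff_gt_0_iff_gt)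
  then obtain \<Gamma> where \<Gamma>: "\<And>u v. u \<in> E \<Longrightarrow> v \<in> E \<Longrightarrow> u < v \<Longrightarrow> \<Gamma> u v 0 = \<phi> u \<and> \<Gamma> u v 1 = \<phi> v \<and>
     (\<forall>r. R r (\<phi> u) (\<phi> v) \<longrightarrow> (\<forall>s\<in>{0..1}. \<forall>t\<in>{0..1}. R (r + (v - u)) (\<Gamma> u v s) (\<Gamma> u v t))) \<and> R_continuous {0..1} (\<Gamma> u v)"
    by metis
  define pos where "pos t = (t - L t) / (Rt t - L t)" for t
  define \<gamma> where "\<gamma> t = (if t \<in> E then \<phi> t else \<Gamma> (L t) (Rt t) (pos t))" for t
  have LR: "L t \<in> E" "Rt t \<in> E" "L t < t" "t < Rt t" "L t < Rt t" "pos t \<in> {0..1}" if "t \<in> {0..1}" "t \<notin> E" for t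
    using gl[OF that(1)] gr[OF that(1)] gs[OF that] by (auto simp: pos_def)
  have small: "R (r + (Rt t - L t)) (\<phi> (L t)) (\<gamma> t)"
    if "t \<in> {0..1}" "t \<notin> E" "R r (\<phi> (L t)) (\<phi> (Rt t))" for t r
  proof -
    note * = \<Gamma>[OF LR(1,2,5)[OF that(1,2)]]
    have "\<forall>s\<in>{0..1}. \<forall>u\<in>{0..1}. R (r + (Rt t - L t)) (\<Gamma> (L t) (Rt t) s) (\<Gamma> (L t) (Rt t) u)"
      using * that(3) by blast
    then have "R (r + (Rt t - L t)) (\<Gamma> (L t) (Rt t) 0) (\<Gamma> (L t) (Rt t) (pos t))"
      using LR(6)[OF that(1,2)] by auto
    then show ?thesis using * that(2) by (simp add: \<gamma>_def)
  qed
  \<comment> \<open>The budget is e/4 from \<open>\<phi> t\<close> to the left end, e/4 + e/4 for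
    the radius between the two ends, and e/4 for the length of the gap.\<close>
  have within: "R e (\<phi> t) (\<gamma> t')"
    if "t' \<in> {0..1}" "t' \<notin> E" "R (e/4) (\<phi> t) (\<phi> (L t'))" "R (e/4) (\<phi> t) (\<phi> (Rt t'))" "Rt t' - L t' \<le> e/4" for t t' e
  proof -
    have "R (e/4 + e/4) (\<phi> (L t')) (\<phi> (Rt t'))" using R_trans[OF R_sym[OF that(3)] that(4)] .
    then have "R (e/4 + e/4 + (Rt t' - L t')) (\<phi> (L t')) (\<gamma> t')" using small[OF that(1,2)] by blast
    from R_trans[OF that(3) this] show ?thesis by (rule R_mono) (use that(5) in auto)
  qed
  have "R_continuous {0..1} \<gamma>"
    unfolding R_continuous_def
  proof (intro ballI allI impI)
    fix t e :: real assume t: "t \<in> {0..1}" and e: "0 < e"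
    show "\<exists>\<delta>>0. \<forall>t'\<in>{0..1}. \<bar>t' - t\<bar> < \<delta> \<longrightarrow> R e (\<gamma> t) (\<gamma> t')"
    proof (cases "t \<in> E")
      case False
      note l = LR[OF t False]
      obtain \<delta> where \<delta>: "\<delta> > 0" "\<forall>s\<in>{0..1}. \<bar>s - pos t\<bar> < \<delta> \<longrightarrow> R e (\<Gamma> (L t) (Rt t) (pos t)) (\<Gamma> (L t) (Rt t) s)"
        using \<Gamma>[OF l(1,2,5)] l(6) e unfolding R_continuous_def by blast
      define \<delta>' where "\<delta>' = min (\<delta> * (Rt t - L t)) (min (t - L t) (Rt t - t))"
      have "R e (\<gamma> t) (\<gamma> t')" if "\<bar>t' - t\<bar> < \<delta>'" for t'
      proof -
        have "L t < t'" "t' < Rt t" using that by (auto simp: \<delta>'_def)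
        note g = ge[OF t this]
        have "\<bar>t' - t\<bar> < \<delta> * (Rt t - L t)" using that by (simp add: \<delta>'_def)
        moreover have "pos t' - pos t = (t' - t) / (Rt t - L t)"
          unfolding pos_def g(1,2) by (simp add: diff_divide_distrib)
        ultimately have "\<bar>pos t' - pos t\<bar> < \<delta>" using l(5) by (simp add: abs_divide pos_divide_less_eq)
        then show ?thesis using \<delta>(2) LR(6)[OF g(3,4)] g(1,2,4) False by (simp add: \<gamma>_def)
      qed
      moreover have "\<delta>' > 0" using \<delta>(1) l by (simp add: \<delta>'_def)
      ultimately show ?thesis by blast
    next
      case True
      obtain \<delta> where \<delta>0: "\<delta> > 0" "\<forall>t'\<in>E. \<bar>t' - t\<bar> < \<delta> \<longrightarrow> R (e/4) (\<phi> t) (\<phi> t')"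
        using \<phi> True e unfolding R_continuous_def by (metis divide_pos_pos zero_less_numeral)
      define \<delta>0 where "\<delta>0 = min \<delta> (e/4)"
      have \<delta>0: "\<delta>0 > 0" "\<delta>0 \<le> e/4" "\<And>t'. t' \<in> E \<Longrightarrow> \<bar>t' - t\<bar> < \<delta>0 \<Longrightarrow> R (e/4) (\<phi> t) (\<phi> t')"
        using \<delta>0 e by (auto simp: \<delta>0_def)
      have \<gamma>t: "\<gamma> t = \<phi> t" using True by (simp add: \<gamma>_def)
      have inE: "R e (\<phi> t) (\<gamma> t')" if "t' \<in> E" "\<bar>t' - t\<bar> < \<delta>0" for t'
        using \<delta>0(3)[OF that] R_mono[of "e/4"] e that(1) by (auto simp: \<gamma>_def)
      \<comment> \<open>The side to the right of t. If E has a point s there within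
        \<open>\<delta>0\<close>, all gaps between t and s have both ends close to t; if not, t is 1
        or the left end of a gap. The other side is symmetric.\<close>
      have "\<exists>\<delta>>0. \<forall>t'\<in>{0..1}. t < t' \<and> t' < t + \<delta> \<longrightarrow> R e (\<phi> t) (\<gamma> t')"
      proof (cases "\<exists>s\<in>E. t < s \<and> s < t + \<delta>0")
        case True
        then obtain s where s: "s \<in> E" "t < s" "s < t + \<delta>0" by blast
        have "R e (\<phi> t) (\<gamma> t')" if t': "t' \<in> {0..1}" "t < t'" "t' < s" for t'
        proof (cases "t' \<in> E")
          case False
          have "t \<le> L t'" using gl(3)[OF t'(1) \<open>t \<in> E\<close>] t' by auto
          moreover have "Rt t' \<le> s" using gr(3)[OF t'(1) s(1)] t' by auto
          ultimately show ?thesis using LR[OF t'(1) False] s \<delta>0(2)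
            by (intro within[OF t'(1) False] \<delta>0(3)) auto
        qed (use inE s t' in auto)
        then show ?thesis using s(2) by (intro exI[of _ "s - t"]) auto
      next
        case none: False
        show ?thesis
        proof (cases "t = 1")
          case False
          \<comment> \<open>A point of the gap that begins at t; it serves to name that gap through
            \<open>L\<close> and \<open>Rt\<close>.\<close>
          define t1 where "t1 = min (t + \<delta>0 / 2) ((t + 1) / 2)"
          have t1: "t1 \<in> {0..1}" "t < t1" "t1 < t + \<delta>0" using t False \<delta>0(1) by (auto simp: t1_def min_def)
          then have t1E: "t1 \<notin> E" using none by blast
          have Lt: "L t1 = t"
            using gl[OF t1(1)] True t1 none by (metis less_eq_real_def order_le_less_trans order.asym)
          have Rge: "t + \<delta>0 \<le> Rt t1" using gr[OF t1(1)] none t1 by (meson linorder_not_less order_less_le_trans)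
          note l = LR[OF t1(1) t1E]
          obtain \<delta> where \<delta>: "\<delta> > 0" "\<forall>s\<in>{0..1}. \<bar>s - 0\<bar> < \<delta> \<longrightarrow> R e (\<Gamma> (L t1) (Rt t1) 0) (\<Gamma> (L t1) (Rt t1) s)"
            using \<Gamma>[OF l(1,2,5)] e unfolding R_continuous_def by (metis atLeastAtMost_iff order_refl zero_le_one)
          define \<delta>' where "\<delta>' = min \<delta>0 (\<delta> * (Rt t1 - t))"
          have "R e (\<phi> t) (\<gamma> t')" if t': "t < t'" "t' < t + \<delta>'" for t'
          proof -
            have "L t1 < t'" "t' < Rt t1" using t' Lt Rge by (auto simp: \<delta>'_def)
            note g = ge[OF t1(1) this]
            have p: "pos t' = (t' - t) / (Rt t1 - t)" using g(1,2) Lt by (simp add: pos_def)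
            have "t' - t < \<delta> * (Rt t1 - t)" using t' by (auto simp: \<delta>'_def)
            moreover have "0 < Rt t1 - t" using Lt l(5) by simp
            ultimately have "\<bar>pos t' - 0\<bar> < \<delta>" using t' unfolding p by (simp add: abs_divide pos_divide_less_eq)
            then show ?thesis using \<delta>(2) LR(6)[OF g(3,4)] g(1,2,4) \<Gamma>[OF l(1,2,5)] Lt by (simp add: \<gamma>_def)
          qed
          moreover have "\<delta>' > 0" using \<delta>(1) \<delta>0(1) Lt l(5) by (simp add: \<delta>'_def)
          ultimately show ?thesis by blast
        qed (intro exI[of _ 1], auto)
      qed
      then obtain d1 where d1: "d1 > 0" "\<forall>t'\<in>{0..1}. t < t' \<and> t' < t + d1 \<longrightarrow> R e (\<phi> t) (\<gamma> t')" by blast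
      have "\<exists>\<delta>>0. \<forall>t'\<in>{0..1}. t' < t \<and> t - \<delta> < t' \<longrightarrow> R e (\<phi> t) (\<gamma> t')"
      proof (cases "\<exists>s\<in>E. s < t \<and> t - \<delta>0 < s")
        case True
        then obtain s where s: "s \<in> E" "s < t" "t - \<delta>0 < s" by blast
        have "R e (\<phi> t) (\<gamma> t')" if t': "t' \<in> {0..1}" "t' < t" "s < t'" for t'
        proof (cases "t' \<in> E")
          case False
          have "Rt t' \<le> t" using gr(3)[OF t'(1) \<open>t \<in> E\<close>] t' by auto
          moreover have "s \<le> L t'" using gl(3)[OF t'(1) s(1)] t' by auto
          ultimately show ?thesis using LR[OF t'(1) False] s \<delta>0(2)
            by (intro within[OF t'(1) False] \<delta>0(3)) auto
        qed (use inE s t' in auto)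
        then show ?thesis using s(2) by (intro exI[of _ "t - s"]) auto
      next
        case none: False
        show ?thesis
        proof (cases "t = 0")
          case False
          define t1 where "t1 = max (t - \<delta>0 / 2) (t / 2)"
          have t1: "t1 \<in> {0..1}" "t1 < t" "t - \<delta>0 < t1" using t False \<delta>0(1) by (auto simp: t1_def max_def)
          then have t1E: "t1 \<notin> E" using none by blast
          have Rtt: "Rt t1 = t"
            using gr[OF t1(1)] True t1 none by (metis less_eq_real_def order_less_le_trans order.asym)
          have Lle: "L t1 \<le> t - \<delta>0" using gl[OF t1(1)] none t1 by (meson linorder_not_less order_le_less_trans)
          note l = LR[OF t1(1) t1E]
          obtain \<delta> where \<delta>: "\<delta> > 0" "\<forall>s\<in>{0..1}. \<bar>s - 1\<bar> < \<delta> \<longrightarrow> R e (\<Gamma> (L t1) (Rt t1) 1) (\<Gamma> (L t1) (Rt t1) s)"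
            using \<Gamma>[OF l(1,2,5)] e unfolding R_continuous_def by (metis atLeastAtMost_iff order_refl zero_le_one)
          define \<delta>' where "\<delta>' = min \<delta>0 (\<delta> * (t - L t1))"
          have "R e (\<phi> t) (\<gamma> t')" if t': "t' < t" "t - \<delta>' < t'" for t'
          proof -
            have "L t1 < t'" "t' < Rt t1" using t' Rtt Lle by (auto simp: \<delta>'_def)
            note g = ge[OF t1(1) this]
            have "0 < t - L t1" using Rtt l(5) by simp
            then have p: "pos t' - 1 = (t' - t) / (t - L t1)" using g(1,2) Rtt by (simp add: pos_def field_simps)
            have "t - t' < \<delta> * (t - L t1)" using t' by (auto simp: \<delta>'_def)
            then have "\<bar>pos t' - 1\<bar> < \<delta>" using t' \<open>0 < t - L t1\<close> unfolding p by (simp add: abs_divide pos_divide_less_eq)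
            then show ?thesis using \<delta>(2) LR(6)[OF g(3,4)] g(1,2,4) \<Gamma>[OF l(1,2,5)] Rtt by (simp add: \<gamma>_def)
          qed
          moreover have "\<delta>' > 0" using \<delta>(1) \<delta>0(1) Rtt l(5) by (simp add: \<delta>'_def)
          ultimately show ?thesis by blast
        qed (intro exI[of _ 1], auto)
      qed
      then obtain d2 where d2: "d2 > 0" "\<forall>t'\<in>{0..1}. t' < t \<and> t - d2 < t' \<longrightarrow> R e (\<phi> t) (\<gamma> t')" by blast
      have "R e (\<gamma> t) (\<gamma> t')" if "t' \<in> {0..1}" "\<bar>t' - t\<bar> < min \<delta>0 (min d1 d2)" for t'
      proof -
        consider "t' = t" | "t < t'" | "t' < t" by linarith
        then show ?thesis
        proof cases
          case 1 then show ?thesis using inE[OF True] \<delta>0(1) \<gamma>t by simp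
        qed (use d1(2) d2(2) that \<gamma>t in auto)
      qed
      then show ?thesis using \<delta>0(1) d1(1) d2(1) by (intro exI[of _ "min \<delta>0 (min d1 d2)"]) auto
    qed
  qed
  then show ?thesis by (intro exI[of _ \<gamma>]) (simp add: \<gamma>_def)
qed

end

section \<open>Extension to limit times and the choice of positions\<close>

context small_rel
begin

text \<open>Sequential compactness of C takes the place of completeness: the value at a limit time
  is some cluster point of values at nearby times, with no claim of uniqueness. Uniform continuity
  makes every such choice continuous, with e split into three parts.\<close>

lemma extend_to_closure:
  assumes C: "C \<subseteq> S" "R_seq_compact C" and \<phi>C: "\<And>t. t \<in> E \<Longrightarrow> \<phi> t \<in> C"
    and \<phi>: "R_unif_continuous E \<phi>"
  shows "\<exists>\<psi>. (\<forall>t\<in>E. \<psi> t = \<phi> t) \<and> (\<forall>t\<in>closure E. \<psi> t \<in> C) \<and> R_continuous (closure E) \<psi>"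
proof -
  have "\<exists>d\<in>C. (t \<in> E \<longrightarrow> d = \<phi> t) \<and> (\<forall>e>0. \<forall>\<eta>>0. \<exists>t'\<in>E. \<bar>t' - t\<bar> < \<eta> \<and> R e d (\<phi> t'))"
    if t: "t \<in> closure E" for t
  proof (cases "t \<in> E")
    case True
    then show ?thesis using \<phi>C C(1) by (intro bexI[of _ "\<phi> t"]) (auto intro!: bexI[of _ t] R_refl)
  next
    case False
    have "\<exists>t'\<in>E. \<bar>t' - t\<bar> < 1 / real (Suc m)" for m
      using t by (force simp: closure_approachable dist_real_def)
    then obtain v where v: "\<And>m. v m \<in> E" "\<And>m. \<bar>v m - t\<bar> < 1 / real (Suc m)" by metis
    obtain d where d: "d \<in> C" "\<And>r N. r > 0 \<Longrightarrow> \<exists>m\<ge>N. R r d (\<phi> (v m))"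
      using C(2) \<phi>C v(1) unfolding R_seq_compact_def by meson
    have "\<exists>t'\<in>E. \<bar>t' - t\<bar> < \<eta> \<and> R e d (\<phi> t')" if e: "e > 0" "\<eta> > 0" for e \<eta>
    proof -
      obtain N where N: "1 / real (Suc N) < \<eta>" using nat_approx_posE[OF e(2)] by blast
      obtain m where m: "m \<ge> N" "R e d (\<phi> (v m))" using d(2)[OF e(1)] by blast
      have "1 / real (Suc m) \<le> 1 / real (Suc N)" using m(1) by (intro divide_left_mono) auto
      then have "\<bar>v m - t\<bar> < \<eta>" using v(2)[of m] N by linarith
      then show ?thesis using v(1) m(2) by blast
    qed
    then show ?thesis using d(1) False by blast
  qed
  then obtain \<psi> where \<psi>: "\<And>t. t \<in> closure E \<Longrightarrow> \<psi> t \<in> C" "\<And>t. t \<in> closure E \<Longrightarrow> t \<in> E \<Longrightarrow> \<psi> t = \<phi> t"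
    "\<And>t e \<eta>. t \<in> closure E \<Longrightarrow> e > 0 \<Longrightarrow> \<eta> > 0 \<Longrightarrow> \<exists>t'\<in>E. \<bar>t' - t\<bar> < \<eta> \<and> R e (\<psi> t) (\<phi> t')"
    by metis
  have "R_continuous (closure E) \<psi>"
    unfolding R_continuous_def
  proof (intro ballI allI impI)
    fix t e :: real assume t: "t \<in> closure E" and e: "e > 0"
    then have e3: "e / 3 > 0" by simp
    then obtain \<delta> where \<delta>: "\<delta> > 0" "\<forall>s\<in>E. \<forall>s'\<in>E. \<bar>s' - s\<bar> < \<delta> \<longrightarrow> R (e / 3) (\<phi> s) (\<phi> s')"
      using \<phi> unfolding R_unif_continuous_def by blast
    have \<delta>3: "\<delta> / 3 > 0" using \<delta>(1) by simp
    have "R e (\<psi> t) (\<psi> t')" if t': "t' \<in> closure E" "\<bar>t' - t\<bar> < \<delta> / 3" for t'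
    proof -
      obtain s where s: "s \<in> E" "\<bar>s - t\<bar> < \<delta> / 3" "R (e / 3) (\<psi> t) (\<phi> s)" using \<psi>(3)[OF t e3 \<delta>3] by blast
      obtain s' where s': "s' \<in> E" "\<bar>s' - t'\<bar> < \<delta> / 3" "R (e / 3) (\<psi> t') (\<phi> s')" using \<psi>(3)[OF t'(1) e3 \<delta>3] by blast
      have "\<bar>s' - s\<bar> < \<delta>" using s(2) s'(2) t'(2) by linarith
      then have "R (e / 3) (\<phi> s) (\<phi> s')" using \<delta>(2) s(1) s'(1) by blast
      from R_trans[OF R_trans[OF s(3) this] R_sym[OF s'(3)]] show ?thesis by simp
    qed
    then show "\<exists>\<delta>>0. \<forall>t'\<in>closure E. \<bar>t' - t\<bar> < \<delta> \<longrightarrow> R e (\<psi> t) (\<psi> t')" using \<delta>3 by blast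
  qed
  then show ?thesis using \<psi>(1,2) closure_subset[of E] by (intro exI[of _ \<psi>]) blast
qed

text \<open>This is total boundedness. Otherwise each N has an index \<open>i N\<close> whose point
  is far from all points of index up to N, while a cluster point of these puts two of them close
  together.\<close>

lemma finite_net:
  assumes C: "R_seq_compact C" "\<And>i::nat. c i \<in> C" and r: "r > 0"
  shows "\<exists>N. \<forall>i. \<exists>k\<le>N. R r (c k) (c i)"
proof (rule ccontr)
  assume "\<not> ?thesis"
  then obtain i where i: "\<And>N k. k \<le> N \<Longrightarrow> \<not> R r (c k) (c (i N))" by metis
  have "\<exists>d\<in>C. \<forall>e>0. \<forall>N. \<exists>m\<ge>N. R e d (c (i m))"
    using C(1)[unfolded R_seq_compact_def, rule_format, of "\<lambda>m. c (i m)"] C(2) by blast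
  then obtain d where d: "\<And>e N. e > 0 \<Longrightarrow> \<exists>m\<ge>N. R e d (c (i m))" by blast
  have r2: "r / 2 > 0" using r by simp
  obtain m where m: "R (r/2) d (c (i m))" using d[OF r2, of 0] by blast
  \<comment> \<open>\<open>m' \<ge> i m\<close> puts \<open>c (i m)\<close> among the points from
    which \<open>c (i m')\<close> is far.\<close>
  obtain m' where m': "m' \<ge> i m" "R (r/2) d (c (i m'))" using d[OF r2, of "i m"] by blast
  have "R r (c (i m)) (c (i m'))" using R_trans[OF R_sym[OF m] m'(2)] by simp
  then show False using i[OF m'(1)] by blast
qed

definition digit :: "(nat \<Rightarrow> 'p) \<Rightarrow> nat \<Rightarrow> nat \<Rightarrow> bool" where
  "digit c i m = (if even m then (case prod_decode (m div 2) of (k, n) \<Rightarrow> R (1 / 2 ^ n) (c k) (c i))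
                  else m div 2 = i)"

text \<open>The even digits record which small balls contain c i, so that close positions belong to close
points; the odd digits make the positions isolated.\<close>
lemma positions:
  assumes C: "R_seq_compact C" "\<And>i::nat. c i \<in> C"
  obtains \<tau> \<rho> :: "nat \<Rightarrow> real" where "\<And>i. 1/4 \<le> \<tau> i" "\<And>i. \<tau> i \<le> 3/4" "\<And>i. 0 < \<rho> i" "\<And>i. \<rho> i \<le> 1/16"
    "\<And>i k. i \<noteq> k \<Longrightarrow> 2 * (\<rho> i + \<rho> k) \<le> \<bar>\<tau> i - \<tau> k\<bar>"
    "\<And>e. e > 0 \<Longrightarrow> \<exists>\<delta>>0. \<forall>i k. \<bar>\<tau> i - \<tau> k\<bar> < \<delta> \<longrightarrow> R e (c i) (c k)"
proof
  \<comment> \<open>The Cantor values, which are at most 3/2, are scaled by 1/3 into the interval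
    from 1/4 to 3/4. \<open>D\<close> below is the bound of \<open>ternary_separated\<close> after
    this scaling.\<close>
  define \<tau> where "\<tau> i = 1/4 + ternary (digit c i) / 3" for i
  define D where "D M = (1 / (6 * 3 ^ M) :: real)" for M :: nat
  \<comment> \<open>Digit \<open>2 * i + 1\<close> is set for i alone, so every other position is at
    least \<open>D (2 * i + 1)\<close> away from \<open>\<tau> i\<close>. With a quarter of this as
    radius, even twice the sum of two radii is at most the distance of their centres.\<close>
  define \<rho> where "\<rho> i = D (2 * i + 1) / 4" for i
  have sep: "\<bar>\<tau> i - \<tau> k\<bar> \<ge> D M" if "digit c i m \<noteq> digit c k m" "m \<le> M" for i k m M
    using ternary_separated[of "digit c i" m "digit c k" M, OF that]
    unfolding \<tau>_def D_def by (simp add: field_simps abs_if split: if_splits)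
  show "1/4 \<le> \<tau> i" "\<tau> i \<le> 3/4" for i
    using ternary_bounds[of "digit c i"] by (auto simp: \<tau>_def)
  show "0 < \<rho> i" for i by (simp add: \<rho>_def D_def)
  have D6: "D M \<le> 1/6" for M by (simp add: D_def field_simps)
  show "\<rho> i \<le> 1/16" for i using D6[of "2 * i + 1"] by (simp add: \<rho>_def)
  show "2 * (\<rho> i + \<rho> k) \<le> \<bar>\<tau> i - \<tau> k\<bar>" if "i \<noteq> k" for i k
  proof -
    have "digit c i (2 * i + 1) \<noteq> digit c k (2 * i + 1)" "digit c i (2 * k + 1) \<noteq> digit c k (2 * k + 1)"
      using that by (auto simp: digit_def)
    then have "D (2 * i + 1) \<le> \<bar>\<tau> i - \<tau> k\<bar>" "D (2 * k + 1) \<le> \<bar>\<tau> i - \<tau> k\<bar>" using sep by blast+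
    then show ?thesis by (simp add: \<rho>_def)
  qed
  show "\<exists>\<delta>>0. \<forall>i k. \<bar>\<tau> i - \<tau> k\<bar> < \<delta> \<longrightarrow> R e (c i) (c k)" if e: "e > 0" for e
  proof -
    obtain n where n: "(1/2) ^ n < e / 2" using real_arch_pow_inv[of "e/2" "1/2"] e by auto
    obtain N where N: "\<And>i. \<exists>k\<le>N. R (1 / 2 ^ n) (c k) (c i)" using finite_net[where c=c, OF C(1) C(2), of "1 / 2 ^ n"] by auto
    \<comment> \<open>Positions closer than \<open>D M\<close> agree in all digits up to M, hence in
      those that record closeness to the net points at scale \<open>1 / 2 ^ n\<close>; so both
      points are close to a common net point.\<close>
    define M where "M = Max ((\<lambda>k. 2 * prod_encode (k, n)) ` {..N})"
    have M: "2 * prod_encode (k, n) \<le> M" if "k \<le> N" for k unfolding M_def using that by (intro Max_ge) auto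
    have "R e (c i) (c k)" if ik: "\<bar>\<tau> i - \<tau> k\<bar> < D M" for i k
    proof -
      obtain l where l: "l \<le> N" "R (1 / 2 ^ n) (c l) (c i)" using N by blast
      have "digit c i (2 * prod_encode (l, n)) = digit c k (2 * prod_encode (l, n))"
        using sep[OF _ M[OF l(1)]] ik by (meson linorder_not_less)
      then have "R (1 / 2 ^ n) (c l) (c k)" using l(2) by (simp add: digit_def)
      from R_trans[OF R_sym[OF l(2)] this] show ?thesis
        by (rule R_mono) (use n in \<open>simp add: power_one_over\<close>)
    qed
    moreover have "D M > 0" by (simp add: D_def)
    ultimately show ?thesis by blast
  qed
qed

text \<open>The intervals of rest may accumulate at further times; the values there come from
  \<open>extend_to_closure\<close>, which is where compactness of C enters. The times 0 and 1 are
  included with value y, so that the path starts there and \<open>gap_fill\<close> applies.\<close>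

lemma path_through_sequence:
  assumes C: "C \<subseteq> S" "R_seq_compact C" "\<And>i::nat. c i \<in> C" "y \<in> C"
  obtains \<gamma> and \<tau> \<rho> :: "nat \<Rightarrow> real" where "R_continuous {0..1} \<gamma>" "\<gamma> 0 = y"
    "\<And>i. 0 < \<tau> i - \<rho> i" "\<And>i. \<tau> i + \<rho> i < 1" "\<And>i. 0 < \<rho> i"
    "\<And>i t. \<bar>t - \<tau> i\<bar> \<le> \<rho> i \<Longrightarrow> \<gamma> t = c i"
    "\<And>i k t. \<bar>t - \<tau> i\<bar> \<le> \<rho> i \<Longrightarrow> \<bar>t - \<tau> k\<bar> \<le> \<rho> k \<Longrightarrow> i = k"
proof -
  obtain \<tau> \<rho> :: "nat \<Rightarrow> real" where \<tau>: "\<And>i. 1/4 \<le> \<tau> i" "\<And>i. \<tau> i \<le> 3/4" "\<And>i. 0 < \<rho> i" "\<And>i. \<rho> i \<le> 1/16"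
    "\<And>i k. i \<noteq> k \<Longrightarrow> 2 * (\<rho> i + \<rho> k) \<le> \<bar>\<tau> i - \<tau> k\<bar>"
    "\<And>e. e > 0 \<Longrightarrow> \<exists>\<delta>>0. \<forall>i k. \<bar>\<tau> i - \<tau> k\<bar> < \<delta> \<longrightarrow> R e (c i) (c k)"
    by (rule positions[where c=c, OF C(2) C(3)]) blast
  define J where "J i = {t. \<bar>t - \<tau> i\<bar> \<le> \<rho> i}" for i
  have J01: "1/8 \<le> t" "t \<le> 7/8" if "t \<in> J i" for t i
    using that \<tau>(1,2,4)[of i] by (auto simp: J_def abs_le_iff)
  \<comment> \<open>The radii take up at most half of the distance of two centres, so times in
    different intervals are at least half as far apart as the centres.\<close>
  have close: "\<bar>\<tau> i - \<tau> k\<bar> \<le> 2 * \<bar>t' - t\<bar>" if "t \<in> J i" "t' \<in> J k" for t t' i k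
  proof (cases "i = k")
    case False
    have "\<bar>\<tau> i - \<tau> k\<bar> \<le> \<bar>t' - t\<bar> + \<rho> i + \<rho> k" using that by (auto simp: J_def)
    then show ?thesis using \<tau>(5)[OF False] by auto
  qed auto
  have uniq: "i = k" if "t \<in> J i" "t \<in> J k" for t i k
    using close[OF that] \<tau>(5)[of i k] \<tau>(3)[of i] \<tau>(3)[of k] by fastforce
  define E where "E = (\<Union>i. J i) \<union> {0, 1}"
  define \<phi> where "\<phi> t = (if t \<in> (\<Union>i. J i) then c (THE i. t \<in> J i) else y)" for t
  have \<phi>J: "\<phi> t = c i" if "t \<in> J i" for t i
  proof -
    have "(THE i. t \<in> J i) = i" using that uniq by blast
    then show ?thesis using that by (auto simp: \<phi>_def)
  qed
  have n01: "0 \<notin> J i" "1 \<notin> J i" for i using J01 by force+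
  have \<phi>01: "\<phi> 0 = y" "\<phi> 1 = y" using n01 by (auto simp: \<phi>_def)
  have \<phi>C: "\<phi> t \<in> C" for t using C(3,4) by (simp add: \<phi>_def)
  have "R_unif_continuous E \<phi>"
    unfolding R_unif_continuous_def
  proof (intro allI impI)
    fix e :: real assume e: "e > 0"
    obtain \<delta> where \<delta>: "\<delta> > 0" "\<forall>i k. \<bar>\<tau> i - \<tau> k\<bar> < \<delta> \<longrightarrow> R e (c i) (c k)" using \<tau>(6)[OF e] by blast
    \<comment> \<open>The bound 1/8 isolates the times 0 and 1, because every \<open>J i\<close>
      lies between 1/8 and 7/8.\<close>
    have "R e (\<phi> t) (\<phi> t')" if t: "t \<in> E" "t' \<in> E" "\<bar>t' - t\<bar> < min (\<delta> / 2) (1/8)" for t t'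
    proof (cases "t \<in> (\<Union>i. J i) \<and> t' \<in> (\<Union>i. J i)")
      case True
      then obtain i k where ik: "t \<in> J i" "t' \<in> J k" by blast
      have "\<bar>\<tau> i - \<tau> k\<bar> < \<delta>" using close[OF ik] t(3) by auto
      then show ?thesis using \<delta>(2) \<phi>J[OF ik(1)] \<phi>J[OF ik(2)] by simp
    next
      case False
      have "t = t'" using False t J01 by (fastforce simp: E_def)
      then show ?thesis using R_refl[OF _ e] \<phi>C C(1) by blast
    qed
    then show "\<exists>\<delta>>0. \<forall>t\<in>E. \<forall>t'\<in>E. \<bar>t' - t\<bar> < \<delta> \<longrightarrow> R e (\<phi> t) (\<phi> t')"
      using \<delta>(1) by (intro exI[of _ "min (\<delta> / 2) (1/8)"]) auto
  qed
  from extend_to_closure[OF C(1,2) \<phi>C this] obtain \<psi> where \<psi>: "\<And>t. t \<in> E \<Longrightarrow> \<psi> t = \<phi> t"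
    "\<And>t. t \<in> closure E \<Longrightarrow> \<psi> t \<in> C" "R_continuous (closure E) \<psi>" by blast
  have "E \<subseteq> {0..1}" using J01 by (fastforce simp: E_def)
  then have "closure E \<subseteq> {0..1}" by (intro closure_minimal) auto
  moreover have "0 \<in> closure E" "1 \<in> closure E" using closure_subset[of E] by (auto simp: E_def)
  ultimately obtain \<gamma> where \<gamma>: "\<And>t. t \<in> closure E \<Longrightarrow> \<gamma> t = \<psi> t" "R_continuous {0..1} \<gamma>"
    using gap_fill[of "closure E" \<psi>] \<psi>(2,3) C(1) by (metis closed_closure subsetD)
  have \<gamma>E: "\<gamma> t = \<phi> t" if "t \<in> E" for t using \<gamma>(1) \<psi>(1) that closure_subset[of E] by auto
  show thesis
  proof
    show "R_continuous {0..1} \<gamma>" by fact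
    show "\<gamma> 0 = y" using \<gamma>E[of 0] \<phi>01 by (simp add: E_def)
    show "0 < \<tau> i - \<rho> i" "\<tau> i + \<rho> i < 1" "0 < \<rho> i" for i using \<tau>(1,2,3,4)[of i] by auto
    show "\<gamma> t = c i" if "\<bar>t - \<tau> i\<bar> \<le> \<rho> i" for i t
    proof -
      have "t \<in> J i" using that by (simp add: J_def)
      then show ?thesis using \<gamma>E[of t] \<phi>J by (auto simp: E_def)
    qed
    show "i = k" if "\<bar>t - \<tau> i\<bar> \<le> \<rho> i" "\<bar>t - \<tau> k\<bar> \<le> \<rho> k" for i k t
      using uniq[of t i k] that by (simp add: J_def)
  qed
qed

end

section \<open>Lifts and the small-path relation on the covering of X\<close>

context adj_sc
begin

lemma pathin_incl: "pathin (A j) \<delta> \<Longrightarrow> pathin Y (incl j \<circ> \<delta>)"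
  unfolding pathin_def by (rule continuous_map_compose[OF _ continuous_map_incl])

lemma pathin_Inl: "pathin X \<epsilon> \<Longrightarrow> pathin Y (Inl \<circ> \<epsilon>)"
  unfolding pathin_def by (rule continuous_map_compose[OF _ continuous_map_Inl])

text \<open>q sends the loop to a constant, so \<open>path_hom_project\<close> makes it
  null-homotopic in Y.\<close>

lemma pact_loop:
  assumes c: "c \<in> gcov_carrier Y y" "gcov_proj c = Inl (x j)"
    and \<delta>: "pathin (A j) \<delta>" "\<delta> 0 = a j" "\<delta> 1 = a j"
  shows "pact Y c (incl j \<circ> \<delta>) = c"
proof (rule pact_null[OF c(1)])
  have "path_hom Y (incl j \<circ> \<delta>) (\<lambda>t. Inl (q ((incl j \<circ> \<delta>) t)))"
    by (rule path_hom_project[OF pathin_incl[OF \<delta>(1)]]) (use \<delta> in auto)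
  then show "path_hom Y (incl j \<circ> \<delta>) (\<lambda>_. gcov_proj c)" using c(2) by simp
qed (use pathin_incl \<delta> c in auto)

text \<open>One path followed by the reverse of the other is a loop in \<open>A j\<close>, which
  acts trivially. So a point of a copy of \<open>A j\<close> depends only on its position in
  \<open>A j\<close>, and copies at different fibre points are disjoint.\<close>

lemma pact_incl_unique:
  assumes c: "c \<in> gcov_carrier Y y" "gcov_proj c = Inl (x j)" and c': "c' \<in> gcov_carrier Y y" "gcov_proj c' = Inl (x j)"
    and \<delta>: "pathin (A j) \<delta>" "\<delta> 0 = a j" and \<delta>': "pathin (A j) \<delta>'" "\<delta>' 0 = a j" "\<delta> 1 = \<delta>' 1"
  shows "pact Y c (incl j \<circ> \<delta>) = pact Y c' (incl j \<circ> \<delta>') \<longleftrightarrow> c = c'"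
proof -
  have p: "pathin Y (incl j \<circ> \<delta>)" "pathin Y (incl j \<circ> \<delta>')" using \<delta> \<delta>' pathin_incl by auto
  define \<sigma> where "\<sigma> = pcat \<delta> (\<lambda>t. \<delta>' (1 - t))"
  have \<sigma>: "pathin (A j) \<sigma>" "\<sigma> 0 = a j" "\<sigma> 1 = a j"
    using \<delta> \<delta>' by (auto simp: \<sigma>_def intro!: pathin_pcat pathin_reverse)
  have "pact Y (pact Y c (incl j \<circ> \<delta>)) (\<lambda>t. (incl j \<circ> \<delta>') (1 - t)) = pact Y c (pcat (incl j \<circ> \<delta>) (\<lambda>t. (incl j \<circ> \<delta>') (1 - t)))"
    by (rule pact_pact[OF c(1) p(1)]) (use c \<delta> \<delta>' pathin_reverse[OF p(2)] in auto)
  also have "pcat (incl j \<circ> \<delta>) (\<lambda>t. (incl j \<circ> \<delta>') (1 - t)) = incl j \<circ> \<sigma>"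
    by (auto simp: \<sigma>_def pcat_def)
  also have "pact Y c (incl j \<circ> \<sigma>) = c" by (rule pact_loop[OF c \<sigma>])
  finally have 1: "pact Y (pact Y c (incl j \<circ> \<delta>)) (\<lambda>t. (incl j \<circ> \<delta>') (1 - t)) = c" .
  have 2: "pact Y (pact Y c' (incl j \<circ> \<delta>')) (\<lambda>t. (incl j \<circ> \<delta>') (1 - t)) = c'"
    by (rule pact_rev[OF c'(1) p(2)]) (use c' \<delta>' in auto)
  have 3: "pact Y (pact Y c' (incl j \<circ> \<delta>)) (\<lambda>t. (incl j \<circ> \<delta>) (1 - t)) = c'"
    by (rule pact_rev[OF c'(1) p(1)]) (use c' \<delta> in auto)
  show ?thesis
  proof
    assume "c = c'"
    have "pact Y c' (incl j \<circ> \<delta>') = pact Y c (incl j \<circ> \<delta>)"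
    proof -
      have "pact Y (pact Y (pact Y c (incl j \<circ> \<delta>)) (\<lambda>t. (incl j \<circ> \<delta>') (1 - t))) (\<lambda>t. (\<lambda>t. (incl j \<circ> \<delta>') (1 - t)) (1 - t))
         = pact Y c (incl j \<circ> \<delta>)"
      proof (rule pact_rev)
        show "pact Y c (incl j \<circ> \<delta>) \<in> gcov_carrier Y y"
          by (rule pact_in_carrier[OF c(1) p(1)]) (use c \<delta> in auto)
        have "gcov_proj (pact Y c (incl j \<circ> \<delta>)) = (incl j \<circ> \<delta>) 1"
          by (rule proj_pact[OF c(1) p(1)]) (use c \<delta> in auto)
        then show "(incl j \<circ> \<delta>') (1 - 0) = gcov_proj (pact Y c (incl j \<circ> \<delta>))" using \<delta>' by simp
      qed (rule pathin_reverse[OF p(2)])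
      then show ?thesis unfolding 1 using \<open>c = c'\<close> by (simp add: o_def)
    qed
    then show "pact Y c (incl j \<circ> \<delta>) = pact Y c' (incl j \<circ> \<delta>')" by simp
  next
    assume "pact Y c (incl j \<circ> \<delta>) = pact Y c' (incl j \<circ> \<delta>')"
    then show "c = c'" using 1 2 by metis
  qed
qed

end

locale adj_metric = adj_sc +
  fixes d :: "'a \<Rightarrow> 'a \<Rightarrow> real" and y0 :: 'a
  assumes metric: "Metric_space (topspace X) d" and mtop: "Metric_space.mtopology (topspace X) d = X"
    and y0_in: "y0 \<in> topspace X"
begin

abbreviation Cr :: "(real \<Rightarrow> 'a + nat \<times> 'b) set set" where "Cr \<equiv> gcov_carrier Y (Inl y0)"
abbreviation Yt :: "(real \<Rightarrow> 'a + nat \<times> 'b) set topology" where "Yt \<equiv> gcov Y (Inl y0)"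
abbreviation fib :: "nat \<Rightarrow> (real \<Rightarrow> 'a + nat \<times> 'b) set set" where "fib \<equiv> fiberj X A x a y0"
abbreviation lift :: "nat \<Rightarrow> (real \<Rightarrow> 'a + nat \<times> 'b) set \<Rightarrow> (real \<Rightarrow> 'a + nat \<times> 'b) set set"
  where "lift \<equiv> liftA X A x a"

section \<open>Copies of the summands in the covering\<close>

definition Xs :: "(real \<Rightarrow> 'a + nat \<times> 'b) set set" where
  "Xs = {c \<in> Cr. gcov_proj c \<in> Inl ` topspace X}"

lemma Xtilde_eq: "Xtilde X A x a y0 = subtopology Yt Xs"
  by (simp add: Xtilde_def Xs_def)

lemma fib_iff: "c \<in> fib j \<longleftrightarrow> c \<in> Cr \<and> gcov_proj c = Inl (x j)"
  by (simp add: fiberj_def gcov_fiber_def)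

lemma fib_Xs: "c \<in> fib j \<Longrightarrow> c \<in> Xs"
  using x_in by (auto simp: fib_iff Xs_def)

lemma lift_eq:
  assumes "c \<in> fib j"
  shows "lift j c = {pact Y c (incl j \<circ> \<delta>) | \<delta>. pathin (A j) \<delta> \<and> \<delta> 0 = a j}"
proof -
  have c: "c \<in> Cr" "gcov_proj c = Inl (x j)" using assms by (auto simp: fib_iff)
  obtain \<alpha> where \<alpha>: "pathin Y \<alpha>" "c = pclass Y \<alpha>" "gcov_proj c = \<alpha> 1" using c(1) by (rule gcov_carrierE)
  have 1: "pclass Y (pcat \<beta> (incl j \<circ> \<delta>)) = pact Y c (incl j \<circ> \<delta>)"
    if "\<beta> \<in> c" "pathin (A j) \<delta>" "\<delta> 0 = a j" for \<beta> \<delta>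
  proof -
    have h: "path_hom Y \<alpha> \<beta>" using that(1) \<alpha>(2) by (simp add: pclass_eq)
    note b = path_hom_imp[OF h]
    have "c = pclass Y \<beta>" using \<alpha>(2) pclass_eq_iff[OF b(2)] h by simp
    then show ?thesis using that b \<alpha>(3) c(2) pathin_incl by (simp add: pact_pclass)
  qed
  have "\<alpha> \<in> c" using \<alpha> path_hom_refl by (simp add: pclass_eq)
  then show ?thesis unfolding liftA_def using 1 by blast
qed

lemma lift_memE:
  assumes "c \<in> fib j" "z \<in> lift j c"
  obtains \<delta> where "pathin (A j) \<delta>" "\<delta> 0 = a j" "z = pact Y c (incl j \<circ> \<delta>)" "z \<in> Cr" "gcov_proj z = incl j (\<delta> 1)"
    "\<delta> 1 \<in> topspace (A j)"
proof -
  obtain \<delta> where \<delta>: "pathin (A j) \<delta>" "\<delta> 0 = a j" "z = pact Y c (incl j \<circ> \<delta>)"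
    using assms lift_eq by blast
  have c: "c \<in> Cr" "gcov_proj c = Inl (x j)" using assms by (auto simp: fib_iff)
  note p = pathin_incl[OF \<delta>(1)]
  have s: "(incl j \<circ> \<delta>) 0 = gcov_proj c" using \<delta> c by simp
  show thesis
    using that[OF \<delta>] pact_in_carrier[OF c(1) p s] proj_pact[OF c(1) p s] \<delta>(3) pathin_in_topspace[OF \<delta>(1), of 1] by simp
qed

text \<open>A path in \<open>A j\<close> whose image ends over X ends at \<open>a j\<close>, so it
  is a loop and acts trivially.\<close>

lemma lift_over_X:
  assumes c: "c \<in> fib j" and z: "z \<in> lift j c" "gcov_proj z = Inl w" shows "z = c"
proof -
  obtain \<delta> where \<delta>: "pathin (A j) \<delta>" "\<delta> 0 = a j" "z = pact Y c (incl j \<circ> \<delta>)" "gcov_proj z = incl j (\<delta> 1)"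
    by (rule lift_memE[OF c z(1)])
  then have "\<delta> 1 = a j" using z(2) by (auto simp: adj_incl_def split: if_splits)
  then show ?thesis using \<delta> pact_loop[of c "Inl y0" j \<delta>] c by (simp add: fib_iff)
qed

lemma lift_unique:
  assumes c: "c \<in> fib j" "z \<in> lift j c" and c': "c' \<in> fib k" "z \<in> lift k c'" and z: "gcov_proj z = Inr w"
  shows "j = k \<and> c = c'"
proof -
  obtain \<delta> where \<delta>: "pathin (A j) \<delta>" "\<delta> 0 = a j" "z = pact Y c (incl j \<circ> \<delta>)" "gcov_proj z = incl j (\<delta> 1)"
    by (rule lift_memE[OF c])
  obtain \<delta>' where \<delta>': "pathin (A k) \<delta>'" "\<delta>' 0 = a k" "z = pact Y c' (incl k \<circ> \<delta>')" "gcov_proj z = incl k (\<delta>' 1)"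
    by (rule lift_memE[OF c'])
  have jk: "j = k" "\<delta> 1 = \<delta>' 1" using z \<delta>(4) \<delta>'(4) by (auto simp: adj_incl_def split: if_splits)
  then have "c = c'" using pact_incl_unique[of c "Inl y0" j c' \<delta> \<delta>'] c(1) c'(1) \<delta> \<delta>' by (simp add: fib_iff)
  then show ?thesis using jk by simp
qed

text \<open>The r j image of a path representing z runs from \<open>a j\<close> to b, whatever that
  path does in between; going back along it from z leads to the required c.\<close>

lemma lift_exists:
  assumes z: "z \<in> Cr" "gcov_proj z = Inr (j, b)"
  obtains c where "c \<in> fib j" "z \<in> lift j c"
proof -
  obtain \<beta> where \<beta>: "pathin Y \<beta>" "\<beta> 0 = Inl y0" "gcov_proj z = \<beta> 1" using z(1) by (rule gcov_carrierE)
  define \<delta> where "\<delta> = r j \<circ> \<beta>"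
  have \<delta>: "pathin (A j) \<delta>" "\<delta> 0 = a j" "\<delta> 1 = b"
    using \<beta>(2) z(2) pathin_compose[OF \<beta>(1) continuous_map_r[of j]] by (auto simp: \<delta>_def simp flip: \<beta>(3))
  have "Inr (j, b) \<in> topspace Y" using gcov_proj_in_topspace[OF z(1)] z(2) by simp
  then have b: "incl j b = Inr (j, b)" by (simp add: topspace_Y adj_incl_def)
  note p = pathin_incl[OF \<delta>(1)]
  note pr = pathin_reverse[OF p]
  define c where "c = pact Y z (\<lambda>t. (incl j \<circ> \<delta>) (1 - t))"
  have s: "(incl j \<circ> \<delta>) (1 - 0) = gcov_proj z" using \<delta> b z(2) by simp
  have c: "c \<in> fib j" using pact_in_carrier[OF z(1) pr s] proj_pact[OF z(1) pr s] \<delta>(2) by (simp add: fib_iff c_def)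
  have "pact Y c (\<lambda>t. (\<lambda>t. (incl j \<circ> \<delta>) (1 - t)) (1 - t)) = z" unfolding c_def by (rule pact_rev[OF z(1) pr s])
  then have "z = pact Y c (incl j \<circ> \<delta>)" by (simp add: o_def)
  then show thesis using that[OF c] lift_eq[OF c] \<delta> by blast
qed

section \<open>The small-path relation\<close>

definition RR :: "real \<Rightarrow> (real \<Rightarrow> 'a + nat \<times> 'b) set \<Rightarrow> (real \<Rightarrow> 'a + nat \<times> 'b) set \<Rightarrow> bool" where
  "RR e c c' \<longleftrightarrow> c \<in> Xs \<and> (\<exists>\<epsilon>. pathin X \<epsilon> \<and> Inl (\<epsilon> 0) = gcov_proj c \<and> c' = pact Y c (Inl \<circ> \<epsilon>) \<and>
     (\<forall>s\<in>{0..1}. \<forall>t\<in>{0..1}. d (\<epsilon> s) (\<epsilon> t) < e))"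

lemma pact_Inl:
  assumes c: "c \<in> Cr" and \<epsilon>: "pathin X \<epsilon>" "Inl (\<epsilon> 0) = gcov_proj c"
  shows "pact Y c (Inl \<circ> \<epsilon>) \<in> Xs" "gcov_proj (pact Y c (Inl \<circ> \<epsilon>)) = Inl (\<epsilon> 1)"
proof -
  have s: "(Inl \<circ> \<epsilon>) 0 = gcov_proj c" using \<epsilon>(2) by simp
  show "gcov_proj (pact Y c (Inl \<circ> \<epsilon>)) = Inl (\<epsilon> 1)" 
    using proj_pact[OF c pathin_Inl[OF \<epsilon>(1)] s] by (simp add: o_def)
  then show "pact Y c (Inl \<circ> \<epsilon>) \<in> Xs"
    using pact_in_carrier[OF c pathin_Inl[OF \<epsilon>(1)] s] pathin_in_topspace[OF \<epsilon>(1), of 1] by (simp add: Xs_def o_def)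
qed

lemma pathin_continuous_at:
  assumes \<epsilon>: "pathin X \<epsilon>" and s: "s \<in> {0..1}" "e > 0"
  obtains \<delta> where "\<delta> > 0" "\<And>t. t \<in> {0..1} \<Longrightarrow> \<bar>t - s\<bar> < \<delta> \<Longrightarrow> d (\<epsilon> s) (\<epsilon> t) < e"
proof -
  interpret Metric_space "topspace X" d by (rule metric)
  have \<epsilon>s: "\<epsilon> s \<in> topspace X" using pathin_in_topspace[OF \<epsilon> s(1)] .
  have "openin (top_of_set {0..1}) {t \<in> topspace (top_of_set {0..1}). \<epsilon> t \<in> mball (\<epsilon> s) e}"
    using \<epsilon> openin_mball[of "\<epsilon> s" e] unfolding mtop pathin_def by (rule openin_continuous_map_preimage)
  then obtain T where T: "open T" "{t \<in> topspace (top_of_set {0..1}). \<epsilon> t \<in> mball (\<epsilon> s) e} = {0..1} \<inter> T"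
    unfolding openin_open by blast
  have "s \<in> {t \<in> topspace (top_of_set {0..1}). \<epsilon> t \<in> mball (\<epsilon> s) e}" using s \<epsilon>s by simp
  then have "s \<in> T" unfolding T(2) by blast
  with T(1) obtain \<delta> where \<delta>: "\<delta> > 0" "ball s \<delta> \<subseteq> T" by (meson openE)
  have "d (\<epsilon> s) (\<epsilon> t) < e" if "t \<in> {0..1}" "\<bar>t - s\<bar> < \<delta>" for t
  proof -
    have "t \<in> T" using \<delta>(2) that(2) by (auto simp: dist_real_def)
    then have "t \<in> {t \<in> topspace (top_of_set {0..1}). \<epsilon> t \<in> mball (\<epsilon> s) e}" unfolding T(2) using that(1) by blast
    then show ?thesis by simp
  qed
  then show thesis using that \<delta>(1) by blast
qed

text \<open>Transport of c along the initial pieces of \<open>\<epsilon>\<close> traces its lift,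
  and two points of the lift are joined by the piece between their times. Since s may come after t,
  that piece is described by \<open>closed_segment\<close>.\<close>

lemma RR_subpath:
  assumes c: "c \<in> Xs" and \<epsilon>: "pathin X \<epsilon>" "Inl (\<epsilon> 0) = gcov_proj c" and st: "s \<in> {0..1}" "t \<in> {0..1}"
    and small: "\<And>u v. u \<in> closed_segment s t \<Longrightarrow> v \<in> closed_segment s t \<Longrightarrow> d (\<epsilon> u) (\<epsilon> v) < e"
  shows "RR e (pact Y c (Inl \<circ> (\<lambda>u. \<epsilon> (s * u)))) (pact Y c (Inl \<circ> (\<lambda>u. \<epsilon> (t * u))))"
proof -
  have cC: "c \<in> Cr" using c by (simp add: Xs_def)
  have lin: "pathin (top_of_set {0..1}) (\<lambda>u. w * u)" if "w \<in> {0..1}" for w :: real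
    by (rule pathin_unit) (use that in \<open>auto intro!: continuous_intros simp: mult_le_one\<close>)
  have seg: "s + (t - s) * u \<in> closed_segment s t" if "u \<in> {0..1}" for u
    using that by (auto simp: in_segment algebra_simps intro!: exI[of _ u])
  have "closed_segment s t \<subseteq> {0..1}" using st by (intro closed_segment_subset) auto
  then have lin2: "pathin (top_of_set {0..1}) (\<lambda>u. s + (t - s) * u)"
    using seg by (intro pathin_unit continuous_intros) blast
  have sub: "pathin X (\<lambda>u. \<epsilon> (w * u))" if "w \<in> {0..1}" for w
    using pathin_unit_comp[OF \<epsilon>(1) lin[OF that]] by (simp add: o_def)
  define \<sigma> where "\<sigma> = (\<lambda>u. \<epsilon> (s + (t - s) * u))"
  have \<sigma>: "pathin X \<sigma>" using pathin_unit_comp[OF \<epsilon>(1) lin2] by (simp add: o_def \<sigma>_def)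
  have st0: "(Inl \<circ> (\<lambda>u. \<epsilon> (s * u))) 0 = gcov_proj c" using \<epsilon>(2) by simp
  note ps = pact_Inl[OF cC sub[OF st(1)]]
  have "pact Y (pact Y c (Inl \<circ> (\<lambda>u. \<epsilon> (s * u)))) (Inl \<circ> \<sigma>) = pact Y c (pcat (Inl \<circ> (\<lambda>u. \<epsilon> (s * u))) (Inl \<circ> \<sigma>))"
    by (rule pact_pact[OF cC pathin_Inl[OF sub[OF st(1)]] st0 pathin_Inl[OF \<sigma>]]) (simp add: \<sigma>_def)
  also have "\<dots> = pact Y c (Inl \<circ> (\<lambda>u. \<epsilon> (t * u)))"
  proof (rule pact_cong[OF cC])
    have "path_hom Y (pcat ((Inl \<circ> \<epsilon>) \<circ> (\<lambda>u. s * u)) ((Inl \<circ> \<epsilon>) \<circ> (\<lambda>u. s + (t - s) * u))) ((Inl \<circ> \<epsilon>) \<circ> (\<lambda>u. t * u))"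
      by (rule path_hom_pcat_reparam[OF pathin_Inl[OF \<epsilon>(1)] lin[OF st(1)] lin2 lin[OF st(2)]]) auto
    then show h: "path_hom Y (pcat (Inl \<circ> (\<lambda>u. \<epsilon> (s * u))) (Inl \<circ> \<sigma>)) (Inl \<circ> (\<lambda>u. \<epsilon> (t * u)))"
      by (simp add: o_def \<sigma>_def)
    show "pathin Y (pcat (Inl \<circ> (\<lambda>u. \<epsilon> (s * u))) (Inl \<circ> \<sigma>))" by (rule path_hom_imp(1)[OF h])
    show "pcat (Inl \<circ> (\<lambda>u. \<epsilon> (s * u))) (Inl \<circ> \<sigma>) 0 = gcov_proj c" using st0 by simp
  qed
  finally have e: "pact Y c (Inl \<circ> (\<lambda>u. \<epsilon> (t * u))) = pact Y (pact Y c (Inl \<circ> (\<lambda>u. \<epsilon> (s * u)))) (Inl \<circ> \<sigma>)" by simp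
  show ?thesis unfolding RR_def
  proof (intro conjI exI[of _ \<sigma>])
    show "\<forall>u\<in>{0..1}. \<forall>v\<in>{0..1}. d (\<sigma> u) (\<sigma> v) < e" using small seg by (auto simp: \<sigma>_def)
  qed (use ps \<sigma> e \<epsilon>(2) in \<open>auto simp: \<sigma>_def\<close>)
qed

lemma RR_path:
  assumes "RR e c c'"
  shows "\<exists>\<Gamma>. \<Gamma> 0 = c \<and> \<Gamma> 1 = c' \<and> (\<forall>s\<in>{0..1}. \<forall>t\<in>{0..1}. RR e (\<Gamma> s) (\<Gamma> t)) \<and>
       (\<forall>s\<in>{0..1}. \<forall>e>0. \<exists>\<delta>>0. \<forall>t\<in>{0..1::real}. \<bar>t - s\<bar> < \<delta> \<longrightarrow> RR e (\<Gamma> s) (\<Gamma> t))"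
proof -
  interpret Metric_space "topspace X" d by (rule metric)
  obtain \<epsilon> where c: "c \<in> Xs" and \<epsilon>: "pathin X \<epsilon>" "Inl (\<epsilon> 0) = gcov_proj c" "c' = pact Y c (Inl \<circ> \<epsilon>)"
     "\<forall>s\<in>{0..1}. \<forall>t\<in>{0..1}. d (\<epsilon> s) (\<epsilon> t) < e" using assms by (auto simp: RR_def)
  have cC: "c \<in> Cr" using c by (simp add: Xs_def)
  define \<Gamma> where "\<Gamma> s = pact Y c (Inl \<circ> (\<lambda>u. \<epsilon> (s * u)))" for s
  have seg: "closed_segment s t \<subseteq> {0..1::real}" if "s \<in> {0..1}" "t \<in> {0..1}" for s t
    using that by (intro closed_segment_subset) auto
  have "RR e' (\<Gamma> s) (\<Gamma> t)"
    if "s \<in> {0..1}" "t \<in> {0..1}" "\<And>u v. u \<in> closed_segment s t \<Longrightarrow> v \<in> closed_segment s t \<Longrightarrow> d (\<epsilon> u) (\<epsilon> v) < e'" for s t e'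
    unfolding \<Gamma>_def by (rule RR_subpath[OF c \<epsilon>(1,2) that])
  note * = this
  show ?thesis
  proof (intro exI[of _ \<Gamma>] conjI ballI allI impI)
    have "Inl \<circ> (\<lambda>u. \<epsilon> (0 * u)) = (\<lambda>_. gcov_proj c)" using \<epsilon>(2) by (auto simp: o_def)
    then show "\<Gamma> 0 = c" unfolding \<Gamma>_def using pact_const[OF cC] by metis
    show "\<Gamma> 1 = c'" using \<epsilon>(3) by (simp add: \<Gamma>_def)
    show "RR e (\<Gamma> s) (\<Gamma> t)" if "s \<in> {0..1}" "t \<in> {0..1}" for s t
      using *[OF that] \<epsilon>(4) seg[OF that] by blast
    fix s e' :: real assume s: "s \<in> {0..1}" and e': "e' > 0"
    \<comment> \<open>Two points of the piece between s and t are compared through the point at time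
      s, hence the half.\<close>
    then have "e' / 2 > 0" by simp
    from pathin_continuous_at[OF \<epsilon>(1) s this] obtain \<delta>
      where \<delta>: "\<delta> > 0" "\<And>t. t \<in> {0..1} \<Longrightarrow> \<bar>t - s\<bar> < \<delta> \<Longrightarrow> d (\<epsilon> s) (\<epsilon> t) < e' / 2" by blast
    have "RR e' (\<Gamma> s) (\<Gamma> t)" if t: "t \<in> {0..1}" "\<bar>t - s\<bar> < \<delta>" for t
    proof (rule *[OF s t(1)])
      fix u v assume uv: "u \<in> closed_segment s t" "v \<in> closed_segment s t"
      then have in01: "u \<in> {0..1}" "v \<in> {0..1}" using seg[OF s t(1)] by auto
      have "\<bar>u - s\<bar> < \<delta>" "\<bar>v - s\<bar> < \<delta>" using uv t(2) by (auto simp: closed_segment_eq_real_ivl split: if_splits)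
      then have "d (\<epsilon> s) (\<epsilon> u) < e' / 2" "d (\<epsilon> s) (\<epsilon> v) < e' / 2" using \<delta>(2) in01 by auto
      moreover have "d (\<epsilon> u) (\<epsilon> v) \<le> d (\<epsilon> u) (\<epsilon> s) + d (\<epsilon> s) (\<epsilon> v)"
        using triangle pathin_in_topspace[OF \<epsilon>(1)] in01 s by auto
      ultimately show "d (\<epsilon> u) (\<epsilon> v) < e'" by (simp add: commute)
    qed
    then show "\<exists>\<delta>>0. \<forall>t\<in>{0..1}. \<bar>t - s\<bar> < \<delta> \<longrightarrow> RR e' (\<Gamma> s) (\<Gamma> t)" using \<delta>(1) by blast
  qed
qed

lemma RR_in: "RR e c c' \<Longrightarrow> c \<in> Xs \<and> c' \<in> Xs"
  unfolding RR_def using pact_Inl(1) by (auto simp: Xs_def)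

text \<open>Together with \<open>whisker_RR\<close> this says that over X the small-path relation
  induces the whisker topology.\<close>

lemma RR_whisker:
  assumes U: "openin Y U" and c: "c \<in> Xs" "gcov_proj c \<in> U"
  shows "\<exists>e>0. \<forall>c'. RR e c c' \<longrightarrow> c' \<in> whisker_nbhd Y c U"
proof -
  interpret Metric_space "topspace X" d by (rule metric)
  obtain z where z: "gcov_proj c = Inl z" "z \<in> topspace X" using c(1) by (auto simp: Xs_def)
  have "openin X {z \<in> topspace X. Inl z \<in> U}" by (rule openin_continuous_map_preimage[OF continuous_map_Inl U])
  then have "openin mtopology {z \<in> topspace X. Inl z \<in> U}" by (simp only: mtop)
  then obtain e where e: "e > 0" "mball z e \<subseteq> {z \<in> topspace X. Inl z \<in> U}"
    using z c(2) unfolding openin_mtopology by auto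
  have "c' \<in> whisker_nbhd Y c U" if R: "RR e c c'" for c'
  proof -
    obtain \<epsilon> where \<epsilon>: "pathin X \<epsilon>" "Inl (\<epsilon> 0) = gcov_proj c" "c' = pact Y c (Inl \<circ> \<epsilon>)"
     "\<forall>s\<in>{0..1}. \<forall>t\<in>{0..1}. d (\<epsilon> s) (\<epsilon> t) < e" using R by (auto simp: RR_def)
    have "Inl (\<epsilon> t) \<in> U" if "t \<in> {0..1}" for t
      using e(2) \<epsilon>(2,4) z that pathin_in_topspace[OF \<epsilon>(1) that] by (force simp: subset_iff)
    then have "pathin (subtopology Y U) (Inl \<circ> \<epsilon>)"
      using pathin_Inl[OF \<epsilon>(1)] by (auto simp: pathin_def continuous_map_in_subtopology)
    then show ?thesis using whisker_nbhd_eq[of c Y "Inl y0" U] c(1) \<epsilon>(2,3) by (auto simp: Xs_def)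
  qed
  then show ?thesis using e(1) by blast
qed

text \<open>The path may leave X on the way; \<open>path_hom_project\<close> replaces it by its
  projection without changing the end of the lift.\<close>

lemma RR_project:
  assumes c: "c \<in> Xs" and \<mu>: "pathin Y \<mu>" "\<mu> 0 = gcov_proj c" "\<mu> 1 = Inl z"
    and small: "\<And>s t. s \<in> {0..1} \<Longrightarrow> t \<in> {0..1} \<Longrightarrow> d (q (\<mu> s)) (q (\<mu> t)) < e"
  shows "RR e c (pact Y c \<mu>)"
proof -
  obtain w where w: "gcov_proj c = Inl w" and cC: "c \<in> Cr" using c by (auto simp: Xs_def)
  have "path_hom Y \<mu> (\<lambda>t. Inl (q (\<mu> t)))" using path_hom_project[OF \<mu>(1) _ \<mu>(3)] \<mu>(2) w by simp
  then have "pact Y c \<mu> = pact Y c (Inl \<circ> (q \<circ> \<mu>))" using pact_cong[OF cC \<mu>(1,2)] by (simp add: o_def)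
  moreover have "pathin X (q \<circ> \<mu>)" using pathin_compose[OF \<mu>(1) continuous_map_q] .
  moreover have "Inl ((q \<circ> \<mu>) 0) = gcov_proj c" using \<mu>(2) w by simp
  ultimately show ?thesis unfolding RR_def using c small by (intro conjI exI[of _ "q \<circ> \<mu>"]) auto
qed

text \<open>The set is a preimage under q, so together with z it contains every summand attached at
  z as a whole. The last clause serves paths that run inside such a summand.\<close>

lemma q_ball:
  assumes "z \<in> topspace X" "e > 0"
  obtains U where "openin Y U" "Inl z \<in> U" "\<And>y y'. y \<in> U \<Longrightarrow> y' \<in> U \<Longrightarrow> d (q y) (q y') < e"
    "\<And>y. y \<in> topspace Y \<Longrightarrow> q y = z \<Longrightarrow> y \<in> U"
proof -
  interpret Metric_space "topspace X" d by (rule metric)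
  define U where "U = {y \<in> topspace Y. q y \<in> mball z (e / 2)}"
  show thesis
  proof
    show "openin Y U" unfolding U_def
      using openin_mball[of z "e/2"] unfolding mtop by (rule openin_continuous_map_preimage[OF continuous_map_q])
    show "Inl z \<in> U" using assms by (auto simp: U_def topspace_Y)
    show "d (q y) (q y') < e" if "y \<in> U" "y' \<in> U" for y y'
    proof -
      have *: "q y \<in> topspace X" "q y' \<in> topspace X" "d z (q y) < e/2" "d z (q y') < e/2" using that by (auto simp: U_def)
      have "d (q y) (q y') \<le> d (q y) z + d z (q y')" using triangle * assms(1) by auto
      then show ?thesis using * by (simp add: commute)
    qed
    show "y \<in> U" if "y \<in> topspace Y" "q y = z" for y
      using that assms by (auto simp: U_def)
  qed
qed

lemma whisker_RR:
  assumes c: "c \<in> Xs" and e: "e > 0"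
  obtains U where "openin Y U" "gcov_proj c \<in> U" "\<And>c'. c' \<in> whisker_nbhd Y c U \<Longrightarrow> c' \<in> Xs \<Longrightarrow> RR e c c'"
proof -
  obtain z where z: "gcov_proj c = Inl z" "z \<in> topspace X" and cC: "c \<in> Cr" using c by (auto simp: Xs_def)
  obtain U where U: "openin Y U" "Inl z \<in> U" "\<And>y y'. y \<in> U \<Longrightarrow> y' \<in> U \<Longrightarrow> d (q y) (q y') < e"
    by (rule q_ball[OF z(2) e]) blast
  have "RR e c c'" if c': "c' \<in> whisker_nbhd Y c U" "c' \<in> Xs" for c'
  proof -
    obtain \<epsilon> where \<epsilon>: "pathin (subtopology Y U) \<epsilon>" "pathin Y \<epsilon>" "\<epsilon> 0 = gcov_proj c" "c' = pact Y c \<epsilon>" "gcov_proj c' = \<epsilon> 1"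
      by (rule whisker_memE[OF cC c'(1)])
    obtain z' where z': "\<epsilon> 1 = Inl z'" using c'(2) \<epsilon>(5) by (auto simp: Xs_def)
    have inU: "\<epsilon> t \<in> U" if "t \<in> {0..1}" for t
      using \<epsilon>(1) that by (auto simp: pathin_def continuous_map_in_subtopology Pi_iff)
    show ?thesis unfolding \<epsilon>(4) by (rule RR_project[OF c \<epsilon>(2,3) z']) (use U(3) inU in blast)
  qed
  then show thesis using that U z by metis
qed

lemma gcov_base_in: "gcov_base Y (Inl y0) \<in> Xs" "gcov_base Y (Inl y0) \<in> Cr"
  "gcov_proj (gcov_base Y (Inl y0)) = Inl y0"
proof -
  have p: "pathin Y (\<lambda>_. Inl y0)" using y0_in by (simp add: pathin_def topspace_Y)
  then show C: "gcov_base Y (Inl y0) \<in> Cr" by (auto simp: gcov_base_def gcov_carrier_def)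
  show "gcov_proj (gcov_base Y (Inl y0)) = Inl y0" unfolding gcov_base_def using gcov_proj_pclass[OF p] .
  then show "gcov_base Y (Inl y0) \<in> Xs" using C y0_in by (simp add: Xs_def)
qed

lemma small_rel_RR: "small_rel RR Xs"
proof -
  interpret Metric_space "topspace X" d by (rule metric)
  show ?thesis
  proof
    show "c \<in> Xs" if "RR e c c'" for e c c' using that by (simp add: RR_def)
    show "0 < e" if "RR e c c'" for e c c'
    proof -
      obtain \<epsilon> where "\<forall>s\<in>{0..1::real}. \<forall>t\<in>{0..1::real}. d (\<epsilon> s) (\<epsilon> t) < e" using \<open>RR e c c'\<close> by (auto simp: RR_def)
      then have "d (\<epsilon> 0) (\<epsilon> 0) < e" by auto
      then show ?thesis using nonneg[of "\<epsilon> 0" "\<epsilon> 0"] by linarith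
    qed
    show "RR e' c c'" if "RR e c c'" "e \<le> e'" for e e' c c'
    proof -
      obtain \<epsilon> where "pathin X \<epsilon>" "Inl (\<epsilon> 0) = gcov_proj c" "c' = pact Y c (Inl \<circ> \<epsilon>)"
        "\<forall>s\<in>{0..1}. \<forall>t\<in>{0..1}. d (\<epsilon> s) (\<epsilon> t) < e" "c \<in> Xs" using \<open>RR e c c'\<close> by (auto simp: RR_def)
      then show ?thesis unfolding RR_def using \<open>e \<le> e'\<close> by (intro conjI exI[of _ \<epsilon>]) fastforce+
    qed
    show refl: "RR e c c" if c: "c \<in> Xs" "0 < e" for e c
    proof -
      obtain z where z: "gcov_proj c = Inl z" "z \<in> topspace X" and cC: "c \<in> Cr" using c by (auto simp: Xs_def)
      have "pathin X (\<lambda>_. z)" using z by (simp add: pathin_def)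
      moreover have "c = pact Y c (Inl \<circ> (\<lambda>_. z))" using pact_const[OF cC] z by (simp add: o_def)
      ultimately show ?thesis unfolding RR_def using c z by (intro conjI exI[of _ "\<lambda>_. z"]) auto
    qed
    \<comment> \<open>\<open>RR_path\<close> bounds all pairs of times, so symmetry is its instance
      at the times 1 and 0.\<close>
    show "RR e c' c" if R: "RR e c c'" for e c c'
    proof -
      obtain \<Gamma> where "\<Gamma> (0::real) = c" "\<Gamma> 1 = c'" "\<forall>s\<in>{0..1}. \<forall>t\<in>{0..1}. RR e (\<Gamma> s) (\<Gamma> t)"
        using RR_path[OF R] by blast
      then show ?thesis by force
    qed
    show "RR (e + e') c c''" if R: "RR e c c'" "RR e' c' c''" for e e' c c' c''
    proof -
      obtain \<epsilon> where c: "c \<in> Xs" and \<epsilon>: "pathin X \<epsilon>" "Inl (\<epsilon> 0) = gcov_proj c" "c' = pact Y c (Inl \<circ> \<epsilon>)"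
        "\<forall>s\<in>{0..1}. \<forall>t\<in>{0..1}. d (\<epsilon> s) (\<epsilon> t) < e" using R(1) by (auto simp: RR_def)
      obtain \<epsilon>' where \<epsilon>': "pathin X \<epsilon>'" "Inl (\<epsilon>' 0) = gcov_proj c'" "c'' = pact Y c' (Inl \<circ> \<epsilon>')"
        "\<forall>s\<in>{0..1}. \<forall>t\<in>{0..1}. d (\<epsilon>' s) (\<epsilon>' t) < e'" using R(2) by (auto simp: RR_def)
      have cC: "c \<in> Cr" using c by (simp add: Xs_def)
      have e01: "\<epsilon> 1 = \<epsilon>' 0" using pact_Inl(2)[OF cC \<epsilon>(1,2)] \<epsilon>(3) \<epsilon>'(2) by simp
      have "pact Y c (Inl \<circ> pcat \<epsilon> \<epsilon>') = c''"
      proof -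
        have "pact Y (pact Y c (Inl \<circ> \<epsilon>)) (Inl \<circ> \<epsilon>') = pact Y c (pcat (Inl \<circ> \<epsilon>) (Inl \<circ> \<epsilon>'))"
          by (rule pact_pact[OF cC pathin_Inl[OF \<epsilon>(1)] _ pathin_Inl[OF \<epsilon>'(1)]]) (use \<epsilon>(2) e01 in auto)
        then show ?thesis using \<epsilon>(3) \<epsilon>'(3) by (simp add: pcat_comp)
      qed
      moreover have "pathin X (pcat \<epsilon> \<epsilon>')" using pathin_pcat[OF \<epsilon>(1) \<epsilon>'(1) e01] .
      moreover have "d (pcat \<epsilon> \<epsilon>' s) (pcat \<epsilon> \<epsilon>' t) < e + e'" if st: "s \<in> {0..1}" "t \<in> {0..1}" for s t
      proof -
        have pos: "d (\<epsilon> 0) (\<epsilon> 0) < e" "d (\<epsilon>' 0) (\<epsilon>' 0) < e'" using \<epsilon>(4) \<epsilon>'(4) by auto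
        then have pos: "0 < e" "0 < e'" using nonneg order_le_less_trans by blast+
        have mix: "d (\<epsilon> u) (\<epsilon>' v) < e + e'" if uv: "u \<in> {0..1}" "v \<in> {0..1}" for u v
        proof -
          have "d (\<epsilon> u) (\<epsilon>' v) \<le> d (\<epsilon> u) (\<epsilon> 1) + d (\<epsilon>' 0) (\<epsilon>' v)"
            unfolding e01[symmetric] using uv e01
            by (metis triangle pathin_in_topspace[OF \<epsilon>(1)] pathin_in_topspace[OF \<epsilon>'(1)] atLeastAtMost_iff order_refl zero_le_one)
          moreover have "d (\<epsilon> u) (\<epsilon> 1) < e" "d (\<epsilon>' 0) (\<epsilon>' v) < e'" using \<epsilon>(4) \<epsilon>'(4) uv by auto
          ultimately show ?thesis by linarith
        qed
        have ee: "d (\<epsilon> u) (\<epsilon> v) < e + e'" "d (\<epsilon>' u) (\<epsilon>' v) < e + e'" if "u \<in> {0..1}" "v \<in> {0..1}" for u v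
          using \<epsilon>(4) \<epsilon>'(4) that pos by (smt (verit))+
        have mix': "d (\<epsilon>' v) (\<epsilon> u) < e + e'" if "u \<in> {0..1}" "v \<in> {0..1}" for u v
          using mix[OF that] by (simp add: commute)
        show ?thesis unfolding pcat_def using st by (auto intro!: mix mix' ee)
      qed
      ultimately show ?thesis unfolding RR_def using c \<epsilon>(2) by (intro conjI exI[of _ "pcat \<epsilon> \<epsilon>'"]) auto
    qed
    show "\<exists>e. RR e c c'" if cc: "c \<in> Xs" "c' \<in> Xs" for c c'
    proof -
      obtain \<alpha> where \<alpha>: "pathin Y \<alpha>" "\<alpha> 0 = Inl y0" "c = pclass Y \<alpha>" "gcov_proj c = \<alpha> 1"
        using cc(1) by (auto simp: Xs_def elim: gcov_carrierE)
      obtain \<beta> where \<beta>: "pathin Y \<beta>" "\<beta> 0 = Inl y0" "c' = pclass Y \<beta>" "gcov_proj c' = \<beta> 1"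
        using cc(2) by (auto simp: Xs_def elim: gcov_carrierE)
      obtain z z' where z: "\<alpha> 1 = Inl z" "\<beta> 1 = Inl z'" using cc \<alpha>(4) \<beta>(4) by (auto simp: Xs_def)
      have cC: "c \<in> Cr" using cc by (simp add: Xs_def)
      \<comment> \<open>Back along \<open>\<alpha>\<close> to the base class and out along
        \<open>\<beta>\<close>; the projection of this path to X has a compact, hence bounded,
        image.\<close>
      define \<epsilon> where "\<epsilon> = pcat (\<lambda>t. \<alpha> (1 - t)) \<beta>"
      have \<epsilon>: "pathin Y \<epsilon>" "\<epsilon> 0 = gcov_proj c" "\<epsilon> 1 = Inl z'"
        using \<alpha> \<beta> z by (auto simp: \<epsilon>_def intro!: pathin_pcat pathin_reverse)
      have b: "gcov_base Y (Inl y0) \<in> Cr" "gcov_proj (gcov_base Y (Inl y0)) = Inl y0"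
        using gcov_base_in by blast+
      have act: "pact Y (gcov_base Y (Inl y0)) \<mu> = pclass Y \<mu>" if "pathin Y \<mu>" "\<mu> 0 = Inl y0" for \<mu>
      proof -
        have p: "pathin Y (\<lambda>_. Inl y0)" using y0_in by (simp add: pathin_def topspace_Y)
        have "path_hom Y (pcat (\<mu> \<circ> (\<lambda>_. 0)) (\<mu> \<circ> id)) (\<mu> \<circ> id)"
          by (rule path_hom_pcat_reparam[OF that(1)]) (auto simp: pathin_unit_id pathin_unit)
        then have "path_hom Y (pcat (\<lambda>_. Inl y0) \<mu>) \<mu>" using that(2) by (simp add: o_def)
        then show ?thesis unfolding gcov_base_def using that pact_pclass[OF p that(1)] pclass_eq_iff[OF that(1)] by simp
      qed
      have "pact Y c (\<lambda>t. \<alpha> (1 - t)) = gcov_base Y (Inl y0)"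
        using pact_rev[OF b(1) \<alpha>(1)] act[OF \<alpha>(1,2)] b(2) \<alpha>(2,3) by simp
      then have "pact Y c \<epsilon> = c'"
        using pact_pact[OF cC pathin_reverse[OF \<alpha>(1)] _ \<beta>(1)] act[OF \<beta>(1,2)] \<alpha> \<beta> by (simp add: \<epsilon>_def)
      moreover have "path_hom Y \<epsilon> (\<lambda>t. Inl (q (\<epsilon> t)))" using path_hom_project[OF \<epsilon>(1) _ \<epsilon>(3)] \<epsilon>(2) \<alpha>(4) z(1) by simp
      ultimately have e: "c' = pact Y c (Inl \<circ> (q \<circ> \<epsilon>))" using pact_cong[OF cC \<epsilon>(1,2)] by (simp add: o_def)
      have p: "pathin X (q \<circ> \<epsilon>)" using pathin_compose[OF \<epsilon>(1) continuous_map_q] .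
      have "compactin X ((q \<circ> \<epsilon>) ` {0..1})"
        using p unfolding pathin_def by (intro image_compactin[where X="top_of_set {0..1}"]) (auto simp: compactin_subtopology)
      then have "mbounded ((q \<circ> \<epsilon>) ` {0..1})" using compactin_imp_mbounded unfolding mtop by blast
      then obtain B where B: "\<forall>u\<in>(q \<circ> \<epsilon>) ` {0..1}. \<forall>v\<in>(q \<circ> \<epsilon>) ` {0..1}. d u v \<le> B"
        unfolding mbounded_alt by blast
      have "d ((q \<circ> \<epsilon>) s) ((q \<circ> \<epsilon>) t) < B + 1" if "s \<in> {0..1}" "t \<in> {0..1}" for s t
        using B that by (meson image_eqI less_add_one order_le_less_trans)
      then have "RR (B + 1) c c'" unfolding RR_def using cc(1) p e \<epsilon>(2) \<alpha>(4) z(1)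
        by (intro conjI exI[of _ "q \<circ> \<epsilon>"]) auto
      then show ?thesis by blast
    qed
  qed (rule RR_path)
qed

end

section \<open>Elements of the image\<close>

lemma bclass_eqI:
  assumes "homotopic_with (\<lambda>k. k b = a) H A f g" shows "bclass H b A a f = bclass H b A a g"
proof -
  have "homotopic_with (\<lambda>k. k b = a) H A f k \<longleftrightarrow> homotopic_with (\<lambda>k. k b = a) H A g k" for k
    using assms homotopic_with_trans homotopic_with_symD by metis
  then show ?thesis by (simp add: bclass_def)
qed

text \<open>The class of a based map k contains k, so equality of the classes makes f homotopic to
  k, and \<open>homotopic_with\<close> entails continuity of both maps. In this way the continuity
  of the coordinates of a map is read off from membership in \<open>Gset\<close>.\<close>

lemma bclass_in_bclasses_imp_based_map:
  assumes "bclass H b A a f \<in> bclasses H b A a" shows "based_map H b A a f"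
proof -
  obtain k where k: "bclass H b A a f = bclass H b A a k" "based_map H b A a k" using assms by (auto simp: bclasses_def)
  have "k \<in> bclass H b A a k" using k(2) by (auto simp: bclass_def based_map_def)
  then have "k \<in> bclass H b A a f" by (simp only: k(1))
  then have h: "homotopic_with (\<lambda>k. k b = a) H A f k" by (simp add: bclass_def)
  show ?thesis
    using homotopic_with_imp_continuous_maps[OF h] homotopic_with_imp_property[OF h] by (auto simp: based_map_def)
qed

lemma bclass_const:
  assumes "based_map H b A a f" "b \<in> topspace H" "\<And>s. s \<in> topspace H \<Longrightarrow> f s = a"
  shows "bclass H b A a f = bclass H b A a (\<lambda>_. a)"
proof (rule bclass_eqI, rule homotopic_with_equal)
  show "f b = a" "continuous_map H A f" using assms(1) by (auto simp: based_map_def)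
qed (use assms(3) in auto)

text \<open>In a Hausdorff space the times of agreement form a closed set, and t is a limit of
  earlier times.\<close>

lemma continuous_eq_at_end:
  fixes f g :: "real \<Rightarrow> 'h"
  assumes "Hausdorff_space H" "continuous_map (top_of_set {0..1}) H f" "continuous_map (top_of_set {0..1}) H g"
    and t: "0 < t" "t \<le> 1" and eq: "\<And>s. 0 \<le> s \<Longrightarrow> s < t \<Longrightarrow> f s = g s"
  shows "f t = g t"
proof -
  have "closedin (top_of_set {0..1}) {s \<in> topspace (top_of_set {0..1}). f s = g s}"
    using assms(1-3) by (intro closedin_continuous_maps_eq)
  then have "closed {s \<in> {0..1}. f s = g s}" 
    by (simp only: closedin_closed_eq[OF closed_atLeastAtMost] topspace_euclidean_subtopology)
  moreover have "{0..<t} \<subseteq> {s \<in> {0..1}. f s = g s}" using eq t by auto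
  ultimately have "closure {0..<t} \<subseteq> {s \<in> {0..1}. f s = g s}" by (rule closure_minimal[rotated])
  moreover have "t \<in> closure {0..<t}" using t by (simp add: closure_atLeastLessThan)
  ultimately show ?thesis by blast
qed

context adj_metric
begin

interpretation small_rel RR Xs by (rule small_rel_RR)

section \<open>Closures and compactness in the covering over X\<close>

lemma Xs_Cr: "c \<in> Xs \<Longrightarrow> c \<in> Cr"
  by (simp add: Xs_def)

lemma topspace_Xtilde: "topspace (Xtilde X A x a y0) = Xs"
  unfolding Xtilde_eq topspace_subtopology topspace_gcov Xs_def by blast

lemma openin_Xtilde_RR:
  assumes "openin (Xtilde X A x a y0) W" "c \<in> W"
  shows "\<exists>e>0. \<forall>c'. RR e c c' \<longrightarrow> c' \<in> W"
proof -
  obtain W' where W': "openin Yt W'" "W = W' \<inter> Xs" using assms(1) by (auto simp: Xtilde_eq openin_subtopology)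
  then obtain U where U: "openin Y U" "gcov_proj c \<in> U" "whisker_nbhd Y c U \<subseteq> W'"
    using assms(2) openin_gcov[of Y "Inl y0" W'] by blast
  have "c \<in> Xs" using assms(2) W'(2) by blast
  from RR_whisker[OF U(1) this U(2)] show ?thesis using U(3) W'(2) RR_in by blast
qed

lemma RR_nbhd:
  assumes "c \<in> Xs" "e > 0"
  obtains W where "openin (Xtilde X A x a y0) W" "c \<in> W" "\<And>c'. c' \<in> W \<Longrightarrow> RR e c c'"
proof -
  obtain U where U: "openin Y U" "gcov_proj c \<in> U" "\<And>c'. c' \<in> whisker_nbhd Y c U \<Longrightarrow> c' \<in> Xs \<Longrightarrow> RR e c c'"
    by (rule whisker_RR[OF assms]) blast
  show thesis
  proof
    show "openin (Xtilde X A x a y0) (whisker_nbhd Y c U \<inter> Xs)"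
      unfolding Xtilde_eq by (intro openin_subtopology_Int openin_whisker_nbhd U Xs_Cr assms)
    show "c \<in> whisker_nbhd Y c U \<inter> Xs" using whisker_refl[OF Xs_Cr[OF assms(1)] U(2)] assms(1) by blast
  qed (use U(3) in blast)
qed

lemma closure_RR:
  assumes "c \<in> Xtilde X A x a y0 closure_of K" "e > 0" obtains c' where "c' \<in> K" "RR e c c'"
proof -
  have "c \<in> Xs" using assms(1) in_closure_of topspace_Xtilde by metis
  from RR_nbhd[OF this assms(2)] obtain W where "openin (Xtilde X A x a y0) W" "c \<in> W" "\<And>c'. c' \<in> W \<Longrightarrow> RR e c c'" by blast
  then show thesis using assms(1) that by (auto simp: in_closure_of)
qed

lemma closure_RR_I:
  assumes "c \<in> Xs" "\<And>e. e > 0 \<Longrightarrow> \<exists>c'\<in>K. RR e c c'"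
  shows "c \<in> Xtilde X A x a y0 closure_of K"
  unfolding in_closure_of topspace_Xtilde
proof (intro conjI allI impI)
  fix T assume "c \<in> T \<and> openin (Xtilde X A x a y0) T"
  then obtain e where "e > 0" "\<forall>c'. RR e c c' \<longrightarrow> c' \<in> T" using openin_Xtilde_RR by blast
  then show "\<exists>y. y \<in> K \<and> y \<in> T" using assms(2) by blast
qed (rule assms(1))

text \<open>Each point of K gets a radius whose double stays inside one member of the cover;
  finitely many of the balls cover K, and a closure point, being closer to K than all their radii,
  is covered by the same members. This is the usual argument for compact sets in regular
  spaces.\<close>

lemma compactin_closure:
  assumes K: "compactin (Xtilde X A x a y0) K" and T: "T \<subseteq> Xtilde X A x a y0 closure_of K"
  shows "compactin (Xtilde X A x a y0) (Xtilde X A x a y0 closure_of T)"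
proof (rule closed_compactin)
  let ?X = "Xtilde X A x a y0"
  show "?X closure_of T \<subseteq> ?X closure_of K" using T by (simp add: closure_of_minimal)
  show "compactin ?X (?X closure_of K)"
    unfolding compactin_def
  proof (intro conjI allI impI)
    fix \<U> assume \<U>: "Ball \<U> (openin ?X) \<and> ?X closure_of K \<subseteq> \<Union>\<U>"
    have "\<exists>O' e W. O' \<in> \<U> \<and> e > 0 \<and> (\<forall>c'. RR (e + e) c c' \<longrightarrow> c' \<in> O') \<and> openin ?X W \<and> c \<in> W \<and> (\<forall>c'\<in>W. RR e c c')"
      if c: "c \<in> K" for c
    proof -
      have cl: "c \<in> ?X closure_of K" using c closure_of_subset[of K ?X] compactin_subset_topspace[OF K] by blast
      then obtain O' where O': "O' \<in> \<U>" "c \<in> O'" using \<U> by blast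
      then obtain e where e: "e > 0" "\<forall>c'. RR e c c' \<longrightarrow> c' \<in> O'" using \<U> openin_Xtilde_RR by blast
      have cX: "c \<in> Xs" "e / 2 > 0" using cl in_closure_of topspace_Xtilde e(1) by (metis, simp)
      obtain W where "openin ?X W" "c \<in> W" "\<And>c'. c' \<in> W \<Longrightarrow> RR (e / 2) c c'" using RR_nbhd[OF cX] by blast
      then show ?thesis using O'(1) e(2) cX(2) by (intro exI[of _ O'] exI[of _ "e/2"] exI[of _ W]) auto
    qed
    then have "\<forall>c\<in>K. \<exists>O' e W. O' \<in> \<U> \<and> e > 0 \<and> (\<forall>c'. RR (e + e) c c' \<longrightarrow> c' \<in> O') \<and>
        openin ?X W \<and> c \<in> W \<and> (\<forall>c'\<in>W. RR e c c')" by blast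
    then obtain Of e W where OW0: "\<forall>c\<in>K. Of c \<in> \<U> \<and> e c > 0 \<and> (\<forall>c'. RR (e c + e c) c c' \<longrightarrow> c' \<in> Of c) \<and>
        openin ?X (W c) \<and> c \<in> W c \<and> (\<forall>c'\<in>W c. RR (e c) c c')" unfolding bchoice_iff by blast
    have OW: "\<And>c. c \<in> K \<Longrightarrow> Of c \<in> \<U>" "\<And>c. c \<in> K \<Longrightarrow> e c > 0"
      "\<And>c c'. c \<in> K \<Longrightarrow> RR (e c + e c) c c' \<Longrightarrow> c' \<in> Of c" "\<And>c. c \<in> K \<Longrightarrow> openin ?X (W c)"
      "\<And>c. c \<in> K \<Longrightarrow> c \<in> W c" "\<And>c c'. c \<in> K \<Longrightarrow> c' \<in> W c \<Longrightarrow> RR (e c) c c'"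
      using OW0 by blast+
    have "Ball (W ` K) (openin ?X)" "K \<subseteq> \<Union>(W ` K)" using OW(4,5) by auto
    then obtain \<F> where "finite \<F>" "\<F> \<subseteq> W ` K" "K \<subseteq> \<Union>\<F>" using K unfolding compactin_def by meson
    then obtain D where D: "finite D" "D \<subseteq> K" "K \<subseteq> \<Union>(W ` D)" by (metis finite_subset_image)
    have "?X closure_of K \<subseteq> \<Union>(Of ` D)"
    proof
      fix y assume y: "y \<in> ?X closure_of K"
      \<comment> \<open>The 1 keeps the minimum meaningful when D is empty.\<close>
      define e0 where "e0 = Min (insert 1 (e ` D))"
      have e0: "e0 > 0" "\<And>c. c \<in> D \<Longrightarrow> e0 \<le> e c" using D OW(2) by (auto simp: e0_def)
      obtain z where z: "z \<in> K" "RR e0 y z" by (rule closure_RR[OF y e0(1)])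
      then obtain c where c: "c \<in> D" "z \<in> W c" using D(3) by blast
      have "RR (e c) c z" using OW(6) c D(2) by blast
      moreover have "RR (e c) z y" using R_mono[OF R_sym[OF z(2)] e0(2)[OF c(1)]] .
      ultimately have "RR (e c + e c) c y" by (rule R_trans)
      then show "y \<in> \<Union>(Of ` D)" using OW(3) c D(2) by blast
    qed
    then show "\<exists>\<F>. finite \<F> \<and> \<F> \<subseteq> \<U> \<and> ?X closure_of K \<subseteq> \<Union>\<F>"
      using D OW(1) by (intro exI[of _ "Of ` D"]) auto
  qed (simp add: closure_of_subset_topspace)
qed simp

text \<open>If no point of C were a cluster point, each would have a neighbourhood that u leaves for
  good, and finitely many of these would cover C.\<close>

lemma compactin_imp_R_seq_compact:
  assumes C: "compactin (Xtilde X A x a y0) C" shows "R_seq_compact C"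
  unfolding R_seq_compact_def
proof (intro allI impI, rule ccontr)
  let ?X = "Xtilde X A x a y0"
  fix u assume u: "\<forall>m::nat. u m \<in> C" and no: "\<not> (\<exists>c\<in>C. \<forall>e>0. \<forall>N. \<exists>m\<ge>N. RR e c (u m))"
  have CX: "C \<subseteq> Xs" using compactin_subset_topspace[OF C] topspace_Xtilde by simp
  have "\<exists>W N. openin ?X W \<and> c \<in> W \<and> (\<forall>m\<ge>N. u m \<notin> W)" if c: "c \<in> C" for c
  proof -
    obtain e N where e: "e > 0" "\<forall>m\<ge>N. \<not> RR e c (u m)" using no c by blast
    obtain W where "openin ?X W" "c \<in> W" "\<And>c'. c' \<in> W \<Longrightarrow> RR e c c'" using RR_nbhd[of c e] CX c e(1) by blast
    then show ?thesis using e(2) by blast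
  qed
  then obtain W N where W: "\<And>c. c \<in> C \<Longrightarrow> openin ?X (W c)" "\<And>c. c \<in> C \<Longrightarrow> c \<in> W c"
    "\<And>c m. c \<in> C \<Longrightarrow> m \<ge> N c \<Longrightarrow> u m \<notin> W c" by metis
  have "Ball (W ` C) (openin ?X)" "C \<subseteq> \<Union>(W ` C)" using W(1,2) by auto
  then obtain \<F> where "finite \<F>" "\<F> \<subseteq> W ` C" "C \<subseteq> \<Union>\<F>" using C unfolding compactin_def by meson
  then obtain D where D: "finite D" "D \<subseteq> C" "C \<subseteq> \<Union>(W ` D)" by (metis finite_subset_image)
  define M where "M = Max (insert 0 (N ` D))"
  have M: "N c \<le> M" if "c \<in> D" for c using D(1) that by (simp add: M_def)
  obtain c where "c \<in> D" "u M \<in> W c" using D(3) u by blast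
  then show False using W(3) M D(2) by blast
qed

lemma R_continuous_imp_continuous_map:
  assumes "R_continuous {0..1} \<gamma>" shows "continuous_map (top_of_set {0..1}) Yt \<gamma>"
proof (rule continuous_map_into_gcov)
  have X: "\<gamma> t \<in> Xs" if "t \<in> {0..1}" for t
  proof -
    obtain \<delta> where "\<delta> > 0" "\<forall>t'\<in>{0..1}. \<bar>t' - t\<bar> < \<delta> \<longrightarrow> RR 1 (\<gamma> t) (\<gamma> t')"
      using assms \<open>t \<in> {0..1}\<close> zero_less_one unfolding R_continuous_def by blast
    then have "RR 1 (\<gamma> t) (\<gamma> t)" using \<open>t \<in> {0..1}\<close> by simp
    then show ?thesis by (rule R_carrier)
  qed
  then show "\<gamma> t \<in> Cr" if "t \<in> topspace (top_of_set {0..1})" for t using that Xs_Cr by simp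
  fix t U assume t: "t \<in> topspace (top_of_set {0..1})" and U: "openin Y U" "gcov_proj (\<gamma> t) \<in> U"
  then have t01: "t \<in> {0..1}" by simp
  obtain e where e: "e > 0" "\<forall>c'. RR e (\<gamma> t) c' \<longrightarrow> c' \<in> whisker_nbhd Y (\<gamma> t) U"
    using RR_whisker[OF U(1) X[OF t01] U(2)] by blast
  obtain \<delta> where \<delta>: "\<delta> > 0" "\<forall>t'\<in>{0..1}. \<bar>t' - t\<bar> < \<delta> \<longrightarrow> RR e (\<gamma> t) (\<gamma> t')"
    using assms t01 e(1) unfolding R_continuous_def by blast
  have "openin (top_of_set {0..1}) ({0..1} \<inter> ball t \<delta>)" by (rule openin_open_Int) simp
  then show "\<exists>N. openin (top_of_set {0..1}) N \<and> t \<in> N \<and> (\<forall>w\<in>N. \<gamma> w \<in> whisker_nbhd Y (\<gamma> t) U)"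
    using \<delta> e(2) t01 by (intro exI[of _ "{0..1} \<inter> ball t \<delta>"]) (auto simp: dist_real_def)
qed

text \<open>The (j, c) coordinate of a single point z; \<open>Phi\<close> takes the class of its
  composition with f. The use of \<open>inv_into\<close> is justified by
  \<open>inj_incl\<close>.\<close>

definition crd :: "nat \<Rightarrow> (real \<Rightarrow> 'a + nat \<times> 'b) set \<Rightarrow> (real \<Rightarrow> 'a + nat \<times> 'b) set \<Rightarrow> 'b" where
  "crd j c z = inv_into (topspace (A j)) (incl j) (gcov_proj (retr X A x a j c z))"

lemma Phi_crd: "c \<in> fib j \<Longrightarrow> Phi X A x a y0 n f j c = bclass (nsphere n) sph_base (A j) (a j) (\<lambda>s. crd j c (f s))"
  by (simp add: Phi_def crd_def)

lemma inj_incl: "inj_on (incl j) (topspace (A j))"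
  by (rule inj_on_inverseI[of _ "r j"]) simp

lemma crd_in:
  assumes "c \<in> fib j" "z \<in> lift j c" "gcov_proj z = incl j b" "b \<in> topspace (A j)"
  shows "crd j c z = b"
proof -
  have "retr X A x a j c z = z" using assms(2) by (simp add: retr_def)
  then show ?thesis unfolding crd_def using inv_into_f_f[OF inj_incl assms(4)] assms(3) by simp
qed

lemma crd_out:
  assumes c: "c \<in> fib j" and "z \<notin> lift j c \<or> gcov_proj z = Inl w"
  shows "crd j c z = a j"
proof -
  have "retr X A x a j c z = c" using assms lift_over_X[OF c] by (auto simp: retr_def)
  then have "gcov_proj (retr X A x a j c z) = incl j (a j)" using c by (simp add: fib_iff)
  then show ?thesis unfolding crd_def using inv_into_f_f[OF inj_incl a_in] by simp
qed

lemma crd_neq: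
  assumes c: "c \<in> fib j" and ne: "crd j c z \<noteq> a j"
  shows "z \<in> lift j c" "gcov_proj z = Inr (j, crd j c z)"
proof -
  show z: "z \<in> lift j c" using crd_out[OF c] ne by blast
  obtain b where b: "gcov_proj z = incl j b" "b \<in> topspace (A j)" by (rule lift_memE[OF c z])
  then have "crd j c z = b" by (rule crd_in[OF c z])
  then show "gcov_proj z = Inr (j, crd j c z)" using b ne by (simp add: adj_incl_def)
qed

section \<open>The coordinates of one fixed sphere map\<close>

context
  fixes n :: nat and f :: "(nat \<Rightarrow> real) \<Rightarrow> (real \<Rightarrow> 'a + nat \<times> 'b) set"
  assumes n: "n \<ge> 1" and f: "continuous_map (nsphere n) Yt f"
    and G: "Phi X A x a y0 n f \<in> Gset X A x a y0 n"
begin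

lemma crd_based: assumes "c \<in> fib j" shows "based_map (nsphere n) sph_base (A j) (a j) (\<lambda>s. crd j c (f s))"
proof -
  have "Phi X A x a y0 n f j c \<in> pi_n n (A j) (a j)" using G assms by (simp add: Gset_def)
  then show ?thesis unfolding Phi_crd[OF assms] pi_n_def by (rule bclass_in_bclasses_imp_based_map)
qed

lemma f_in: "s \<in> topspace (nsphere n) \<Longrightarrow> f s \<in> Cr"
  using continuous_map_image_subset_topspace[OF f] unfolding topspace_gcov by blast

lemma supp_nonconstant:
  assumes "c \<in> suppj X A x a y0 n (Phi X A x a y0 n f) j"
  shows "c \<in> fib j" "\<exists>s\<in>topspace (nsphere n). crd j c (f s) \<noteq> a j"
proof -
  show c: "c \<in> fib j" using assms by (simp add: suppj_def)
  show "\<exists>s\<in>topspace (nsphere n). crd j c (f s) \<noteq> a j"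
  proof (rule ccontr)
    assume "\<not> ?thesis"
    then have "Phi X A x a y0 n f j c = pi_zero n (A j) (a j)"
      unfolding Phi_crd[OF c] pi_zero_def using crd_based[OF c] sph_base_in_nsphere by (intro bclass_const) auto
    then show False using assms by (simp add: suppj_def)
  qed
qed

text \<open>On a path in the sphere from a point with nontrivial coordinate to the base point, the
  coordinate reaches \<open>a j\<close> for a first time. Before that time f is in the copy of
  \<open>A j\<close> at c, and at that time it is at a point z over \<open>x j\<close>. Such a z is
  joined to c by lifts of arbitrarily small paths.\<close>

lemma supp_in_closure:
  assumes "c \<in> supp X A x a y0 n (Phi X A x a y0 n f)"
  shows "c \<in> Xtilde X A x a y0 closure_of (f ` {s \<in> topspace (nsphere n). f s \<in> Xs})"
proof -
  obtain j where cs: "c \<in> suppj X A x a y0 n (Phi X A x a y0 n f) j" using assms by (auto simp: supp_def suppj_def)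
  note c = supp_nonconstant(1)[OF cs]
  obtain s1 where s1: "s1 \<in> topspace (nsphere n)" "crd j c (f s1) \<noteq> a j" using supp_nonconstant(2)[OF cs] by blast
  obtain \<sigma> where \<sigma>: "pathin (nsphere n) \<sigma>" "\<sigma> 0 = s1" "\<sigma> 1 = sph_base"
    using path_connected_space_nsphere[OF n] s1(1) sph_base_in_nsphere unfolding path_connected_space_def by blast
  have \<sigma>c: "continuous_map (top_of_set {0..1}) (nsphere n) \<sigma>" using \<sigma>(1) by (simp add: pathin_def)
  define w where "w t = crd j c (f (\<sigma> t))" for t
  have wc: "continuous_map (top_of_set {0..1}) (A j) w"
    using continuous_map_compose[OF \<sigma>c, of "A j" "\<lambda>s. crd j c (f s)"] crd_based[OF c] by (simp add: based_map_def w_def[abs_def] o_def)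
  have w01: "w 0 \<noteq> a j" "w 1 = a j" using s1 \<sigma> crd_based[OF c] by (auto simp: w_def based_map_def)
  define Z where "Z = {t \<in> {0..1}. w t = a j}"
  have "closedin (top_of_set {0..1}) {t \<in> topspace (top_of_set {0..1}). w t \<in> {a j}}"
    using closedin_continuous_map_preimage[OF wc] closedin_Hausdorff_singleton[OF haus_A a_in] by blast
  then have Z: "closed Z" "1 \<in> Z" "bdd_below Z" using w01 by (auto simp: Z_def closedin_closed_eq intro!: bdd_belowI[of _ 0])
  define t where "t = Inf Z"
  have "t \<in> Z" unfolding t_def using Z by (intro closed_contains_Inf) auto
  then have t: "0 < t" "t \<le> 1" "w t = a j" using w01 by (auto simp: Z_def order_less_le intro: ccontr)
  have before: "w u \<noteq> a j" if "0 \<le> u" "u < t" for u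
    using cInf_lower[of u Z] Z(3) that t(2) by (auto simp: t_def Z_def)
  define pr where "pr u = gcov_proj (f (\<sigma> u))" for u
  have fc: "continuous_map (top_of_set {0..1}) Yt (f \<circ> \<sigma>)" using continuous_map_compose[OF \<sigma>c f] .
  have prc: "continuous_map (top_of_set {0..1}) Y pr"
    using continuous_map_compose[OF fc continuous_map_gcov_proj] by (simp add: pr_def[abs_def] o_def)
  have pr_before: "pr u = Inr (j, w u)" if "0 \<le> u" "u < t" for u
    using crd_neq(2)[OF c, of "f (\<sigma> u)"] before[OF that] by (simp add: pr_def w_def)
  \<comment> \<open>The projected point at time t is identified through its images under q and all r
    k, each obtained as a limit from earlier times.\<close>
  have qt: "q (pr t) = x j"
    by (rule continuous_eq_at_end[OF haus_X, of "\<lambda>u. q (pr u)" "\<lambda>_. x j", OF _ _ t(1,2)])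
       (use continuous_map_compose[OF prc continuous_map_q] x_in pr_before in \<open>auto simp: o_def\<close>)
  have rk: "r k (pr t) = a k" for k
  proof (cases "k = j")
    case True
    have "r j (pr t) = w t"
      by (rule continuous_eq_at_end[OF haus_A[of j], of "\<lambda>u. r j (pr u)" w, OF _ wc t(1,2)])
         (use continuous_map_compose[OF prc continuous_map_r] pr_before in \<open>auto simp: o_def\<close>)
    then show ?thesis using t(3) True by simp
  next
    case False
    show ?thesis
      by (rule continuous_eq_at_end[OF haus_A[of k], of "\<lambda>u. r k (pr u)" "\<lambda>_. a k", OF _ _ t(1,2)])
         (use continuous_map_compose[OF prc continuous_map_r] a_in pr_before False in \<open>auto simp: o_def\<close>)
  qed
  have prt: "pr t \<in> topspace Y" using continuous_map_image_subset_topspace[OF prc] t by auto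
  have pt: "pr t = Inl (x j)"
  proof (cases "pr t")
    case (Inr p)
    then show ?thesis using rk[of "fst p"] prt by (cases p) (auto simp: topspace_Y)
  qed (use qt in simp)
  have st: "\<sigma> t \<in> topspace (nsphere n)" using pathin_in_topspace[OF \<sigma>(1)] t by auto
  define z where "z = f (\<sigma> t)"
  have z: "z \<in> fib j" "z \<in> Xs" using f_in[OF st] pt fib_Xs by (auto simp: fib_iff z_def pr_def)
  have "RR e z c" if e: "e > 0" for e
  proof -
    obtain U where U: "openin Y U" "Inl (x j) \<in> U" "\<And>y y'. y \<in> U \<Longrightarrow> y' \<in> U \<Longrightarrow> d (q y) (q y') < e"
      "\<And>y. y \<in> topspace Y \<Longrightarrow> q y = x j \<Longrightarrow> y \<in> U"
      using q_ball[OF x_in e, of j] by blast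
    have zC: "z \<in> Cr" "gcov_proj z = Inl (x j)" using z(1) by (auto simp: fib_iff)
    have "openin (top_of_set {0..1}) {u \<in> topspace (top_of_set {0..1}). (f \<circ> \<sigma>) u \<in> whisker_nbhd Y z U}"
      using openin_whisker_nbhd[OF zC(1) U(1)] U(2) zC(2) by (intro openin_continuous_map_preimage[OF fc]) simp
    then obtain T where T: "open T" "{u \<in> topspace (top_of_set {0..1}). (f \<circ> \<sigma>) u \<in> whisker_nbhd Y z U} = {0..1} \<inter> T"
      unfolding openin_open by blast
    have "t \<in> {u \<in> topspace (top_of_set {0..1}). (f \<circ> \<sigma>) u \<in> whisker_nbhd Y z U}"
      using t whisker_refl[OF zC(1), of U] zC(2) U(2) by (simp add: z_def)
    then have "t \<in> T" unfolding T(2) by blast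
    then obtain \<delta> where \<delta>: "\<delta> > 0" "ball t \<delta> \<subseteq> T" using T(1) by (meson openE)
    \<comment> \<open>A time shortly before t, at which \<open>f (\<sigma> u)\<close> is both in the
      whisker neighbourhood of z and in the copy of \<open>A j\<close> at c.\<close>
    define u where "u = max 0 (t - \<delta> / 2)"
    have u: "0 \<le> u" "u < t" "u \<in> ball t \<delta>" using \<delta>(1) t(1) by (auto simp: u_def dist_real_def)
    then have "u \<in> {u \<in> topspace (top_of_set {0..1}). (f \<circ> \<sigma>) u \<in> whisker_nbhd Y z U}"
      unfolding T(2) using \<delta>(2) t(2) by auto
    then have yw: "f (\<sigma> u) \<in> whisker_nbhd Y z U" by simp
    obtain \<epsilon> where \<epsilon>: "pathin (subtopology Y U) \<epsilon>" "pathin Y \<epsilon>" "\<epsilon> 0 = gcov_proj z" "f (\<sigma> u) = pact Y z \<epsilon>" "gcov_proj (f (\<sigma> u)) = \<epsilon> 1"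
      by (rule whisker_memE[OF zC(1) yw])
    have yl: "f (\<sigma> u) \<in> lift j c" using crd_neq(1)[OF c] before[OF u(1,2)] by (simp add: w_def)
    obtain \<delta>' where \<delta>': "pathin (A j) \<delta>'" "\<delta>' 0 = a j" "f (\<sigma> u) = pact Y c (incl j \<circ> \<delta>')" "gcov_proj (f (\<sigma> u)) = incl j (\<delta>' 1)"
      by (rule lift_memE[OF c yl])
    have cC: "c \<in> Cr" "gcov_proj c = Inl (x j)" using c by (auto simp: fib_iff)
    note p = pathin_incl[OF \<delta>'(1)]
    \<comment> \<open>From z to \<open>f (\<sigma> u)\<close> by the whisker path, then down inside
      the copy of \<open>A j\<close> to c. The second part may be large in \<open>A j\<close>, but q
      is constant on it.\<close>
    define \<mu> where "\<mu> = pcat \<epsilon> (\<lambda>t. (incl j \<circ> \<delta>') (1 - t))"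
    have "c = pact Y (pact Y c (incl j \<circ> \<delta>')) (\<lambda>t. (incl j \<circ> \<delta>') (1 - t))"
      by (rule pact_rev[symmetric, OF cC(1) p]) (use \<delta>'(2) cC(2) in simp)
    also have "\<dots> = pact Y (pact Y z \<epsilon>) (\<lambda>t. (incl j \<circ> \<delta>') (1 - t))" using \<delta>'(3) \<epsilon>(4) by simp
    also have "\<dots> = pact Y z \<mu>" unfolding \<mu>_def
      by (rule pact_pact[OF zC(1) \<epsilon>(2,3) pathin_reverse[OF p]]) (use \<epsilon>(5) \<delta>'(4) in simp)
    finally have cz: "c = pact Y z \<mu>" .
    have \<mu>p: "pathin Y \<mu>" unfolding \<mu>_def
      by (rule pathin_pcat[OF \<epsilon>(2) pathin_reverse[OF p]]) (use \<epsilon>(5) \<delta>'(4) in simp)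
    have inU: "\<mu> v \<in> U" if "v \<in> {0..1}" for v
    proof (cases "v \<le> 1/2")
      case True
      then show ?thesis using \<epsilon>(1) that by (auto simp: \<mu>_def pcat_def pathin_def continuous_map_in_subtopology Pi_iff)
    next
      case False
      then have "\<mu> v = incl j (\<delta>' (1 - (2 * v - 1)))" by (simp add: \<mu>_def pcat_def)
      then show ?thesis using U(4)[of "\<mu> v"] pathin_in_topspace[OF \<mu>p that] by simp
    qed
    show ?thesis unfolding cz
      by (rule RR_project[OF z(2) \<mu>p]) (use \<epsilon>(3) \<delta>'(2) U(3) inU in \<open>auto simp: \<mu>_def[symmetric]\<close>, auto simp: \<mu>_def \<epsilon>(3) \<delta>'(2))
  qed
  then show ?thesis using fib_Xs[OF c] z(2) st R_sym
    by (intro closure_RR_I) (auto simp: z_def intro!: bexI[of _ "\<sigma> t"])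
qed

lemma closure_supp_compact:
  "compactin (Xtilde X A x a y0) (Xtilde X A x a y0 closure_of supp X A x a y0 n (Phi X A x a y0 n f))"
proof (rule compactin_closure)
  let ?K = "{s \<in> topspace (nsphere n). f s \<in> Xs}"
  \<comment> \<open>X is closed in Y as the set where every r j takes its base value, so the part of
    the sphere that f sends over X is compact.\<close>
  have "closedin Y (Inl ` topspace X)"
  proof -
    have "y \<in> Inl ` topspace X" if "y \<in> topspace Y" "\<And>j. r j y = a j" for y
    proof (cases y)
      case (Inr p)
      then show ?thesis using that(1) that(2)[of "fst p"] by (cases p) (auto simp: topspace_Y)
    qed (use that in \<open>auto simp: topspace_Y\<close>)
    then have "Inl ` topspace X = topspace Y \<inter> (\<Inter>j. {y \<in> topspace Y. r j y \<in> {a j}})"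
      by (auto simp: topspace_Y)
    moreover have "closedin Y {y \<in> topspace Y. r j y \<in> {a j}}" for j
      using closedin_continuous_map_preimage[OF continuous_map_r] closedin_Hausdorff_singleton[OF haus_A a_in] by blast
    ultimately show ?thesis by (auto intro!: closedin_Int closedin_INT)
  qed
  then have "closedin (nsphere n) {s \<in> topspace (nsphere n). (gcov_proj \<circ> f) s \<in> Inl ` topspace X}"
    by (intro closedin_continuous_map_preimage[OF continuous_map_compose[OF f continuous_map_gcov_proj]])
  moreover have "{s \<in> topspace (nsphere n). (gcov_proj \<circ> f) s \<in> Inl ` topspace X} = ?K"
    using f_in by (auto simp: Xs_def)
  ultimately have "compactin (nsphere n) ?K"
    using closedin_compact_space[OF compact_space_nsphere] by simp
  then have "compactin Yt (f ` ?K)" using f by (rule image_compactin)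
  then show "compactin (Xtilde X A x a y0) (f ` ?K)" unfolding Xtilde_eq by (auto simp: compactin_subtopology)
  show "supp X A x a y0 n (Phi X A x a y0 n f) \<subseteq> Xtilde X A x a y0 closure_of f ` ?K"
    using supp_in_closure by blast
qed

text \<open>The sets \<open>Oc c\<close> are disjoint by \<open>lift_unique\<close>. They cover the
  compact set where the r j image of the projected map is outside V, and a coordinate that leaves V
  must have its own set in a finite subcover.\<close>

lemma finite_large_coordinates:
  assumes V: "openin (A j) V" "a j \<in> V"
  shows "finite {c \<in> fib j. \<not> (\<lambda>s. crd j c (f s)) ` topspace (nsphere n) \<subseteq> V}"
proof -
  let ?S = "nsphere n"
  define Oc where "Oc c = {s \<in> topspace ?S. crd j c (f s) \<in> topspace (A j) - {a j}}" for c
  have Ocop: "openin ?S (Oc c)" if "c \<in> fib j" for c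
    unfolding Oc_def using crd_based[OF that] closedin_Hausdorff_singleton[OF haus_A a_in, of j]
    by (intro openin_continuous_map_preimage) (auto simp: based_map_def)
  have crd_top: "crd j c (f s) \<in> topspace (A j)" if "c \<in> fib j" "s \<in> topspace ?S" for c s
    using continuous_map_image_subset_topspace crd_based[OF that(1)] that(2) unfolding based_map_def by blast
  have rp: "r j (gcov_proj (f s)) = crd j c (f s)" if "c \<in> fib j" "s \<in> Oc c" for c s
    using crd_neq(2)[OF that(1), of "f s"] that(2) by (simp add: Oc_def)
  have disj: "c = c'" if "c \<in> fib j" "c' \<in> fib j" "s \<in> Oc c" "s \<in> Oc c'" for c c' s
    using lift_unique[OF that(1) crd_neq(1)[OF that(1), of "f s"] that(2) crd_neq(1)[OF that(2), of "f s"]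
      crd_neq(2)[OF that(1), of "f s"]] that(3,4)
    by (simp add: Oc_def)
  define Z where "Z = {s \<in> topspace ?S. (r j \<circ> (gcov_proj \<circ> f)) s \<in> topspace (A j) - V}"
  have rc: "continuous_map ?S (A j) (r j \<circ> (gcov_proj \<circ> f))"
    by (intro continuous_map_compose[OF _ continuous_map_r] continuous_map_compose[OF f continuous_map_gcov_proj])
  have "closedin ?S Z" unfolding Z_def
    by (rule closedin_continuous_map_preimage[OF rc]) (use V in auto)
  then have "compactin ?S Z" using closedin_compact_space[OF compact_space_nsphere] by simp
  moreover have "Z \<subseteq> \<Union>(Oc ` fib j)"
  proof
    fix s assume s: "s \<in> Z"
    then have s': "s \<in> topspace ?S" "r j (gcov_proj (f s)) \<notin> V" by (auto simp: Z_def)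
    then have "r j (gcov_proj (f s)) \<noteq> a j" using V(2) by auto
    then obtain b where b: "gcov_proj (f s) = Inr (j, b)"
      by (cases "gcov_proj (f s)") (auto split: if_splits)
    obtain c where c: "c \<in> fib j" "f s \<in> lift j c" by (rule lift_exists[OF f_in[OF s'(1)] b])
    have "Inr (j, b) \<in> topspace Y" using gcov_proj_in_topspace[OF f_in[OF s'(1)]] b by simp
    then have "b \<in> topspace (A j)" "b \<noteq> a j" by (auto simp: topspace_Y)
    then have "crd j c (f s) = b" using crd_in[OF c] b by (simp add: adj_incl_def)
    then show "s \<in> \<Union>(Oc ` fib j)" using c(1) s'(1) \<open>b \<in> topspace (A j)\<close> \<open>b \<noteq> a j\<close> by (auto simp: Oc_def)
  qed
  moreover have "Ball (Oc ` fib j) (openin ?S)" using Ocop by auto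
  ultimately obtain \<F> where "finite \<F>" "\<F> \<subseteq> Oc ` fib j" "Z \<subseteq> \<Union>\<F>" unfolding compactin_def by meson
  then obtain D where D: "finite D" "D \<subseteq> fib j" "Z \<subseteq> \<Union>(Oc ` D)" by (metis finite_subset_image)
  have "{c \<in> fib j. \<not> (\<lambda>s. crd j c (f s)) ` topspace ?S \<subseteq> V} \<subseteq> D"
  proof
    fix c assume "c \<in> {c \<in> fib j. \<not> (\<lambda>s. crd j c (f s)) ` topspace ?S \<subseteq> V}"
    then obtain s where c: "c \<in> fib j" and s: "s \<in> topspace ?S" "crd j c (f s) \<notin> V" by blast
    have so: "s \<in> Oc c" using crd_top[OF c s(1)] s V(2) by (auto simp: Oc_def)
    then have "s \<in> Z" using s crd_top[OF c s(1)] rp[OF c so] by (auto simp: Z_def)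
    then obtain c' where "c' \<in> D" "s \<in> Oc c'" using D(3) by blast
    then show "c \<in> D" using disj[OF c _ so] D(2) by blast
  qed
  then show ?thesis using D(1) finite_subset by blast
qed

text \<open>The nonempty open sets on which the coordinates differ from \<open>a j\<close> are
  disjoint, so choosing a basic open set inside each of them is injective.\<close>

lemma countable_suppj: "countable (suppj X A x a y0 n (Phi X A x a y0 n f) j)" (is "countable ?S")
proof -
  define Oc where "Oc c = {s \<in> topspace (nsphere n). crd j c (f s) \<in> topspace (A j) - {a j}}" for c
  obtain B :: "(nat \<Rightarrow> real) set set" where B: "countable B" "topological_basis B" using ex_countable_basis by blast
  have "\<exists>b s. b \<in> B \<and> s \<in> b \<and> s \<in> Oc c \<and> topspace (nsphere n) \<inter> b \<subseteq> Oc c" if c: "c \<in> ?S" for c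
  proof -
    note cf = supp_nonconstant(1)[OF c]
    obtain s where s: "s \<in> topspace (nsphere n)" "crd j c (f s) \<noteq> a j" using supp_nonconstant(2)[OF c] by blast
    have "openin (nsphere n) (Oc c)"
      unfolding Oc_def using crd_based[OF cf] closedin_Hausdorff_singleton[OF haus_A a_in, of j]
      by (intro openin_continuous_map_preimage) (auto simp: based_map_def)
    then have "openin (top_of_set (topspace (nsphere n))) (Oc c)" by (subst (asm) nsphere_eq_top_of_set)
    then obtain T where T: "open T" "Oc c = topspace (nsphere n) \<inter> T" unfolding openin_open by blast
    have so: "s \<in> Oc c"
      using s continuous_map_image_subset_topspace crd_based[OF cf] unfolding Oc_def based_map_def by blast
    then have "s \<in> T" using T(2) by blast
    then obtain b where "b \<in> B" "s \<in> b" "b \<subseteq> T" using B(2) T(1) by (meson topological_basisE)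
    then show ?thesis using so T(2) by blast
  qed
  then obtain b s where bs: "\<And>c. c \<in> ?S \<Longrightarrow> b c \<in> B \<and> s c \<in> b c \<and> s c \<in> Oc c \<and> topspace (nsphere n) \<inter> b c \<subseteq> Oc c"
    by metis
  have "inj_on b ?S"
  proof (rule inj_onI)
    fix c c' assume c: "c \<in> ?S" "c' \<in> ?S" "b c = b c'"
    have cf: "c \<in> fib j" "c' \<in> fib j" using c supp_nonconstant(1) by auto
    have "s c \<in> Oc c" "s c \<in> Oc c'" using bs[OF c(1)] bs[OF c(2)] c(3) by (auto simp: Oc_def)
    then show "c = c'"
      using lift_unique[OF cf(1) crd_neq(1)[OF cf(1), of "f (s c)"] cf(2) crd_neq(1)[OF cf(2), of "f (s c)"]
        crd_neq(2)[OF cf(1), of "f (s c)"]]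
      by (simp add: Oc_def)
  qed
  moreover have "countable (b ` ?S)" 
  proof (rule countable_subset[OF _ B(1)])
    show "b ` ?S \<subseteq> B" using bs by blast
  qed
  ultimately show ?thesis using countable_image_inj_on by blast
qed

text \<open>Any enumeration will do, because for each neighbourhood V of \<open>a j\<close> only
  finitely many coordinates leave V.\<close>

lemma suppj_enumeration:
  assumes "infinite (suppj X A x a y0 n (Phi X A x a y0 n f) j)" (is "infinite ?S")
  shows "\<exists>e h. bij_betw e UNIV ?S \<and> based_map (Hwedge n) wedge_pt (A j) (a j) h \<and>
    (\<forall>i. Phi X A x a y0 n f j (e i) = bclass (nsphere n) sph_base (A j) (a j) (h \<circ> wedge_incl i))"
proof -
  define e where "e = from_nat_into ?S"
  have e: "bij_betw e UNIV ?S" unfolding e_def by (rule bij_betw_from_nat_into[OF countable_suppj assms])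
  have eS: "e i \<in> ?S" for i using e by (auto simp: bij_betw_def)
  then have ef: "e i \<in> fib j" for i using supp_nonconstant(1) by blast
  define m where "m i = (\<lambda>s. crd j (e i) (f s))" for i
  have m: "based_map (nsphere n) sph_base (A j) (a j) (m i)" for i
    unfolding m_def by (rule crd_based[OF ef])
  have "based_map (Hwedge n) wedge_pt (A j) (a j) (wedge_map m)"
  proof (rule based_map_wedge_map[OF m])
    fix V assume V: "openin (A j) V" "a j \<in> V"
    have "e ` {i. \<not> m i ` topspace (nsphere n) \<subseteq> V} \<subseteq> {c \<in> fib j. \<not> (\<lambda>s. crd j c (f s)) ` topspace (nsphere n) \<subseteq> V}"
      unfolding m_def using ef by blast
    then have "finite (e ` {i. \<not> m i ` topspace (nsphere n) \<subseteq> V})"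
      using finite_large_coordinates[OF V] finite_subset by blast
    moreover have "inj_on e {i. \<not> m i ` topspace (nsphere n) \<subseteq> V}"
      by (rule inj_on_subset[OF bij_betw_imp_inj_on[OF e]]) simp
    ultimately show "finite {i. \<not> m i ` topspace (nsphere n) \<subseteq> V}" by (rule finite_imageD)
  qed
  moreover have "wedge_map m \<circ> wedge_incl i = m i" for i
    using wedge_map_incl[of m "a j"] m by (auto simp: based_map_def fun_eq_iff)
  ultimately show ?thesis using e Phi_crd[OF ef] by (intro exI[of _ e] exI[of _ "wedge_map m"]) (auto simp: m_def)
qed

end

end

section \<open>Realising elements\<close>

context adj_metric
begin

interpretation small_rel RR Xs by (rule small_rel_RR)

text \<open>Each s is reached by a path from the base point, and c is transported along its image in
  \<open>A j\<close>. Loops in \<open>A j\<close> act trivially, so the choice of path does not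
  matter, and this independence gives the transport law behind continuity. The last clause turns
  smallness of m into smallness of the lift.\<close>

lemma lift_sphere_map:
  assumes n: "n \<ge> 1" and c: "c \<in> fib j" and m: "based_map (nsphere n) sph_base (A j) (a j) m"
  obtains G where "continuous_map (nsphere n) Yt G" "G sph_base = c"
    "\<And>s. s \<in> topspace (nsphere n) \<Longrightarrow> G s \<in> lift j c \<and> gcov_proj (G s) = incl j (m s)"
    "\<And>U s. (\<And>b. b \<in> m ` topspace (nsphere n) \<Longrightarrow> incl j b \<in> U) \<Longrightarrow> s \<in> topspace (nsphere n) \<Longrightarrow> G s \<in> whisker_nbhd Y c U"
proof -
  let ?S = "nsphere n"
  have cC: "c \<in> Cr" "gcov_proj c = Inl (x j)" using c by (auto simp: fib_iff)
  have mc: "continuous_map ?S (A j) m" and mb: "m sph_base = a j" using m by (auto simp: based_map_def)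
  have "\<forall>s\<in>topspace ?S. \<exists>\<sigma>. pathin ?S \<sigma> \<and> \<sigma> 0 = sph_base \<and> \<sigma> 1 = s"
    using path_connected_space_nsphere[OF n] sph_base_in_nsphere unfolding path_connected_space_def by blast
  then obtain \<sigma> where \<sigma>: "\<forall>s\<in>topspace ?S. pathin ?S (\<sigma> s) \<and> \<sigma> s 0 = sph_base \<and> \<sigma> s 1 = s"
    unfolding bchoice_iff by blast
  define G where "G s = pact Y c (incl j \<circ> (m \<circ> \<sigma> s))" for s
  have mp: "pathin (A j) (m \<circ> \<mu>)" if "pathin ?S \<mu>" for \<mu> using pathin_compose[OF that mc] .
  have G_path: "G s = pact Y c (incl j \<circ> \<delta>)"
    if s: "s \<in> topspace ?S" and \<delta>: "pathin (A j) \<delta>" "\<delta> 0 = a j" "\<delta> 1 = m s" for s \<delta>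
    unfolding G_def using pact_incl_unique[OF cC cC mp _ \<delta>(1,2)] \<sigma> s \<delta>(3) mb by auto
  have G_lift: "G s \<in> lift j c" "gcov_proj (G s) = incl j (m s)" "G s \<in> Cr" if s: "s \<in> topspace ?S" for s
  proof -
    have p: "pathin (A j) (m \<circ> \<sigma> s)" "(m \<circ> \<sigma> s) 0 = a j" "(m \<circ> \<sigma> s) 1 = m s" using \<sigma> s mb mp by auto
    then show "G s \<in> lift j c" unfolding lift_eq[OF c] G_def by blast
    have st: "(incl j \<circ> (m \<circ> \<sigma> s)) 0 = gcov_proj c" using p(2) cC(2) by simp
    show "gcov_proj (G s) = incl j (m s)" "G s \<in> Cr"
      unfolding G_def using proj_pact[OF cC(1) pathin_incl[OF p(1)] st] pact_in_carrier[OF cC(1) pathin_incl[OF p(1)] st] p(3) by (simp_all add: o_def)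
  qed
  show thesis
  proof
    show "G s \<in> lift j c \<and> gcov_proj (G s) = incl j (m s)" if "s \<in> topspace ?S" for s using G_lift that by blast
    have "G sph_base = pact Y c (incl j \<circ> (\<lambda>_. a j))"
      by (rule G_path[OF sph_base_in_nsphere]) (use mb a_in in \<open>auto simp: pathin_def\<close>)
    also have "\<dots> = c" using pact_const[OF cC(1)] cC(2) by (simp add: o_def)
    finally show "G sph_base = c" .
    show "continuous_map ?S Yt G"
    proof (rule continuous_map_lift_gcov[OF locally_path_connected_space_nsphere continuous_map_compose[OF mc continuous_map_incl]])
      fix \<mu> assume \<mu>: "pathin ?S \<mu>"
      then have in01: "\<mu> 0 \<in> topspace ?S" "\<mu> 1 \<in> topspace ?S" using pathin_in_topspace[OF \<mu>] by auto
      have p: "pathin (A j) (m \<circ> \<sigma> (\<mu> 0))" "(m \<circ> \<sigma> (\<mu> 0)) 0 = a j" "(m \<circ> \<sigma> (\<mu> 0)) 1 = m (\<mu> 0)"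
        using \<sigma> in01(1) mb mp by auto
      have st: "(incl j \<circ> (m \<circ> \<sigma> (\<mu> 0))) 0 = gcov_proj c" using p(2) cC(2) by simp
      have "pact Y (G (\<mu> 0)) (incl j \<circ> (m \<circ> \<mu>)) = pact Y c (pcat (incl j \<circ> (m \<circ> \<sigma> (\<mu> 0))) (incl j \<circ> (m \<circ> \<mu>)))"
        unfolding G_def by (rule pact_pact[OF cC(1) pathin_incl[OF p(1)] st pathin_incl[OF mp[OF \<mu>]]]) (use p(3) in simp)
      also have "\<dots> = G (\<mu> 1)"
      proof -
        have "pathin ?S (pcat (\<sigma> (\<mu> 0)) \<mu>)" using \<sigma> in01(1) \<mu> by (intro pathin_pcat) auto
        from mp[OF this] show ?thesis unfolding pcat_comp
          by (intro G_path[symmetric, OF in01(2)]) (use p(2) in simp_all)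
      qed
      finally show "G (\<mu> 1) = pact Y (G (\<mu> 0)) (incl j \<circ> m \<circ> \<mu>)" by (simp add: o_assoc)
    qed (use G_lift in auto)
    fix U s assume U: "\<And>b. b \<in> m ` topspace ?S \<Longrightarrow> incl j b \<in> U" and s: "s \<in> topspace ?S"
    have p: "pathin ?S (\<sigma> s)" "\<sigma> s 0 = sph_base" using \<sigma> s by auto
    have "incl j (m (\<sigma> s t)) \<in> U" if "t \<in> {0..1}" for t
      using U pathin_in_topspace[OF p(1) that] by blast
    then have "pathin (subtopology Y U) (incl j \<circ> (m \<circ> \<sigma> s))"
      using pathin_incl[OF mp[OF p(1)]] by (auto simp: pathin_def continuous_map_in_subtopology)
    moreover have "(incl j \<circ> (m \<circ> \<sigma> s)) 0 = gcov_proj c" using p(2) mb cC(2) by simp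
    ultimately show "G s \<in> whisker_nbhd Y c U" unfolding whisker_nbhd_eq[OF cC(1)] G_def by blast
  qed
qed

lemma conditions_imp_image:
  assumes n: "n \<ge> 1" and g: "g \<in> Gset X A x a y0 n"
    and cpt: "compactin (Xtilde X A x a y0) (Xtilde X A x a y0 closure_of supp X A x a y0 n g)"
    and enum: "\<And>j. finite (suppj X A x a y0 n g j) \<or>
           (\<exists>e h. bij_betw e UNIV (suppj X A x a y0 n g j) \<and> based_map (Hwedge n) wedge_pt (A j) (a j) h \<and>
              (\<forall>i. g j (e i) = bclass (nsphere n) sph_base (A j) (a j) (h \<circ> wedge_incl i)))"
    and countable: "\<And>j. countable (suppj X A x a y0 n g j)"
  shows "g \<in> ImPhi X A x a y0 n"
proof -
  let ?S = "nsphere n" and ?X = "Xtilde X A x a y0"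
  let ?sj = "suppj X A x a y0 n g"
  have sjf: "?sj j \<subseteq> fib j" for j by (auto simp: suppj_def)
  \<comment> \<open>Representatives are chosen jointly for each j: for an infinite support they all
    come from the one map h, so that only finitely many leave a given neighbourhood of
    \<open>a j\<close>.\<close>
  have "\<exists>k. (\<forall>c\<in>?sj j. based_map ?S sph_base (A j) (a j) (k c) \<and> g j c = bclass ?S sph_base (A j) (a j) (k c)) \<and>
     (\<forall>V. openin (A j) V \<longrightarrow> a j \<in> V \<longrightarrow> finite {c \<in> ?sj j. \<not> k c ` topspace ?S \<subseteq> V})" for j
  proof (cases "finite (?sj j)")
    case True
    have "\<forall>c\<in>?sj j. \<exists>k. based_map ?S sph_base (A j) (a j) k \<and> g j c = bclass ?S sph_base (A j) (a j) k"
    proof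
      fix c assume "c \<in> ?sj j"
      then have "g j c \<in> pi_n n (A j) (a j)" using g sjf[of j] unfolding Gset_def by blast
      then show "\<exists>k. based_map ?S sph_base (A j) (a j) k \<and> g j c = bclass ?S sph_base (A j) (a j) k"
        unfolding pi_n_def bclasses_def by blast
    qed
    then obtain k where "\<forall>c\<in>?sj j. based_map ?S sph_base (A j) (a j) (k c) \<and> g j c = bclass ?S sph_base (A j) (a j) (k c)"
      unfolding bchoice_iff by blast
    then show ?thesis using True by (intro exI[of _ k]) auto
  next
    case False
    then obtain e h where e: "bij_betw e UNIV (?sj j)" and h: "based_map (Hwedge n) wedge_pt (A j) (a j) h"
      and gh: "\<And>i. g j (e i) = bclass ?S sph_base (A j) (a j) (h \<circ> wedge_incl i)" using enum[of j] by blast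
    define k where "k c = h \<circ> wedge_incl (inv_into UNIV e c)" for c
    have ke: "e (inv_into UNIV e c) = c" if "c \<in> ?sj j" for c
      using that e by (simp add: bij_betw_def f_inv_into_f)
    have "based_map ?S sph_base (A j) (a j) (h \<circ> wedge_incl i)" for i
      using h continuous_map_compose[OF continuous_map_wedge_incl, of n "A j" h i] by (auto simp: based_map_def wedge_incl_base)
    moreover have "g j c = bclass ?S sph_base (A j) (a j) (k c)" if "c \<in> ?sj j" for c
      using gh[of "inv_into UNIV e c"] ke[OF that] by (simp add: k_def)
    moreover have "finite {c \<in> ?sj j. \<not> k c ` topspace ?S \<subseteq> V}" if V: "openin (A j) V" "a j \<in> V" for V
    proof (rule finite_surj[OF based_map_Hwedge_shrinks[OF h V], of _ e])
      show "{c \<in> ?sj j. \<not> k c ` topspace ?S \<subseteq> V} \<subseteq> e ` {i. \<not> (h \<circ> wedge_incl i) ` topspace ?S \<subseteq> V}"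
      proof
        fix c assume "c \<in> {c \<in> ?sj j. \<not> k c ` topspace ?S \<subseteq> V}"
        then have c: "c \<in> ?sj j" "\<not> k c ` topspace ?S \<subseteq> V" by auto
        then have "inv_into UNIV e c \<in> {i. \<not> (h \<circ> wedge_incl i) ` topspace ?S \<subseteq> V}" by (simp add: k_def)
        then show "c \<in> e ` {i. \<not> (h \<circ> wedge_incl i) ` topspace ?S \<subseteq> V}" using ke[OF c(1)] by (metis imageI)
      qed
    qed
    ultimately show ?thesis by (intro exI[of _ k]) (simp add: k_def)
  qed
  then have "\<forall>j. \<exists>k. (\<forall>c\<in>?sj j. based_map ?S sph_base (A j) (a j) (k c) \<and> g j c = bclass ?S sph_base (A j) (a j) (k c)) \<and>
     (\<forall>V. openin (A j) V \<longrightarrow> a j \<in> V \<longrightarrow> finite {c \<in> ?sj j. \<not> k c ` topspace ?S \<subseteq> V})" by blast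
  then obtain k where k0: "\<forall>j. (\<forall>c\<in>?sj j. based_map ?S sph_base (A j) (a j) (k j c) \<and> g j c = bclass ?S sph_base (A j) (a j) (k j c)) \<and>
     (\<forall>V. openin (A j) V \<longrightarrow> a j \<in> V \<longrightarrow> finite {c \<in> ?sj j. \<not> k j c ` topspace ?S \<subseteq> V})" unfolding choice_iff by blast
  then have kb: "\<And>j c. c \<in> ?sj j \<Longrightarrow> based_map ?S sph_base (A j) (a j) (k j c)"
    and kg: "\<And>j c. c \<in> ?sj j \<Longrightarrow> g j c = bclass ?S sph_base (A j) (a j) (k j c)"
    and kV: "\<And>j V. openin (A j) V \<Longrightarrow> a j \<in> V \<Longrightarrow> finite {c \<in> ?sj j. \<not> k j c ` topspace ?S \<subseteq> V}"
    by blast+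
  \<comment> \<open>Balls are indexed by pairs, since one point c can lie in the supports of several
    j with the same attaching point.\<close>
  define P where "P = Sigma UNIV ?sj"
  have P: "p \<in> P \<longleftrightarrow> snd p \<in> ?sj (fst p)" for p by (cases p) (simp add: P_def)
  have Pf: "snd p \<in> fib (fst p)" if "p \<in> P" for p using that sjf P by blast
  have "countable P" unfolding P_def using countable by (intro countable_SIGMA) auto
  then have inj: "inj_on (to_nat_on P) P" by (rule inj_on_to_nat_on)
  define ix where "ix = to_nat_on P"
  define base where "base = gcov_base Y (Inl y0)"
  define cc where "cc i = (if i \<in> ix ` P then snd (inv_into P ix i) else base)" for i
  have cc: "cc (ix p) = snd p" if "p \<in> P" for p using that inj by (simp add: cc_def ix_def)
  define C where "C = ?X closure_of supp X A x a y0 n g \<union> {base}"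
  have "compactin ?X C"
    unfolding C_def using cpt gcov_base_in(1) by (intro compactin_Un) (auto simp: topspace_Xtilde base_def)
  then have C: "C \<subseteq> Xs" "R_seq_compact C"
    using compactin_subset_topspace[of ?X C] compactin_imp_R_seq_compact by (auto simp: topspace_Xtilde)
  have suppC: "snd p \<in> C" if "p \<in> P" for p
  proof -
    have "snd p \<in> supp X A x a y0 n g" using that P by (auto simp: supp_def suppj_def)
    moreover have "supp X A x a y0 n g \<subseteq> topspace ?X" unfolding topspace_Xtilde using fib_Xs by (auto simp: supp_def)
    ultimately show ?thesis unfolding C_def using closure_of_subset[of "supp X A x a y0 n g" ?X] by blast
  qed
  have ccC: "cc i \<in> C" for i
    using suppC[OF inv_into_into[of i ix P]] by (auto simp: cc_def C_def)
  have baseC: "base \<in> C" by (simp add: C_def)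
  obtain \<gamma> and \<tau> \<rho> :: "nat \<Rightarrow> real" where \<gamma>: "R_continuous {0..1} \<gamma>" "\<gamma> 0 = base"
    and \<tau>: "\<And>i. 0 < \<tau> i - \<rho> i" "\<And>i. \<tau> i + \<rho> i < 1" "\<And>i. 0 < \<rho> i"
    and \<gamma>J: "\<And>i t. \<bar>t - \<tau> i\<bar> \<le> \<rho> i \<Longrightarrow> \<gamma> t = cc i"
    and uniq: "\<And>i k t. \<bar>t - \<tau> i\<bar> \<le> \<rho> i \<Longrightarrow> \<bar>t - \<tau> k\<bar> \<le> \<rho> k \<Longrightarrow> i = k"
    by (rule path_through_sequence[where c=cc, OF C ccC baseC]) blast
  have \<gamma>c: "continuous_map (top_of_set {0..1}) Yt \<gamma>" using \<gamma>(1) by (rule R_continuous_imp_continuous_map)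
  have \<gamma>X: "\<gamma> t \<in> Xs" if t: "t \<in> {0..1}" for t
  proof -
    obtain \<delta> where "\<delta> > 0" "\<forall>t'\<in>{0..1}. \<bar>t' - t\<bar> < \<delta> \<longrightarrow> RR 1 (\<gamma> t) (\<gamma> t')"
      using \<gamma>(1) t zero_less_one unfolding R_continuous_def by blast
    then have "RR 1 (\<gamma> t) (\<gamma> t)" using t by simp
    then show ?thesis by (rule R_carrier)
  qed
  have "\<exists>\<kappa>. continuous_map ?S ?S \<kappa> \<and> homotopic_with (\<lambda>k. k sph_base = sph_base) ?S ?S \<kappa> id \<and>
     (\<forall>s\<in>topspace ?S. \<kappa> s \<noteq> sph_base \<longrightarrow> \<bar>(1 - s 0) / 2 - \<tau> i\<bar> < \<rho> i)" for i
  proof -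
    have "0 < \<tau> i" "\<tau> i < 1" using \<tau>[of i] by auto
    then obtain \<kappa> where "continuous_map ?S ?S \<kappa>" "homotopic_with (\<lambda>k. k sph_base = sph_base) ?S ?S \<kappa> id"
      "\<And>s. s \<in> topspace ?S \<Longrightarrow> \<kappa> s \<noteq> sph_base \<Longrightarrow> \<bar>(1 - s 0) / 2 - \<tau> i\<bar> < \<rho> i"
      by (rule nsphere_pinch[OF n _ _ \<tau>(3)[of i]]) blast
    then show ?thesis by (intro exI[of _ \<kappa>]) simp
  qed
  then have "\<forall>i. \<exists>\<kappa>. continuous_map ?S ?S \<kappa> \<and> homotopic_with (\<lambda>k. k sph_base = sph_base) ?S ?S \<kappa> id \<and>
     (\<forall>s\<in>topspace ?S. \<kappa> s \<noteq> sph_base \<longrightarrow> \<bar>(1 - s 0) / 2 - \<tau> i\<bar> < \<rho> i)" by blast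
  then obtain \<kappa> where \<kappa>0: "\<forall>i. continuous_map ?S ?S (\<kappa> i) \<and> homotopic_with (\<lambda>k. k sph_base = sph_base) ?S ?S (\<kappa> i) id \<and>
     (\<forall>s\<in>topspace ?S. \<kappa> i s \<noteq> sph_base \<longrightarrow> \<bar>(1 - s 0) / 2 - \<tau> i\<bar> < \<rho> i)" unfolding choice_iff by blast
  \<comment> \<open>The height on the sphere, 0 at the base point and parameter of the path
    \<open>\<gamma>\<close>.\<close>
  define pr where "pr s = (1 - s 0) / 2" for s :: "nat \<Rightarrow> real"
  have \<kappa>: "\<And>i. continuous_map ?S ?S (\<kappa> i)" "\<And>i. homotopic_with (\<lambda>k. k sph_base = sph_base) ?S ?S (\<kappa> i) id"
    "\<And>i s. s \<in> topspace ?S \<Longrightarrow> \<not> \<bar>pr s - \<tau> i\<bar> < \<rho> i \<Longrightarrow> \<kappa> i s = sph_base"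
    using \<kappa>0 unfolding pr_def by blast+
  have \<kappa>in: "\<kappa> i s \<in> topspace ?S" if "s \<in> topspace ?S" for i s
    using continuous_map_image_subset_topspace[OF \<kappa>(1)] that by blast
  have prc: "continuous_map ?S euclideanreal pr"
    unfolding pr_def by (intro continuous_map_real_divide continuous_map_diff continuous_map_nsphere_projection continuous_map_const[THEN iffD2]) auto
  have pr01: "pr s \<in> {0..1}" if "s \<in> topspace ?S" for s
    using nsphere_coord_bound[OF that, of 0] by (auto simp: pr_def abs_le_iff)
  define Fb where "Fb s = \<gamma> (pr s)" for s
  have Fbc: "continuous_map ?S Yt Fb"
  proof -
    have "continuous_map ?S (top_of_set {0..1}) pr" using prc pr01 by (auto simp: continuous_map_in_subtopology)
    from continuous_map_compose[OF this \<gamma>c] show ?thesis by (simp add: o_def Fb_def[abs_def])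
  qed
  have "\<forall>p\<in>P. \<exists>G. continuous_map ?S Yt G \<and> G sph_base = snd p \<and>
     (\<forall>s\<in>topspace ?S. G s \<in> lift (fst p) (snd p) \<and> gcov_proj (G s) = incl (fst p) (k (fst p) (snd p) s)) \<and>
     (\<forall>U. (\<forall>b\<in>k (fst p) (snd p) ` topspace ?S. incl (fst p) b \<in> U) \<longrightarrow> (\<forall>s\<in>topspace ?S. G s \<in> whisker_nbhd Y (snd p) U))"
  proof
    fix p assume p: "p \<in> P"
    have "based_map ?S sph_base (A (fst p)) (a (fst p)) (k (fst p) (snd p))" using p P kb by blast
    then obtain G where G: "continuous_map ?S Yt G" "G sph_base = snd p"
      "\<And>s. s \<in> topspace ?S \<Longrightarrow> G s \<in> lift (fst p) (snd p) \<and> gcov_proj (G s) = incl (fst p) (k (fst p) (snd p) s)"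
      "\<And>U s. (\<And>b. b \<in> k (fst p) (snd p) ` topspace ?S \<Longrightarrow> incl (fst p) b \<in> U) \<Longrightarrow> s \<in> topspace ?S \<Longrightarrow>
         G s \<in> whisker_nbhd Y (snd p) U"
      by (rule lift_sphere_map[OF n Pf[OF p]]) blast
    show "\<exists>G. continuous_map ?S Yt G \<and> G sph_base = snd p \<and>
     (\<forall>s\<in>topspace ?S. G s \<in> lift (fst p) (snd p) \<and> gcov_proj (G s) = incl (fst p) (k (fst p) (snd p) s)) \<and>
     (\<forall>U. (\<forall>b\<in>k (fst p) (snd p) ` topspace ?S. incl (fst p) b \<in> U) \<longrightarrow> (\<forall>s\<in>topspace ?S. G s \<in> whisker_nbhd Y (snd p) U))"
      by (intro exI[of _ G] conjI ballI allI impI) (use G in \<open>blast+\<close>)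
  qed
  then obtain G where G0: "\<forall>p\<in>P. continuous_map ?S Yt (G p) \<and> G p sph_base = snd p \<and>
     (\<forall>s\<in>topspace ?S. G p s \<in> lift (fst p) (snd p) \<and> gcov_proj (G p s) = incl (fst p) (k (fst p) (snd p) s)) \<and>
     (\<forall>U. (\<forall>b\<in>k (fst p) (snd p) ` topspace ?S. incl (fst p) b \<in> U) \<longrightarrow> (\<forall>s\<in>topspace ?S. G p s \<in> whisker_nbhd Y (snd p) U))"
    unfolding bchoice_iff by blast
  have G: "\<And>p. p \<in> P \<Longrightarrow> continuous_map ?S Yt (G p)" "\<And>p. p \<in> P \<Longrightarrow> G p sph_base = snd p"
    "\<And>p s. p \<in> P \<Longrightarrow> s \<in> topspace ?S \<Longrightarrow> G p s \<in> lift (fst p) (snd p)"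
    "\<And>p s. p \<in> P \<Longrightarrow> s \<in> topspace ?S \<Longrightarrow> gcov_proj (G p s) = incl (fst p) (k (fst p) (snd p) s)"
    "\<And>p U s. p \<in> P \<Longrightarrow> (\<And>b. b \<in> k (fst p) (snd p) ` topspace ?S \<Longrightarrow> incl (fst p) b \<in> U) \<Longrightarrow> s \<in> topspace ?S \<Longrightarrow>
       G p s \<in> whisker_nbhd Y (snd p) U"
    using G0 by blast+
  define F where "F p = G p \<circ> \<kappa> (ix p)" for p
  define B where "B p = {s \<in> topspace ?S. \<bar>pr s - \<tau> (ix p)\<bar> < \<rho> (ix p)}" for p
  have Bdisj: "p = p'" if "p \<in> P" "p' \<in> P" "s \<in> B p" "s \<in> B p'" for p p' s
  proof -
    have "ix p = ix p'" using uniq[of "pr s" "ix p" "ix p'"] that(3,4) by (simp add: B_def)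
    then show ?thesis using inj that(1,2) by (auto simp: ix_def inj_on_def)
  qed
  have Foff: "F p s = snd p" if "p \<in> P" "s \<in> topspace ?S" "s \<notin> B p" for p s
    using that \<kappa>(3)[of s "ix p"] G(2) by (simp add: F_def B_def)
  \<comment> \<open>The path rests at \<open>snd p\<close> on the closed band, and by
    \<open>Foff\<close> this is the value of \<open>F p\<close> off the open band; so the two maps
    agree on its boundary.\<close>
  have Fbon: "Fb s = snd p" if "p \<in> P" "\<bar>pr s - \<tau> (ix p)\<bar> \<le> \<rho> (ix p)" for p s
    using \<gamma>J[OF that(2)] cc[OF that(1)] by (simp add: Fb_def)
  define f where "f s = (if \<exists>p\<in>P. s \<in> B p then F (THE p. p \<in> P \<and> s \<in> B p) s else Fb s)" for s
  have fB: "f s = F p s" if "p \<in> P" "s \<in> B p" for p s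
  proof -
    have "(THE p. p \<in> P \<and> s \<in> B p) = p" using that Bdisj by blast
    then show ?thesis using that by (auto simp: f_def)
  qed
  have f0: "f s = Fb s" if "s \<notin> (\<Union>p\<in>P. B p)" for s using that by (auto simp: f_def)
  have fc: "continuous_map ?S Yt f"
  proof (rule continuous_map_glue_family[where F=F and Fb=Fb and I=P and B=B])
    show "continuous_map ?S Yt Fb" by fact
    show "continuous_map ?S Yt (F p)" if "p \<in> P" for p
      unfolding F_def by (rule continuous_map_compose[OF \<kappa>(1) G(1)[OF that]])
    have absc: "continuous_map ?S euclideanreal (\<lambda>s. \<bar>pr s - \<tau> i\<bar>)" for i
      by (intro continuous_map_real_abs continuous_map_diff prc continuous_map_const[THEN iffD2]) auto
    have Bop: "openin ?S (B p)" for p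
      using openin_continuous_map_preimage[OF absc, of "{..<\<rho> (ix p)}" "ix p"] by (simp add: B_def)
    then show "openin ?S (B p)" if "p \<in> P" for p by blast
    show "F p s = Fb s" if p: "p \<in> P" and s: "s \<in> ?S closure_of B p" "s \<notin> B p" for p s
    proof -
      have "closedin ?S {s \<in> topspace ?S. \<bar>pr s - \<tau> (ix p)\<bar> \<in> {..\<rho> (ix p)}}"
        by (rule closedin_continuous_map_preimage[OF absc]) auto
      then have "?S closure_of B p \<subseteq> {s \<in> topspace ?S. \<bar>pr s - \<tau> (ix p)\<bar> \<in> {..\<rho> (ix p)}}"
        by (intro closure_of_minimal) (auto simp: B_def)
      then have "s \<in> topspace ?S" "\<bar>pr s - \<tau> (ix p)\<bar> \<le> \<rho> (ix p)" using s(1) by auto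
      then show ?thesis using Foff[OF p _ s(2)] Fbon[OF p] by simp
    qed
    show "f s = F p s" if "p \<in> P" "s \<in> B p" for p s using fB that by blast
    show "f s = Fb s" if "s \<in> topspace ?S" "s \<notin> (\<Union>p\<in>P. B p)" for s using f0 that by blast
    fix s V assume s: "s \<in> topspace ?S" and V: "openin Yt V" "Fb s \<in> V"
    define e where "e = Fb s"
    have eX: "e \<in> Xs" using \<gamma>X pr01[OF s] by (simp add: e_def Fb_def)
    then have eC: "e \<in> Cr" by (rule Xs_Cr)
    obtain z where z: "gcov_proj e = Inl z" using eX by (auto simp: Xs_def)
    obtain U where U: "openin Y U" "gcov_proj e \<in> U" "whisker_nbhd Y e U \<subseteq> V"
      using V openin_gcov[of Y "Inl y0" V] unfolding e_def by blast
    obtain V' N where V': "openin X V'" "z \<in> V'" "\<And>z'. z' \<in> V' \<Longrightarrow> Inl z' \<in> U"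
      "\<And>j b. j \<ge> N \<Longrightarrow> x j \<in> V' \<Longrightarrow> b \<in> topspace (A j) \<Longrightarrow> incl j b \<in> U"
      using openin_Y_nbhd_Inl[OF U(1), of z] U(2) z by auto
    \<comment> \<open>A support point in the whisker set for \<open>U'\<close> has its attaching
      point in \<open>V'\<close>, which is what the choice of N requires.\<close>
    define U' where "U' = U \<inter> {y \<in> topspace Y. q y \<in> V'}"
    have U': "openin Y U'" "gcov_proj e \<in> U'"
      using U V' z gcov_proj_in_topspace[OF eC] openin_continuous_map_preimage[OF continuous_map_q V'(1)]
      by (auto simp: U'_def)
    define W where "W = {w \<in> topspace ?S. Fb w \<in> whisker_nbhd Y e U'}"
    have W: "openin ?S W" "s \<in> W"
    proof -
      show "openin ?S W" unfolding W_def
        by (rule openin_continuous_map_preimage[OF Fbc openin_whisker_nbhd[OF eC U']])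
      show "s \<in> W" using s whisker_refl[OF eC U'(2)] by (simp add: W_def e_def)
    qed
    \<comment> \<open>The exceptional pairs: j is below N and the representative leaves U. For each
      such j they are finitely many by \<open>kV\<close>.\<close>
    define J0 where "J0 = Sigma {j. j < N \<and> Inl (x j) \<in> U}
        (\<lambda>j. {c \<in> ?sj j. \<not> k j c ` topspace ?S \<subseteq> {b \<in> topspace (A j). incl j b \<in> U}})"
    have "finite J0" unfolding J0_def
    proof (rule finite_SigmaI)
      fix j assume j: "j \<in> {j. j < N \<and> Inl (x j) \<in> U}"
      show "finite {c \<in> ?sj j. \<not> k j c ` topspace ?S \<subseteq> {b \<in> topspace (A j). incl j b \<in> U}}"
        by (rule kV[OF openin_continuous_map_preimage[OF continuous_map_incl U(1)]]) (use j a_in in auto)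
    qed auto
    moreover have "F p w \<in> V" if p: "p \<in> P - J0" and w: "w \<in> W \<inter> B p" for p w
    proof -
      let ?j = "fst p" and ?c = "snd p"
      have pP: "p \<in> P" and wS: "w \<in> topspace ?S" using p w by (auto simp: B_def)
      have cj: "?c \<in> ?sj ?j" using pP P by blast
      have cw: "?c \<in> whisker_nbhd Y e U'" using w Fbon[OF pP, of w] by (auto simp: W_def B_def)
      then have "gcov_proj ?c \<in> U'" using whisker_subset[OF eC] by blast
      then have xj: "Inl (x ?j) \<in> U" "x ?j \<in> V'" using Pf[OF pP] by (auto simp: fib_iff U'_def)
      have kin: "k ?j ?c ` topspace ?S \<subseteq> topspace (A ?j)"
        using kb[OF cj] unfolding based_map_def by (intro continuous_map_image_subset_topspace) blast
      have "incl ?j b \<in> U" if b: "b \<in> k ?j ?c ` topspace ?S" for b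
      proof (cases "?j < N")
        case True
        have "\<not> (\<not> k ?j ?c ` topspace ?S \<subseteq> {b \<in> topspace (A ?j). incl ?j b \<in> U})"
          using p True xj(1) cj by (cases p) (auto simp: J0_def)
        then show ?thesis using b by blast
      next
        case False
        then show ?thesis using V'(4)[of ?j b] xj(2) b kin by auto
      qed
      then have "G p (\<kappa> (ix p) w) \<in> whisker_nbhd Y ?c U" by (rule G(5)[OF pP _ \<kappa>in[OF wS]])
      \<comment> \<open>Two whiskers are concatenated: from e to c, and from c into its copy of
        \<open>A j\<close>.\<close>
      moreover have "?c \<in> whisker_nbhd Y e U" using cw whisker_mono[of U' U Y e] by (auto simp: U'_def)
      ultimately show ?thesis using whisker_trans[OF eC] U(3) by (auto simp: F_def)
    qed
    ultimately show "\<exists>W J. openin ?S W \<and> s \<in> W \<and> finite J \<and> (\<forall>i\<in>P - J. \<forall>w\<in>W \<inter> B i. F i w \<in> V)" using W by blast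
  qed
  have pr_base: "pr sph_base = 0" by (simp add: pr_def sph_base_def)
  \<comment> \<open>All bands lie strictly above height 0, so the base point is sent to
    \<open>\<gamma> 0\<close>.\<close>
  have "sph_base \<notin> B p" for p using \<tau>(1)[of "ix p"] pr_base by (auto simp: B_def)
  then have f_base: "f sph_base = base" using f0[of sph_base] pr_base \<gamma>(2) by (simp add: Fb_def)
  \<comment> \<open>Outside the band of (j, c) the point \<open>f s\<close> is over X or in the copy
    of another pair, and different copies are disjoint away from X.\<close>
  have crd_zero: "crd j c (f s) = a j" if c: "c \<in> fib j" and s: "s \<in> topspace ?S" and no: "\<And>p. p \<in> P \<Longrightarrow> s \<in> B p \<Longrightarrow> p \<noteq> (j, c)" for j c s
  proof (rule ccontr)
    assume ne: "crd j c (f s) \<noteq> a j"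
    note l = crd_neq[OF c ne]
    show False
    proof (cases "s \<in> (\<Union>p\<in>P. B p)")
      case True
      then obtain p where p: "p \<in> P" "s \<in> B p" by blast
      have "f s \<in> lift (fst p) (snd p)" using fB[OF p] G(3)[OF p(1) \<kappa>in[OF s]] by (simp add: F_def)
      from lift_unique[OF c l(1) Pf[OF p(1)] this l(2)] have "p = (j, c)" by (cases p) auto
      then show False using no[OF p] by simp
    next
      case False
      then have "f s \<in> Xs" using f0[OF False] \<gamma>X pr01[OF s] by (simp add: Fb_def)
      then show False using l(2) by (auto simp: Xs_def)
    qed
  qed
  have Phi: "Phi X A x a y0 n f j c = g j c" for j c
  proof (cases "c \<in> fib j")
    case False
    then show ?thesis using g by (simp add: Phi_def Gset_def)
  next
    case c: True
    show ?thesis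
    proof (cases "c \<in> ?sj j")
      case True
      define p where "p = (j, c)"
      have p: "p \<in> P" using True P by (simp add: p_def)
      have kjb: "continuous_map ?S (A j) (k j c)" "k j c sph_base = a j" using kb[OF True] by (auto simp: based_map_def)
      have eq: "(k j c \<circ> \<kappa> (ix p)) s = crd j c (f s)" if s: "s \<in> topspace ?S" for s
      proof (cases "s \<in> B p")
        case True
        have "f s \<in> lift j c" "gcov_proj (f s) = incl j (k j c (\<kappa> (ix p) s))"
          using fB[OF p True] G(3,4)[OF p \<kappa>in[OF s]] by (auto simp: F_def p_def)
        moreover have "k j c (\<kappa> (ix p) s) \<in> topspace (A j)"
          using continuous_map_image_subset_topspace[OF kjb(1)] \<kappa>in[OF s] by blast
        ultimately show ?thesis using crd_in[OF c] by simp
      next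
        case False
        then have "\<kappa> (ix p) s = sph_base" using \<kappa>(3)[OF s] s by (simp add: B_def)
        moreover have "crd j c (f s) = a j" using crd_zero[OF c s] False p_def by blast
        ultimately show ?thesis using kjb(2) by simp
      qed
      \<comment> \<open>The pinch is homotopic to the identity through based maps, so squeezing
        \<open>k j c\<close> into its band does not change the class.\<close>
      have h: "homotopic_with (\<lambda>m. m sph_base = a j) ?S (A j) (k j c \<circ> \<kappa> (ix p)) (k j c \<circ> id)"
        by (rule homotopic_with_compose_continuous_map_left[OF \<kappa>(2) kjb(1)]) (simp add: kjb(2))
      have "homotopic_with (\<lambda>m. m sph_base = a j) ?S (A j) (k j c \<circ> \<kappa> (ix p)) (\<lambda>s. crd j c (f s))"
      proof (rule homotopic_with_equal)
        show P1: "(k j c \<circ> \<kappa> (ix p)) sph_base = a j" using homotopic_with_imp_property[OF h] by simp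
        then show "crd j c (f sph_base) = a j" using eq[OF sph_base_in_nsphere] by simp
        show "continuous_map ?S (A j) (k j c \<circ> \<kappa> (ix p))" using homotopic_with_imp_continuous_maps[OF h] by simp
      qed (rule eq)
      from bclass_eqI[OF this] bclass_eqI[OF h]
      have "bclass ?S sph_base (A j) (a j) (\<lambda>s. crd j c (f s)) = bclass ?S sph_base (A j) (a j) (k j c \<circ> id)" by simp
      then show ?thesis unfolding Phi_crd[OF c] using kg[OF True] by simp
    next
      case False
      then have gz: "g j c = pi_zero n (A j) (a j)" using c by (simp add: suppj_def)
      have z: "crd j c (f s) = a j" if "s \<in> topspace ?S" for s
        by (rule crd_zero[OF c that]) (use False P in auto)
      have "homotopic_with (\<lambda>m. m sph_base = a j) ?S (A j) (\<lambda>_. a j) (\<lambda>s. crd j c (f s))"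
        by (rule homotopic_with_equal) (use z sph_base_in_nsphere a_in in auto)
      from bclass_eqI[OF this] show ?thesis unfolding Phi_crd[OF c] gz pi_zero_def by simp
    qed
  qed
  have "based_map ?S sph_base Yt (gcov_base Y (Inl y0)) f"
    using fc f_base by (simp add: based_map_def base_def)
  moreover have "g = Phi X A x a y0 n f" using Phi by (intro ext) simp
  ultimately show ?thesis unfolding ImPhi_def by blast
qed

end

theorem theorem6p20:
  fixes n :: nat and X :: "'a topology" and y0 :: 'a and x :: "nat \<Rightarrow> 'a"
    and A :: "nat \<Rightarrow> 'b topology" and a :: "nat \<Rightarrow> 'b"
    and g :: "nat \<Rightarrow> (real \<Rightarrow> 'a + nat \<times> 'b) set \<Rightarrow> ((nat \<Rightarrow> real) \<Rightarrow> 'b) set"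
  assumes "n \<ge> 2"
    and "Hausdorff_space X" and "peano_continuum X" and "one_dimensional X"
    and "y0 \<in> topspace X" and "\<And>j. x j \<in> topspace X"
    and "\<And>j. Hausdorff_space (A j)" and "\<And>j. a j \<in> topspace (A j)"
    and "\<And>j. seq_connected (n - 1) (A j) (a j)"
    and "\<And>j. pi_residual n (A j) (a j)"
    and "g \<in> Gset X A x a y0 n"
  shows "g \<in> ImPhi X A x a y0 n \<longleftrightarrow>
    (compactin (Xtilde X A x a y0) (Xtilde X A x a y0 closure_of supp X A x a y0 n g) \<and>
     (\<forall>j. finite (suppj X A x a y0 n g j) \<or>
          (infinite (suppj X A x a y0 n g j) \<and> countable (suppj X A x a y0 n g j) \<and>
           (\<exists>e h. bij_betw e UNIV (suppj X A x a y0 n g j) \<and>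
                  based_map (Hwedge n) wedge_pt (A j) (a j) h \<and>
                  (\<forall>i. g j (e i) = bclass (nsphere n) sph_base (A j) (a j) (h \<circ> wedge_incl i))))))"
proof -
  have "metrizable_space X" using assms(3) by (simp add: peano_continuum_def)
  then obtain M d where M: "Metric_space M d" "X = Metric_space.mtopology M d" unfolding metrizable_space_def by blast
  then have top: "M = topspace X" using Metric_space.topspace_mtopology[OF M(1)] by simp
  \<comment> \<open>The bound on n puts k = 1 into the range of
    \<open>seq_connected (n - 1)\<close>.\<close>
  have n1: "1 \<in> {1..n - 1}" using assms(1) by simp
  have sing: "is_singleton (bclasses (Hwedge 1) wedge_pt (A j) (a j))" for j
    using assms(9)[of j] n1 unfolding seq_connected_def by blast
  interpret adj_metric X A x a d y0
  proof (intro adj_metric.intro adj_sc.intro adj_data.intro adj_sc_axioms.intro adj_metric_axioms.intro)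
    show "Metric_space (topspace X) d" using M(1) by (simp only: top)
    show "Metric_space.mtopology (topspace X) d = X" using M(2) by (simp only: top)
  qed (fact assms(2) assms(5) assms(6) assms(7) assms(8) sing)+
  have n: "n \<ge> 1" using assms(1) by simp
  show ?thesis
  proof
    assume "g \<in> ImPhi X A x a y0 n"
    then obtain f where f: "continuous_map (nsphere n) Yt f" and gf: "g = Phi X A x a y0 n f"
      by (auto simp: ImPhi_def based_map_def)
    \<comment> \<open>Through this membership the hypothesis on g supplies continuity of the
      coordinates of f.\<close>
    have G: "Phi X A x a y0 n f \<in> Gset X A x a y0 n" using assms(11) gf by simp
    show "compactin (Xtilde X A x a y0) (Xtilde X A x a y0 closure_of supp X A x a y0 n g) \<and>
     (\<forall>j. finite (suppj X A x a y0 n g j) \<or>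
          (infinite (suppj X A x a y0 n g j) \<and> countable (suppj X A x a y0 n g j) \<and>
           (\<exists>e h. bij_betw e UNIV (suppj X A x a y0 n g j) \<and>
                  based_map (Hwedge n) wedge_pt (A j) (a j) h \<and>
                  (\<forall>i. g j (e i) = bclass (nsphere n) sph_base (A j) (a j) (h \<circ> wedge_incl i)))))"
      unfolding gf using closure_supp_compact[OF n f G] countable_suppj[OF n f G] suppj_enumeration[OF n f G] by blast
  next
    assume R: "compactin (Xtilde X A x a y0) (Xtilde X A x a y0 closure_of supp X A x a y0 n g) \<and>
     (\<forall>j. finite (suppj X A x a y0 n g j) \<or>
          (infinite (suppj X A x a y0 n g j) \<and> countable (suppj X A x a y0 n g j) \<and>
           (\<exists>e h. bij_betw e UNIV (suppj X A x a y0 n g j) \<and>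
                  based_map (Hwedge n) wedge_pt (A j) (a j) h \<and>
                  (\<forall>i. g j (e i) = bclass (nsphere n) sph_base (A j) (a j) (h \<circ> wedge_incl i)))))"
    show "g \<in> ImPhi X A x a y0 n"
    proof (rule conditions_imp_image[OF n assms(11)])
      \<comment> \<open>Condition (2) states countability in the infinite case only.\<close>
      show "countable (suppj X A x a y0 n g j)" for j using R countable_finite by blast
    qed (use R in blast)+
  qed
qed

end
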